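(* Let $P$ be a simple $\mathcal{K}_n$-module. Then the following statements hold. (a) The $\mathbb{S}_n$-module $\mathcal{F}(P,V(\delta_0))$ is irreducible if and only if $\mathfrak{h}P=P$. (b) The $\mathbb{S}_n$-module $\mathcal{F}(P,V(\delta_k))$ is not irreducible for $1\le k\le n-1$. (c) If $P\not\cong A_n$, then $\mathcal{F}(P,V(\delta_0))$ has a unique simple $\mathbb{S}_n$-submodule, namely $\mathfrak{h}\mathcal{F}(P,V(\delta_0))$, and any nonzero submodule is of the form $P'\otimes V(\delta_0)$, where $P'$ is a subspace with $\mathfrak{h}P\subseteq P'\subseteq P$. If $P\cong A_n$, then $\mathcal{F}(P,V(\delta_0))\cong A_n'\oplus\mathbb{C}$ as $\mathbb{S}_n$-modules. (d) If $P\not\cong A_n$, then $\mathcal{L}_n(P,1)$ has a unique simple $\mathbb{S}_n$-submodule, namely $\mathfrak{h}\mathcal{L}_n(P,1)$. If $P\cong A_n$, then $\mathcal{L}_n(P,1)=\mathfrak{h}\mathcal{L}_n(P,1)\cong A_n'$ as $\mathbb{S}_n$-modules. In particular, $\mathcal{L}_n(P,1)$ is simple if and only if $\mathfrak{h}P=P$ or $P\cong A_n$. (e) For $n\ge 3$ and $2\le k\le n-1$, the $\mathbb{S}_n$-module $\mathcal{L}_n(P,k)$ is simple for any simple $\mathcal{K}_n$-module $P$. Consequently, $\widetilde{\mathcal{L}}_n(P,k)$ is a maximal $\mathbb{S}_n$-submodule of $\mathcal{F}(P,V(\delta_k))$.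
   Context: All algebras and vector spaces are over $\mathbb{C}$, and $n\ge 2$ is a fixed integer. Let $A_n=\mathbb{C}[x_1^{\pm1},\dots,x_n^{\pm1}]$, $\partial_i=x_i\frac{\partial}{\partial x_i}$, and $x^r=x_1^{r_1}\cdots x_n^{r_n}$ for $r=(r_1,\dots,r_n)^T\in\mathbb{Z}^n$. Let $\mathcal{K}_n$ be the Weyl algebra over $A_n$, i.e. the (unital associative) algebra of differential operators on $A_n$ generated by $A_n$ and $\partial_1,\dots,\partial_n$; $A_n$ is its natural module, and $P\cong A_n$ means isomorphic as $\mathcal{K}_n$-modules. Elements of $\mathbb{C}^n$ and $\mathbb{Z}^n$ are column vectors, $(u|v)=u^Tv$, and $e_1,\dots,e_n$ is the standard basis of $\mathbb{C}^n$. For $u=(u_1,\dots,u_n)^T\in\mathbb{C}^n$ and $r\in\mathbb{Z}^n$ put $D(u,r)=x^r\sum_{i=1}^n u_i\partial_i$; these span the Witt algebra $W_n=\mathrm{Der}(A_n)$, with $[D(u,r),D(v,s)]=D(w,r+s)$, $w=(u|s)v-(v|r)u$. The Lie algebra of divergence zero vector fields on an $n$-dimensional torus is the Lie subalgebra $$\mathbb{S}_n=\mathrm{span}\{D(u,r)\mid u\in\mathbb{C}^n,\ r\in\mathbb{Z}^n,\ (u|r)=0\}\subseteq W_n ,$$ with Cartan subalgebra $\mathfrak{h}=\mathrm{span}\{\partial_1,\dots,\partial_n\}$. For a space $M$ on which $\mathfrak{h}$ acts, $\mathfrak{h}M=\sum_{i=1}^n\partial_iM$. For $0\le k\le n$ let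 $V(\delta_k)=\bigwedge^k(\mathbb{C}^n)$ (with $\bigwedge^0(\mathbb{C}^n)=\mathbb{C}$ and $v\wedge a=av$ for $v\in\mathbb{C}^n$, $a\in\mathbb{C}$), with its natural $\mathfrak{gl}_n$-module structure, so that the identity matrix acts as the scalar $k$. For a $\mathcal{K}_n$-module $P$, let $\mathcal{F}(P,V(\delta_k))=P\otimes V(\delta_k)$ with the $W_n$-action $$D(u,r)(z\otimes y)=D(u,r)z\otimes y+x^rz\otimes (ru^T)y,\qquad z\in P,\ y\in V(\delta_k),\ u\in\mathbb{C}^n,\ r\in\mathbb{Z}^n,$$ where $ru^T\in\mathfrak{gl}_n$; by restriction it is an $\mathbb{S}_n$-module. For $0\le k\le n-1$ the linear map $$d_k:\mathcal{F}(P,V(\delta_k))\to\mathcal{F}(P,V(\delta_{k+1})),\qquad p\otimes w\mapsto\sum_{i=1}^n(\partial_ip)\otimes(e_i\wedge w)$$ is a $W_n$-module homomorphism. Define $\mathcal{L}_n(P,k)=\mathrm{im}(d_{k-1})\subseteq\mathcal{F}(P,V(\delta_k))$ for $1\le k\le n-1$, $\mathcal{L}_n(P,0)=0$, and $$\widetilde{\mathcal{L}}_n(P,k)=\{y\in\mathcal{F}(P,V(\delta_k))\mid W_ny\subseteq\mathcal{L}_n(P,k)\},\qquad 0\le k\le n-1 .$$ The $\mathbb{S}_n$-module $A_n'=\sum_{r\in\mathbb{Z}^n\setminus\{0\}}\mathbb{C}x^r$ is a submodule of $A_n$ (with $\mathbb{S}_n$ acting on $A_n$ by derivations), and $\mathbb{C}$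 denotes the trivial one-dimensional $\mathbb{S}_n$-module. *)

theory Defs
  imports
    "HOL-Analysis.Analysis"
    "HOL-Library.Poly_Mapping"
    "HOL-Library.Function_Algebras"
begin

text \<open>
  Throughout, n is \<open>CARD('n)\<close>. The complex vector spaces are abelian groups with an
  explicit scalar multiplication, as in the locale \<open>vector_space\<close>.
\<close>

section \<open>Modules over a set of operators\<close>

text \<open>
  A module over an algebra or a Lie algebra \<open>L\<close> is a subset \<open>M\<close> of an ambient vector space,
  together with an action map \<open>act\<close>. These notions make sense for any set \<open>L\<close> and
  are used both for \<open>L\<close> an associative algebra and for \<open>L\<close> a Lie algebra.
\<close>

definition submodule ::
  "(complex \<Rightarrow> 'm \<Rightarrow> 'm) \<Rightarrow> 'l set \<Rightarrow> ('l \<Rightarrow> 'm \<Rightarrow> 'm) \<Rightarrow> 'm::ab_group_add set \<Rightarrow> 'm set \<Rightarrow> bool"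
  where "submodule sc L act N M \<longleftrightarrow>
    module.subspace sc N \<and> N \<subseteq> M \<and> (\<forall>a\<in>L. \<forall>y\<in>N. act a y \<in> N)"

definition simple_module ::
  "(complex \<Rightarrow> 'm \<Rightarrow> 'm) \<Rightarrow> 'l set \<Rightarrow> ('l \<Rightarrow> 'm \<Rightarrow> 'm) \<Rightarrow> 'm::ab_group_add set \<Rightarrow> bool"
  where "simple_module sc L act M \<longleftrightarrow>
    submodule sc L act M M \<and> M \<noteq> {0} \<and>
    (\<forall>N. submodule sc L act N M \<longrightarrow> N = {0} \<or> N = M)"

definition maximal_submodule ::
  "(complex \<Rightarrow> 'm \<Rightarrow> 'm) \<Rightarrow> 'l set \<Rightarrow> ('l \<Rightarrow> 'm \<Rightarrow> 'm) \<Rightarrow> 'm::ab_group_add set \<Rightarrow> 'm set \<Rightarrow> bool"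
  where "maximal_submodule sc L act N M \<longleftrightarrow>
    submodule sc L act N M \<and> N \<noteq> M \<and>
    (\<forall>N'. submodule sc L act N' M \<and> N \<subseteq> N' \<longrightarrow> N' = N \<or> N' = M)"

definition unique_simple_submodule ::
  "(complex \<Rightarrow> 'm \<Rightarrow> 'm) \<Rightarrow> 'l set \<Rightarrow> ('l \<Rightarrow> 'm \<Rightarrow> 'm) \<Rightarrow> 'm::ab_group_add set \<Rightarrow> 'm set \<Rightarrow> bool"
  where "unique_simple_submodule sc L act N M \<longleftrightarrow>
    (\<forall>N'. submodule sc L act N' M \<and> simple_module sc L act N' \<longleftrightarrow> N' = N)"

definition isomorphic_modules ::
  "'l set \<Rightarrow> (complex \<Rightarrow> 'a \<Rightarrow> 'a) \<Rightarrow> ('l \<Rightarrow> 'a \<Rightarrow> 'a) \<Rightarrow> 'a::ab_group_add set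
    \<Rightarrow> (complex \<Rightarrow> 'b \<Rightarrow> 'b) \<Rightarrow> ('l \<Rightarrow> 'b \<Rightarrow> 'b) \<Rightarrow> 'b::ab_group_add set \<Rightarrow> bool"
  where "isomorphic_modules L sc1 act1 M1 sc2 act2 M2 \<longleftrightarrow>
    (\<exists>\<phi>. bij_betw \<phi> M1 M2 \<and>
      (\<forall>x\<in>M1. \<forall>y\<in>M1. \<phi> (x + y) = \<phi> x + \<phi> y) \<and>
      (\<forall>c. \<forall>x\<in>M1. \<phi> (sc1 c x) = sc2 c (\<phi> x)) \<and>
      (\<forall>a\<in>L. \<forall>x\<in>M1. \<phi> (act1 a x) = act2 a (\<phi> x)))"

definition fscale :: "(complex \<Rightarrow> 'm \<Rightarrow> 'm) \<Rightarrow> complex \<Rightarrow> ('i \<Rightarrow> 'm) \<Rightarrow> 'i \<Rightarrow> 'm"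
  where "fscale sc c g = (\<lambda>l. sc c (g l))"


section \<open>Laurent polynomials, the Weyl algebra and the Witt algebra\<close>

text \<open>The group algebra of \<open>\<int>\<^sup>n\<close> with the convolution product of \<^theory>\<open>HOL-Library.Poly_Mapping\<close>.\<close>

type_synonym 'n laurent = "(int ^ 'n) \<Rightarrow>\<^sub>0 complex"

definition monomial :: "int ^ 'n \<Rightarrow> 'n::finite laurent"
  where "monomial r = Poly_Mapping.single r 1"

definition lscale :: "complex \<Rightarrow> 'n::finite laurent \<Rightarrow> 'n laurent"
  where "lscale c f = Poly_Mapping.single 0 c * f"

definition partial :: "'n \<Rightarrow> 'n::finite laurent \<Rightarrow> 'n laurent"
  where "partial i f = Poly_Mapping.mapp (\<lambda>r c. of_int (r $ i) * c) f"

inductive_set weyl_algebra :: "('n::finite laurent \<Rightarrow> 'n laurent) set"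
  where
    mult: "(\<lambda>f. g * f) \<in> weyl_algebra"
  | partial: "partial i \<in> weyl_algebra"
  | add: "\<lbrakk>a \<in> weyl_algebra; b \<in> weyl_algebra\<rbrakk> \<Longrightarrow> (\<lambda>f. a f + b f) \<in> weyl_algebra"
  | comp: "\<lbrakk>a \<in> weyl_algebra; b \<in> weyl_algebra\<rbrakk> \<Longrightarrow> a \<circ> b \<in> weyl_algebra"

text \<open>
  A (left, unital) module over the Weyl algebra whose underlying space is the whole type
  \<open>'p\<close>, given as a unital algebra homomorphism into the linear endomorphisms.
\<close>

locale weyl_module = vector_space sc
  for sc :: "complex \<Rightarrow> 'p::ab_group_add \<Rightarrow> 'p" +
  fixes \<rho> :: "('n::finite laurent \<Rightarrow> 'n laurent) \<Rightarrow> 'p \<Rightarrow> 'p"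
  assumes rho_linear: "a \<in> weyl_algebra \<Longrightarrow> Vector_Spaces.linear sc sc (\<rho> a)"
    and rho_add: "\<lbrakk>a \<in> weyl_algebra; b \<in> weyl_algebra\<rbrakk> \<Longrightarrow> \<rho> (\<lambda>f. a f + b f) z = \<rho> a z + \<rho> b z"
    and rho_scale: "a \<in> weyl_algebra \<Longrightarrow> \<rho> (\<lambda>f. lscale c (a f)) z = sc c (\<rho> a z)"
    and rho_comp: "\<lbrakk>a \<in> weyl_algebra; b \<in> weyl_algebra\<rbrakk> \<Longrightarrow> \<rho> (a \<circ> b) z = \<rho> a (\<rho> b z)"
    and rho_id: "\<rho> id z = z"

definition isomorphic_to_A ::
  "(complex \<Rightarrow> 'p \<Rightarrow> 'p) \<Rightarrow> (('n::finite laurent \<Rightarrow> 'n laurent) \<Rightarrow> 'p \<Rightarrow> 'p::ab_group_add) \<Rightarrow> bool"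
  where "isomorphic_to_A sc \<rho> \<longleftrightarrow>
    isomorphic_modules weyl_algebra sc \<rho> UNIV lscale (\<lambda>a f. a f) UNIV"

definition dual_pairing :: "complex ^ 'n \<Rightarrow> int ^ 'n \<Rightarrow> complex"
  where "dual_pairing u r = (\<Sum>i\<in>UNIV. u $ i * of_int (r $ i))"

definition D :: "complex ^ 'n \<Rightarrow> int ^ 'n \<Rightarrow> 'n::finite laurent \<Rightarrow> 'n laurent"
  where "D u r f = monomial r * (\<Sum>i\<in>UNIV. lscale (u $ i) (partial i f))"

definition witt_algebra :: "('n::finite laurent \<Rightarrow> 'n laurent) set"
  where "witt_algebra = {\<delta>. Vector_Spaces.linear lscale lscale \<delta> \<and>
    (\<forall>f g. \<delta> (f * g) = \<delta> f * g + f * \<delta> g)}"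

definition div_zero_algebra :: "('n::finite laurent \<Rightarrow> 'n laurent) set"
  where "div_zero_algebra = module.span (fscale lscale) {D u r | u r. dual_pairing u r = 0}"

text \<open>
  Every derivation \<open>\<delta>\<close> is the finite sum of the \<open>D (witt_coeff \<delta> r) r\<close>; see
  \<open>witt_expansion\<close> below.
\<close>

definition witt_coeff :: "('n::finite laurent \<Rightarrow> 'n laurent) \<Rightarrow> int ^ 'n \<Rightarrow> complex ^ 'n"
  where "witt_coeff \<delta> r =
    (\<chi> i. Poly_Mapping.lookup (\<delta> (monomial (axis i 1))) (r + axis i 1))"

definition witt_support :: "('n::finite laurent \<Rightarrow> 'n laurent) \<Rightarrow> (int ^ 'n) set"
  where "witt_support \<delta> = {r. witt_coeff \<delta> r \<noteq> 0}"

text \<open>\<open>\<hh>M\<close>, for a module on which the derivations \<open>\<partial>\<^sub>i\<close> act through \<open>act\<close>.\<close>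

definition cartan_image ::
  "(('n::finite laurent \<Rightarrow> 'n laurent) \<Rightarrow> 'm \<Rightarrow> 'm::ab_group_add) \<Rightarrow> 'm set \<Rightarrow> 'm set"
  where "cartan_image act M = {\<Sum>i\<in>UNIV. act (partial i) (m i) | m. \<forall>i. m i \<in> M}"

definition A_prime :: "'n::finite laurent set"
  where "A_prime = module.span lscale {monomial r | r. r \<noteq> 0}"

text \<open>The ambient scalar multiplication and action for the direct sum of \<open>A_prime\<close> and the
  trivial module.\<close>

definition A_C_scale :: "complex \<Rightarrow> 'n::finite laurent \<times> complex \<Rightarrow> 'n laurent \<times> complex"
  where "A_C_scale c = (\<lambda>(f, a). (lscale c f, c * a))"

definition A_C_act ::
  "('n::finite laurent \<Rightarrow> 'n laurent) \<Rightarrow> 'n laurent \<times> complex \<Rightarrow> 'n laurent \<times> complex"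
  where "A_C_act \<delta> = (\<lambda>(f, a). (\<delta> f, 0))"


section \<open>Exterior powers and tensor modules\<close>

text \<open>
  The \<open>k\<close>-th exterior power of \<open>\<complex>\<^sup>n\<close> is realised in the \<open>k\<close>-th tensor power as the space of
  alternating tensors. A tensor is given by its coefficients, indexed by the lists
  \<open>[i\<^sub>1, \<dots>, i\<^sub>k]\<close> of length \<open>k\<close>; the wedge product is normalised so that
  \<open>e\<^sub>i\<^sub>1 \<and> \<dots> \<and> e\<^sub>i\<^sub>k\<close> is the signed sum of the permuted tensors
  \<open>e\<^sub>i\<^sub>1 \<otimes> \<dots> \<otimes> e\<^sub>i\<^sub>k\<close>, and the action of a matrix is that on tensors.
  The operators \<open>wedge\<close> and \<open>gl_act\<close> are defined for coefficients in an arbitrary vector space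
  \<open>P\<close>, where they are the operators \<open>id\<^sub>P \<otimes> (v \<and> _)\<close> and \<open>id\<^sub>P \<otimes> X\<close>; the exterior power itself
  is the case \<open>P = \<complex>\<close>.
\<close>

definition exterior_power :: "nat \<Rightarrow> ('n::finite list \<Rightarrow> complex) set"
  where "exterior_power k = {y. (\<forall>l. length l \<noteq> k \<longrightarrow> y l = 0) \<and>
    (\<forall>xs a b ys. y (xs @ b # a # ys) = - y (xs @ a # b # ys))}"

definition wedge ::
  "(complex \<Rightarrow> 'm \<Rightarrow> 'm) \<Rightarrow> complex ^ 'n \<Rightarrow> ('n list \<Rightarrow> 'm) \<Rightarrow> 'n::finite list \<Rightarrow> 'm::ab_group_add"
  where "wedge sc v g l =
    (\<Sum>j<length l. sc ((-1) ^ j * v $ (l ! j)) (g (take j l @ drop (Suc j) l)))"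

definition gl_act ::
  "(complex \<Rightarrow> 'm \<Rightarrow> 'm) \<Rightarrow> complex ^ 'n ^ 'n \<Rightarrow> ('n list \<Rightarrow> 'm) \<Rightarrow> 'n::finite list \<Rightarrow> 'm::ab_group_add"
  where "gl_act sc X g l = (\<Sum>j<length l. \<Sum>b\<in>UNIV. sc (X $ (l ! j) $ b) (g (l[j := b])))"

text \<open>
  Since \<open>exterior_power k\<close> consists of functions supported on a fixed finite set, its tensor product
  with \<open>P\<close> can be taken inside the \<open>P\<close>-valued functions.
\<close>

definition pure_tensor :: "(complex \<Rightarrow> 'p \<Rightarrow> 'p) \<Rightarrow> 'p \<Rightarrow> ('i \<Rightarrow> complex) \<Rightarrow> 'i \<Rightarrow> 'p"
  where "pure_tensor sc p y = (\<lambda>l. sc (y l) p)"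

definition tensor_product ::
  "(complex \<Rightarrow> 'p \<Rightarrow> 'p) \<Rightarrow> 'p::ab_group_add set \<Rightarrow> ('i \<Rightarrow> complex) set \<Rightarrow> ('i \<Rightarrow> 'p) set"
  where "tensor_product sc P V =
    module.span (fscale sc) {pure_tensor sc p y | p y. p \<in> P \<and> y \<in> V}"

definition F_mod :: "(complex \<Rightarrow> 'p \<Rightarrow> 'p) \<Rightarrow> nat \<Rightarrow> ('n::finite list \<Rightarrow> 'p::ab_group_add) set"
  where "F_mod sc k = tensor_product sc UNIV (exterior_power k)"

definition outer :: "int ^ 'n \<Rightarrow> complex ^ 'n \<Rightarrow> complex ^ 'n ^ 'n"
  where "outer r u = (\<chi> i j. of_int (r $ i) * u $ j)"

text \<open>The action of \<open>D u r\<close> on tensor modules, and its linear extension to all derivations.\<close>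

definition F_D ::
  "(complex \<Rightarrow> 'p \<Rightarrow> 'p) \<Rightarrow> (('n::finite laurent \<Rightarrow> 'n laurent) \<Rightarrow> 'p \<Rightarrow> 'p::ab_group_add)
    \<Rightarrow> complex ^ 'n \<Rightarrow> int ^ 'n \<Rightarrow> ('n list \<Rightarrow> 'p) \<Rightarrow> 'n list \<Rightarrow> 'p"
  where "F_D sc \<rho> u r g = (\<lambda>l.
    \<rho> (D u r) (g l) + \<rho> (\<lambda>f. monomial r * f) (gl_act sc (outer r u) g l))"

definition F_act ::
  "(complex \<Rightarrow> 'p \<Rightarrow> 'p) \<Rightarrow> (('n::finite laurent \<Rightarrow> 'n laurent) \<Rightarrow> 'p \<Rightarrow> 'p::ab_group_add)
    \<Rightarrow> ('n laurent \<Rightarrow> 'n laurent) \<Rightarrow> ('n list \<Rightarrow> 'p) \<Rightarrow> 'n list \<Rightarrow> 'p"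
  where "F_act sc \<rho> \<delta> g = (\<Sum>r\<in>witt_support \<delta>. F_D sc \<rho> (witt_coeff \<delta> r) r g)"

definition d_map ::
  "(complex \<Rightarrow> 'p \<Rightarrow> 'p) \<Rightarrow> (('n::finite laurent \<Rightarrow> 'n laurent) \<Rightarrow> 'p \<Rightarrow> 'p::ab_group_add)
    \<Rightarrow> ('n list \<Rightarrow> 'p) \<Rightarrow> 'n list \<Rightarrow> 'p"
  where "d_map sc \<rho> g = (\<Sum>i\<in>UNIV. wedge sc (axis i 1) (\<lambda>l. \<rho> (partial i) (g l)))"

definition L_mod ::
  "(complex \<Rightarrow> 'p \<Rightarrow> 'p) \<Rightarrow> (('n::finite laurent \<Rightarrow> 'n laurent) \<Rightarrow> 'p \<Rightarrow> 'p::ab_group_add)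
    \<Rightarrow> nat \<Rightarrow> ('n list \<Rightarrow> 'p) set"
  where "L_mod sc \<rho> k = (if k = 0 then {0} else d_map sc \<rho> ` F_mod sc (k - 1))"

definition L_tilde ::
  "(complex \<Rightarrow> 'p \<Rightarrow> 'p) \<Rightarrow> (('n::finite laurent \<Rightarrow> 'n laurent) \<Rightarrow> 'p \<Rightarrow> 'p::ab_group_add)
    \<Rightarrow> nat \<Rightarrow> ('n list \<Rightarrow> 'p) set"
  where "L_tilde sc \<rho> k =
    {y \<in> F_mod sc k. \<forall>\<delta>\<in>witt_algebra. F_act sc \<rho> \<delta> y \<in> L_mod sc \<rho> k}"


section \<open>Agreement with the usual formulas\<close>

subsection \<open>Derivations of Laurent polynomials\<close>

lemma laurent_induct [case_names single add]:
  assumes "\<And>r c. Q (Poly_Mapping.single r c)" "\<And>f g. Q f \<Longrightarrow> Q g \<Longrightarrow> Q (f + g)"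
  shows "Q (f :: 'n::finite laurent)"
proof (induction f rule: Poly_Mapping.update_induct)
  case const
  show ?case using assms(1)[of 0 0] by simp
next
  case (update f k v)
  have "Poly_Mapping.update k v f = f + Poly_Mapping.single k v"
    using update(1)
    by (intro poly_mapping_eqI)
       (auto simp: lookup_update lookup_add lookup_single in_keys_iff when_def)
  then show ?case using assms update by simp
qed

lemma lookup_partial [simp]:
  "Poly_Mapping.lookup (partial i f) r = of_int (r $ i) * Poly_Mapping.lookup f r"
  by (auto simp: partial_def lookup_mapp in_keys_iff when_def)

lemma lookup_lscale [simp]: "Poly_Mapping.lookup (lscale c f) r = c * Poly_Mapping.lookup f r"
  by (simp add: lscale_def mult_map_scale_conv_mult[symmetric] Poly_Mapping.map.rep_eq when_def)

lemma vector_space_lscale: "vector_space lscale"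
  by unfold_locales (auto intro!: poly_mapping_eqI simp: lookup_add algebra_simps)

lemma vector_space_fscale: "vector_space sc \<Longrightarrow> vector_space (fscale sc)"
  by (auto simp: vector_space_def fscale_def fun_eq_iff)

lemma lscale_mult_left: "lscale c f * g = lscale c (f * g)"
  and lscale_mult_right: "f * lscale c g = lscale c (f * g)"
  by (simp_all add: lscale_def mult_ac)

lemma lookup_monomial_mult [simp]:
  "Poly_Mapping.lookup (monomial r * f) (r + s) = Poly_Mapping.lookup f s"
  by (induction f rule: laurent_induct)
     (auto simp: monomial_def mult_single lookup_single when_def distrib_left lookup_add)

lemma partial_add: "partial i (f + g) = partial i f + partial i g"
  by (intro poly_mapping_eqI) (simp add: lookup_add algebra_simps)

lemma partial_lscale: "partial i (lscale c f) = lscale c (partial i f)"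
  by (intro poly_mapping_eqI) simp

lemma partial_single:
  "partial i (Poly_Mapping.single r c) = Poly_Mapping.single r (of_int (r $ i) * c)"
  by (intro poly_mapping_eqI) (simp add: lookup_single when_def)

lemma partial_mult: "partial i (f * g) = partial i f * g + f * partial i g"
proof (induction f rule: laurent_induct)
  case (single r c)
  show ?case
  proof (induction g rule: laurent_induct)
    case (single s d)
    show ?case
      by (simp add: partial_single mult_single single_add[symmetric] algebra_simps)
  qed (simp add: partial_add algebra_simps)
qed (simp add: partial_add algebra_simps)

lemma D_axis: "D (axis i 1) 0 = partial (i::'n::finite)"
proof
  fix f :: "'n laurent"
  have "(\<Sum>j\<in>UNIV. lscale (axis i 1 $ j) (partial j f)) = (\<Sum>j\<in>UNIV. if j = i then partial i f else 0)"
    by (intro sum.cong) (auto intro!: poly_mapping_eqI simp: axis_def)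
  then show "D (axis i 1) 0 f = partial i f"
    by (simp add: D_def monomial_def)
qed

lemma D_monomial: "D u r (monomial s) = lscale (dual_pairing u s) (monomial (r + s))"
proof -
  have "(\<Sum>i\<in>UNIV. lscale (u $ i) (partial i (monomial s))) = lscale (dual_pairing u s) (monomial s)"
    by (intro poly_mapping_eqI)
       (simp add: lookup_sum monomial_def lookup_single dual_pairing_def sum_distrib_right when_def)
  then show ?thesis
    by (simp add: D_def lscale_mult_right) (simp add: monomial_def mult_single)
qed

lemma D_in_witt_algebra: "D u r \<in> witt_algebra"
proof -
  interpret vector_space lscale by (rule vector_space_lscale)
  have "D u r (lscale c f) = lscale c (D u r f)" for c f
    by (simp add: D_def partial_lscale sum_distrib_left lscale_mult_right scale_sum_right mult.commute)
  then have "Vector_Spaces.linear lscale lscale (D u r)"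
    unfolding Vector_Spaces.linear_iff
    by (auto simp: vector_space_lscale D_def partial_add scale_right_distrib sum.distrib distrib_left)
  moreover have "D u r (f * g) = D u r f * g + f * D u r g" for f g
    by (simp add: D_def partial_mult lscale_def sum.distrib sum_distrib_left sum_distrib_right
        algebra_simps)
  ultimately show ?thesis by (simp add: witt_algebra_def)
qed

lemma weyl_algebra_lscale: "a \<in> weyl_algebra \<Longrightarrow> (\<lambda>f. lscale c (a f)) \<in> weyl_algebra"
  using weyl_algebra.comp[OF weyl_algebra.mult[of "Poly_Mapping.single 0 c"]]
  by (simp add: comp_def lscale_def)

lemma weyl_algebra_sum:
  fixes a :: "'i \<Rightarrow> 'a::finite laurent \<Rightarrow> 'a laurent"
  shows "finite I \<Longrightarrow> (\<And>i. i \<in> I \<Longrightarrow> a i \<in> weyl_algebra) \<Longrightarrow> (\<lambda>f. \<Sum>i\<in>I. a i f) \<in> weyl_algebra"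
proof (induction I rule: finite_induct)
  case empty
  have "(\<lambda>f. 0 * f) \<in> (weyl_algebra :: ('a laurent \<Rightarrow> 'a laurent) set)"
    by (rule weyl_algebra.mult)
  then show ?case by (simp only: mult_zero_left sum.empty)
qed (simp add: weyl_algebra.add)

lemma D_in_weyl_algebra: "D u r \<in> weyl_algebra"
  using weyl_algebra.comp[OF weyl_algebra.mult[of "monomial r"]
      weyl_algebra_sum[of UNIV "\<lambda>i f. lscale (u $ i) (partial i f)"]]
  by (auto simp: comp_def D_def[abs_def] weyl_algebra_lscale weyl_algebra.partial)

lemma witt_coeff_D: "witt_coeff (D u r) s = (if s = r then u else 0)"
proof -
  have "dual_pairing u (axis i 1) = u $ i" for i
    by (simp add: dual_pairing_def axis_def if_distrib cong: if_cong)
  then have "witt_coeff (D u r) s $ i = (if s = r then u $ i else 0)" for i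
    unfolding witt_coeff_def D_monomial by (auto simp: monomial_def lookup_single)
  then show ?thesis by (auto simp: vec_eq_iff)
qed

lemma additive_int_vec:
  fixes G :: "int ^ 'n::finite \<Rightarrow> complex"
  assumes add: "\<And>r s. G (r + s) = G r + G s"
  shows "G s = (\<Sum>i\<in>UNIV. G (axis i 1) * of_int (s $ i))"
proof -
  have zero: "G 0 = 0" using add[of 0 0] by simp
  have diff: "G (r - s) = G r - G s" for r s using add[of "r - s" s] by simp
  have ax: "G (axis i m) = G (axis i 1) * of_int m" for i m
  proof (induction m rule: int_induct[of _ 0])
    case base
    have "axis i (0::int) = 0" by (simp add: vec_eq_iff axis_def)
    then show ?case using zero by (metis mult_zero_right of_int_0)
  next
    case (step1 m)
    have "axis i (m + 1) = axis i m + axis i 1" by (simp add: vec_eq_iff axis_def)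
    then show ?case using step1 by (simp add: add algebra_simps)
  next
    case (step2 m)
    have "axis i (m - 1) = axis i m - axis i 1" by (simp add: vec_eq_iff axis_def)
    then show ?case using step2 by (simp only: diff of_int_diff of_int_1) (simp add: algebra_simps)
  qed
  have sum: "G (\<Sum>i\<in>I. v i) = (\<Sum>i\<in>I. G (v i))" for v and I :: "'n set"
    by (induction I rule: infinite_finite_induct) (simp_all add: zero add)
  have "s = (\<Sum>i\<in>UNIV. axis i (s $ i))"
    by (simp add: vec_eq_iff axis_def)
  then have "G s = G (\<Sum>i\<in>UNIV. axis i (s $ i))" by (rule arg_cong)
  also have "\<dots> = (\<Sum>i\<in>UNIV. G (axis i 1) * of_int (s $ i))"
    unfolding sum by (rule sum.cong[OF refl ax])
  finally show ?thesis .
qed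

lemma finite_witt_support: "finite (witt_support \<delta>)"
proof (rule finite_subset)
  show "witt_support \<delta> \<subseteq>
      (\<Union>i. (\<lambda>r. r - axis i 1) ` Poly_Mapping.keys (\<delta> (monomial (axis i 1))))"
  proof
    fix r assume "r \<in> witt_support \<delta>"
    then obtain i where "witt_coeff \<delta> r $ i \<noteq> 0"
      by (auto simp: witt_support_def vec_eq_iff)
    then have "r + axis i 1 \<in> Poly_Mapping.keys (\<delta> (monomial (axis i 1)))"
      by (simp add: witt_coeff_def in_keys_iff)
    then show "r \<in> (\<Union>i. (\<lambda>r. r - axis i 1) ` Poly_Mapping.keys (\<delta> (monomial (axis i 1))))"
      by (intro UN_I[of i] image_eqI[of _ _ "r + axis i 1"]) simp_all
  qed
qed simp

lemma witt_expansion: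
  assumes "\<delta> \<in> witt_algebra"
  shows "\<delta> f = (\<Sum>r\<in>witt_support \<delta>. D (witt_coeff \<delta> r) r f)"
proof -
  have lin: "\<delta> (f + g) = \<delta> f + \<delta> g" "\<delta> (lscale c f) = lscale c (\<delta> f)"
    and leib: "\<delta> (f * g) = \<delta> f * g + f * \<delta> g" for f g c
    using assms by (auto simp: witt_algebra_def Vector_Spaces.linear_iff)
  have linD: "D u r (f + g) = D u r f + D u r g" "D u r (lscale c f) = lscale c (D u r f)" for u r f g c
    using D_in_witt_algebra[of u r] by (auto simp: witt_algebra_def Vector_Spaces.linear_iff)
  interpret vector_space lscale by (rule vector_space_lscale)
  have mono: "\<delta> (monomial s) = (\<Sum>r\<in>witt_support \<delta>. D (witt_coeff \<delta> r) r (monomial s))" for s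
  proof (intro poly_mapping_eqI)
    fix t
    define G where "G t' s = Poly_Mapping.lookup (\<delta> (monomial s)) (t' + s)" for t' s
    have "G t' (r + s) = G t' r + G t' s" for t' r s
    proof -
      have m: "monomial (r + s) = monomial r * monomial s"
        by (simp add: monomial_def mult_single)
      have "G t' (r + s) = Poly_Mapping.lookup (monomial s * \<delta> (monomial r)) (s + (t' + r)) +
          Poly_Mapping.lookup (monomial r * \<delta> (monomial s)) (r + (t' + s))"
        by (simp add: G_def m leib lookup_add ac_simps)
      then show ?thesis by (simp only: lookup_monomial_mult G_def)
    qed
    from additive_int_vec[of "G (t - s)" s, OF this]
    have "G (t - s) s = dual_pairing (witt_coeff \<delta> (t - s)) s"
      by (simp add: G_def dual_pairing_def witt_coeff_def)
    moreover have "dual_pairing 0 s = 0" by (simp add: dual_pairing_def)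
    moreover have "(\<Sum>r\<in>witt_support \<delta>. dual_pairing (witt_coeff \<delta> r) s * (1 when r + s = t)) =
        (\<Sum>r\<in>witt_support \<delta>. if r = t - s then dual_pairing (witt_coeff \<delta> r) s else 0)"
      by (intro sum.cong) (auto simp: when_def)
    ultimately show "Poly_Mapping.lookup (\<delta> (monomial s)) t =
        Poly_Mapping.lookup (\<Sum>r\<in>witt_support \<delta>. D (witt_coeff \<delta> r) r (monomial s)) t"
      using finite_witt_support[of \<delta>] unfolding D_monomial lookup_sum
      by (auto simp: G_def monomial_def lookup_single witt_support_def)
  qed
  show ?thesis
  proof (induction f rule: laurent_induct)
    case (single s c)
    have "Poly_Mapping.single s c = lscale c (monomial s)"
      by (intro poly_mapping_eqI) (simp add: monomial_def lookup_single when_def)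
    then show ?case by (simp only: lin linD mono scale_sum_right)
  qed (simp add: lin linD sum.distrib)
qed

subsection \<open>Exterior powers\<close>

lemma exterior_power_iff:
  "y \<in> exterior_power k \<longleftrightarrow>
    (\<forall>l. length l \<noteq> k \<longrightarrow> y l = 0) \<and> (\<forall>xs a b ys. y (xs @ b # a # ys) + y (xs @ a # b # ys) = 0)"
  by (auto simp: exterior_power_def eq_neg_iff_add_eq_0)

lemma wedge_Nil [simp]: "wedge sc v g [] = 0"
  by (simp add: wedge_def)

lemma wedge_Cons:
  fixes sc :: "complex \<Rightarrow> 'm::ab_group_add \<Rightarrow> 'm"
  assumes "vector_space sc"
  shows "wedge sc v g (a # l) = sc (v $ a) (g l) - wedge sc v (\<lambda>m. g (a # m)) l"
proof -
  interpret vector_space sc by fact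
  show ?thesis
    by (simp add: wedge_def sum.lessThan_Suc_shift sum_negf[symmetric] del: sum.lessThan_Suc)
qed

lemma gl_act_Nil [simp]: "gl_act sc X g [] = 0"
  by (simp add: gl_act_def)

lemma gl_act_Cons:
  "gl_act sc X g (a # l) =
    (\<Sum>b\<in>UNIV. sc (X $ a $ b) (g (b # l))) + gl_act sc X (\<lambda>m. g (a # m)) l"
  by (simp add: gl_act_def sum.lessThan_Suc_shift del: sum.lessThan_Suc)

lemma vector_space_complex: "vector_space ((*) :: complex \<Rightarrow> complex \<Rightarrow> complex)"
  by unfold_locales (simp_all add: algebra_simps)

lemmas wedge_Cons_complex = wedge_Cons[OF vector_space_complex]

lemma wedge_diff_scale:
  "wedge (*) v (\<lambda>m. c * f m - g m) l = c * wedge (*) v f l - wedge (*) v g l"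
  by (simp add: wedge_def sum_distrib_left sum_subtractf algebra_simps)

lemma wedge_sum_add:
  "wedge (*) v (\<lambda>m. (\<Sum>b\<in>B. c b * f b m) + g m) l =
    (\<Sum>b\<in>B. c b * wedge (*) v (f b) l) + wedge (*) v g l"
  by (simp add: wedge_def sum_distrib_left sum.distrib algebra_simps
      sum.swap[of _ B])

lemma gl_act_diff_scale:
  "gl_act (*) X (\<lambda>m. c * f m - g m) l = c * gl_act (*) X f l - gl_act (*) X g l"
  by (simp add: gl_act_def sum_distrib_left sum_subtractf algebra_simps)

lemma wedge_wedge_same: "wedge (*) v (wedge (*) v y) l = 0"
proof (induction l arbitrary: y)
  case (Cons a l)
  then show ?case
    by (simp add: wedge_Cons_complex wedge_diff_scale)
qed simp

lemma gl_act_wedge: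
  "gl_act (*) X (wedge (*) v y) l =
    wedge (*) (X *v v) y l + wedge (*) v (gl_act (*) X y) l"
proof (induction l arbitrary: y)
  case (Cons a l)
  then show ?case
    by (simp add: wedge_Cons_complex gl_act_Cons wedge_diff_scale wedge_sum_add gl_act_diff_scale
        sum_subtractf right_diff_distrib)
       (simp add: matrix_vector_mult_def sum_distrib_left sum_distrib_right algebra_simps)
qed simp

lemma exterior_power_0: "exterior_power 0 = range (\<lambda>c l. if l = [] then c else 0)"
  by (auto simp: exterior_power_def fun_eq_iff image_iff)

lemma gl_act_exterior_power_0:
  "y \<in> exterior_power 0 \<Longrightarrow> gl_act (*) X y = 0"
  by (auto simp: exterior_power_0 gl_act_def fun_eq_iff intro!: sum.neutral)

lemma gl_act_identity:
  assumes "y \<in> exterior_power k"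
  shows "gl_act (*) (mat 1) y l = of_nat k * y l"
proof -
  have "gl_act (*) (mat 1) y l = (\<Sum>j<length l. y l)"
    unfolding gl_act_def
  proof (intro sum.cong refl)
    fix j
    have "(\<Sum>b\<in>UNIV. mat 1 $ (l ! j) $ b * y (l[j := b])) =
        (\<Sum>b\<in>UNIV. if b = l ! j then y (l[j := b]) else 0)"
      by (intro sum.cong) (auto simp: mat_def)
    then show "(\<Sum>b\<in>UNIV. mat 1 $ (l ! j) $ b * y (l[j := b])) = y l" by simp
  qed
  moreover have "length l \<noteq> k \<Longrightarrow> y l = 0"
    using assms by (simp add: exterior_power_def)
  ultimately show ?thesis by (cases "length l = k") auto
qed

lemma subspace_exterior_power: "module.subspace (fscale (*)) (exterior_power k)"
proof -
  interpret vector_space "fscale ((*) :: complex \<Rightarrow> complex \<Rightarrow> complex)"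
    by (intro vector_space_fscale vector_space_complex)
  show ?thesis
    by (simp add: subspace_def exterior_power_iff fscale_def distrib_left[symmetric] add_ac)
qed

lemma wedge_in_exterior_power:
  assumes "y \<in> exterior_power k"
  shows "wedge (*) v y \<in> exterior_power (Suc k)"
proof -
  have alt: "wedge (*) v y (xs @ b # a # ys) = - wedge (*) v y (xs @ a # b # ys)"
    if "\<And>xs a b ys. y (xs @ b # a # ys) = - y (xs @ a # b # ys)" for xs a b ys
    using that
  proof (induction xs arbitrary: y)
    case Nil
    have "y (b # a # m) = - y (a # b # m)" for m
      using Nil[of "[]" b a m] by simp
    then have "wedge (*) v (\<lambda>m. y (b # a # m)) ys = - wedge (*) v (\<lambda>m. y (a # b # m)) ys"
      by (simp add: wedge_def sum_negf)
    then show ?case by (simp add: wedge_Cons_complex)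
  next
    case (Cons x xs)
    have "wedge (*) v (\<lambda>m. y (x # m)) (xs @ b # a # ys) =
        - wedge (*) v (\<lambda>m. y (x # m)) (xs @ a # b # ys)"
      by (intro Cons.IH) (use Cons.prems in \<open>metis append_Cons\<close>)
    then show ?case using Cons.prems[of xs b a ys] by (simp add: wedge_Cons_complex)
  qed
  have "wedge (*) v y l = 0" if "length l \<noteq> Suc k" for l
    unfolding wedge_def
  proof (intro sum.neutral ballI)
    fix j assume "j \<in> {..<length l}"
    then have "length (take j l @ drop (Suc j) l) \<noteq> k" using that by auto
    then have "y (take j l @ drop (Suc j) l) = 0"
      using assms unfolding exterior_power_def by blast
    then show "(- 1) ^ j * v $ (l ! j) * y (take j l @ drop (Suc j) l) = 0" by simp
  qed
  moreover have "y (xs @ b # a # ys) = - y (xs @ a # b # ys)" for xs a b ys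
    using assms unfolding exterior_power_def by blast
  ultimately show ?thesis unfolding exterior_power_def using alt by blast
qed

lemma gl_act_in_exterior_power:
  assumes "y \<in> exterior_power k"
  shows "gl_act (*) X y \<in> exterior_power k"
proof -
  have alt: "gl_act (*) X y (xs @ b # a # ys) = - gl_act (*) X y (xs @ a # b # ys)"
    if "\<And>xs a b ys. y (xs @ b # a # ys) = - y (xs @ a # b # ys)" for xs a b ys
    using that
  proof (induction xs arbitrary: y)
    case Nil
    have y: "y (b # a # m) = - y (a # b # m)" for a b m
      using Nil[of "[]" b a m] by simp
    have "gl_act (*) X (\<lambda>m. y (b # a # m)) ys = - gl_act (*) X (\<lambda>m. y (a # b # m)) ys"
      by (simp add: gl_act_def sum_negf y[of b a])
    moreover have "(\<Sum>c\<in>UNIV. X $ b $ c * y (c # a # ys)) = - (\<Sum>c\<in>UNIV. X $ b $ c * y (a # c # ys))"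
      "(\<Sum>c\<in>UNIV. X $ a $ c * y (b # c # ys)) = - (\<Sum>c\<in>UNIV. X $ a $ c * y (c # b # ys))"
      by (auto simp: sum_negf[symmetric] y[of _ a] y[of b] intro!: sum.cong)
    ultimately show ?case by (simp add: gl_act_Cons)
  next
    case (Cons x xs)
    have "gl_act (*) X (\<lambda>m. y (x # m)) (xs @ b # a # ys) =
        - gl_act (*) X (\<lambda>m. y (x # m)) (xs @ a # b # ys)"
      by (intro Cons.IH) (use Cons.prems in \<open>metis append_Cons\<close>)
    moreover have "y (c # xs @ b # a # ys) = - y (c # xs @ a # b # ys)" for c
      using Cons.prems[of "c # xs" b a ys] by simp
    ultimately show ?case by (simp add: gl_act_Cons sum_negf)
  qed
  have "gl_act (*) X y l = 0" if "length l \<noteq> k" for l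
    using that assms by (simp add: gl_act_def exterior_power_def)
  moreover have "y (xs @ b # a # ys) = - y (xs @ a # b # ys)" for xs a b ys
    using assms unfolding exterior_power_def by blast
  ultimately show ?thesis unfolding exterior_power_def using alt by blast
qed

text \<open>
  Together with \<open>exterior_power_0\<close>, this shows that \<open>exterior_power k\<close> is spanned by the products
  \<open>v\<^sub>1 \<and> \<dots> \<and> v\<^sub>k\<close>, and \<open>gl_act_wedge\<close> that matrices act on these by the Leibniz rule.
\<close>

lemma exterior_power_Suc:
  "(exterior_power (Suc k) :: ('n::finite list \<Rightarrow> complex) set) =
    module.span (fscale (*)) {wedge (*) v y | v y. y \<in> exterior_power k}"
proof
  interpret vector_space "fscale (*) :: complex \<Rightarrow> ('n list \<Rightarrow> complex) \<Rightarrow> 'n list \<Rightarrow> complex"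
    by (intro vector_space_fscale vector_space_complex)
  show "span {wedge (*) v y | v y. y \<in> exterior_power k} \<subseteq> exterior_power (Suc k)"
    using subspace_exterior_power wedge_in_exterior_power by (intro span_minimal) auto
  show "exterior_power (Suc k) \<subseteq> span {wedge (*) v y | v y. y \<in> exterior_power k}"
  proof
    fix y :: "'n list \<Rightarrow> complex"
    assume y: "y \<in> exterior_power (Suc k)"
    then have alt: "y (xs @ b # a # ys) = - y (xs @ a # b # ys)" for xs a b ys
      unfolding exterior_power_def by blast
    define \<iota> where "\<iota> i = (\<lambda>m. y (i # m))" for i
    have \<iota>: "\<iota> i \<in> exterior_power k" for i
    proof -
      have "y (i # xs @ b # a # ys) = - y (i # xs @ a # b # ys)" for xs a b ys
        using alt[of "i # xs" b a ys] by simp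
      moreover have "length m \<noteq> k \<Longrightarrow> y (i # m) = 0" for m
        using y by (simp add: exterior_power_def)
      ultimately show ?thesis unfolding exterior_power_def \<iota>_def by blast
    qed
    have front: "y (a # xs @ ys) = (-1) ^ length xs * y (xs @ a # ys)" for a xs ys
    proof (induction xs arbitrary: ys rule: rev_induct)
      case (snoc x xs)
      then show ?case using alt[of xs a x ys] snoc[of "x # ys"] by simp
    qed simp
    have "(\<Sum>i\<in>UNIV. wedge (*) (axis i 1) (\<iota> i) l) = of_nat (Suc k) * y l" for l
    proof -
      have "(\<Sum>i\<in>UNIV. wedge (*) (axis i 1) (\<iota> i) l) =
          (\<Sum>j<length l. \<Sum>i\<in>UNIV. (-1) ^ j * axis i 1 $ (l ! j) * \<iota> i (take j l @ drop (Suc j) l))"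
        unfolding wedge_def by (rule sum.swap)
      also have "\<dots> = (\<Sum>j<length l. y l)"
      proof (intro sum.cong refl)
        fix j assume j: "j \<in> {..<length l}"
        have "(\<Sum>i\<in>UNIV. (-1) ^ j * axis i 1 $ (l ! j) * \<iota> i (take j l @ drop (Suc j) l)) =
            (\<Sum>i\<in>UNIV. if i = l ! j then (-1) ^ j * y (l ! j # take j l @ drop (Suc j) l) else 0)"
          by (intro sum.cong) (auto simp: axis_def \<iota>_def)
        also have "\<dots> = (-1) ^ j * ((-1) ^ j * y (take j l @ l ! j # drop (Suc j) l))"
          using j by (simp add: front min_def)
        also have "\<dots> = y l"
          using j by (simp add: id_take_nth_drop[symmetric] mult.assoc[symmetric]
              power_mult_distrib[symmetric])
        finally show "(\<Sum>i\<in>UNIV. (-1) ^ j * axis i 1 $ (l ! j) * \<iota> i (take j l @ drop (Suc j) l)) = y l" .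
      qed
      also have "\<dots> = of_nat (Suc k) * y l"
        using y by (cases "length l = Suc k") (auto simp: exterior_power_def)
      finally show ?thesis .
    qed
    then have "fscale (*) (1 / of_nat (Suc k)) (\<Sum>i\<in>UNIV. wedge (*) (axis i 1) (\<iota> i)) l = y l" for l
    proof -
      have "(\<Sum>i\<in>I. f i) l = (\<Sum>i\<in>I. f i l)" for f :: "'n \<Rightarrow> 'n list \<Rightarrow> complex" and I
        by (induction I rule: infinite_finite_induct) auto
      then show ?thesis
        using \<open>(\<Sum>i\<in>UNIV. wedge (*) (axis i 1) (\<iota> i) l) = of_nat (Suc k) * y l\<close>
        by (simp add: fscale_def del: of_nat_Suc)
    qed
    then have "y = fscale (*) (1 / of_nat (Suc k)) (\<Sum>i\<in>UNIV. wedge (*) (axis i 1) (\<iota> i))"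
      by auto
    also have "\<dots> \<in> span {wedge (*) v y | v y. y \<in> exterior_power k}"
      using \<iota> by (intro span_scale span_sum span_base) auto
    finally show "y \<in> span {wedge (*) v y | v y. y \<in> exterior_power k}" .
  qed
qed

subsection \<open>Tensor modules\<close>

lemma sum_fun_apply: "(\<Sum>i\<in>I. f i) l = (\<Sum>i\<in>I. f i l :: 'a::comm_monoid_add)"
  by (induction I rule: infinite_finite_induct) auto

text \<open>Together with bilinearity, this says that \<open>tensor_product\<close> is the tensor product.\<close>

lemma pure_tensor_independent:
  fixes sc :: "complex \<Rightarrow> 'p::ab_group_add \<Rightarrow> 'p"
  assumes "vector_space sc" and B: "finite B" "\<not> module.dependent (fscale (*)) B"
    and eq: "(\<Sum>y\<in>B. pure_tensor sc (p y) y) = 0" and y: "y \<in> B"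
  shows "p y = 0"
proof -
  interpret V: vector_space sc by fact
  interpret C: vector_space "fscale (*) :: complex \<Rightarrow> ('a \<Rightarrow> complex) \<Rightarrow> 'a \<Rightarrow> complex"
    by (intro vector_space_fscale vector_space_complex)
  obtain E where "V.independent E" and "UNIV \<subseteq> V.span E"
    by (rule V.maximal_independent_subset[of UNIV])
  then have E: "V.independent E" "V.span E = UNIV" by (auto simp only: top.extremum_unique)
  have zero: "V.representation E (p y) b = 0" for b
  proof -
    have "(\<Sum>y\<in>B. fscale (*) (V.representation E (p y) b) y) l = 0" for l
    proof -
      have "(\<Sum>y\<in>B. sc (y l) (p y)) = 0"
        using fun_cong[OF eq, of l] by (simp add: sum_fun_apply pure_tensor_def)
      then have "V.representation E (\<Sum>y\<in>B. sc (y l) (p y)) b = 0"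
        by (simp add: V.representation_zero)
      then have "(\<Sum>y\<in>B. V.representation E (sc (y l) (p y)) b) = 0"
        using V.representation_sum[OF E(1), of B "\<lambda>y. sc (y l) (p y)"] E(2) by simp
      then have "(\<Sum>y\<in>B. y l * V.representation E (p y) b) = 0"
        using V.representation_scale[OF E(1)] E(2) by simp
      then show ?thesis by (simp add: sum_fun_apply fscale_def mult.commute)
    qed
    then have "(\<Sum>y\<in>B. fscale (*) (V.representation E (p y) b) y) = 0"
      by (simp add: fun_eq_iff)
    then show ?thesis by (rule C.independentD[OF B(2,1) order_refl _ y])
  qed
  have "p y = (\<Sum>b | V.representation E (p y) b \<noteq> 0. sc (V.representation E (p y) b) b)"
    using V.sum_nonzero_representation_eq[OF E(1)] E(2) by simp
  also have "\<dots> = 0" by (simp add: zero)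
  finally show ?thesis .
qed

lemma wedge_pure_tensor:
  assumes "vector_space sc"
  shows "wedge sc v (pure_tensor sc p y) = pure_tensor sc p (wedge (*) v y)"
proof -
  interpret vector_space sc by fact
  show ?thesis by (auto simp: wedge_def pure_tensor_def scale_sum_left)
qed

lemma gl_act_pure_tensor:
  assumes "vector_space sc"
  shows "gl_act sc X (pure_tensor sc p y) = pure_tensor sc p (gl_act (*) X y)"
proof -
  interpret vector_space sc by fact
  show ?thesis by (auto simp: gl_act_def pure_tensor_def scale_sum_left)
qed

lemma div_zero_subset_witt: "div_zero_algebra \<subseteq> (witt_algebra :: ('n::finite laurent \<Rightarrow> 'n laurent) set)"
proof -
  interpret L: vector_space "lscale :: complex \<Rightarrow> 'n laurent \<Rightarrow> 'n laurent"
    by (rule vector_space_lscale)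
  interpret vector_space
    "fscale lscale :: complex \<Rightarrow> ('n laurent \<Rightarrow> 'n laurent) \<Rightarrow> 'n laurent \<Rightarrow> 'n laurent"
    by (intro vector_space_fscale vector_space_lscale)
  have "subspace (witt_algebra :: ('n laurent \<Rightarrow> 'n laurent) set)"
    by (auto simp: subspace_def witt_algebra_def Vector_Spaces.linear_iff fscale_def algebra_simps
        vector_space_lscale L.scale_right_distrib L.scale_left_commute
        lscale_mult_left lscale_mult_right)
  then show ?thesis
    unfolding div_zero_algebra_def by (intro span_minimal) (auto simp: D_in_witt_algebra)
qed

context weyl_module
begin

lemma F_D_pure_tensor:
  "F_D sc \<rho> u r (pure_tensor sc p y) =
    pure_tensor sc (\<rho> (D u r) p) y +
    pure_tensor sc (\<rho> (\<lambda>f. monomial r * f) p) (gl_act (*) (outer r u) y)"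
  using rho_linear[OF D_in_weyl_algebra] rho_linear[OF weyl_algebra.mult]
  by (auto simp: F_D_def gl_act_pure_tensor[OF vector_space_axioms])
     (simp add: pure_tensor_def Vector_Spaces.linear_iff fun_eq_iff)

lemma rho_zero: "a \<in> weyl_algebra \<Longrightarrow> \<rho> a 0 = 0"
  using rho_linear[of a] by (metis Vector_Spaces.linear_iff scale_zero_left)

lemma F_act_D: "F_act sc \<rho> (D u r) g = F_D sc \<rho> u r g"
proof (cases "u = 0")
  case True
  have "\<rho> (D 0 r) z = 0" for z
    using rho_scale[OF D_in_weyl_algebra[of 0 r], of 0]
    by (simp add: D_def[abs_def] lscale_def)
  moreover have "\<rho> (\<lambda>f. monomial r * f) 0 = 0"
    by (rule rho_zero[OF weyl_algebra.mult])
  moreover have "gl_act sc (outer r 0) g l = 0" for l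
    by (simp add: gl_act_def outer_def)
  ultimately show ?thesis
    by (auto simp: F_act_def F_D_def witt_support_def witt_coeff_D True)
next
  case False
  then have "witt_support (D u r) = {r}"
    by (auto simp: witt_support_def witt_coeff_D)
  then show ?thesis by (simp add: F_act_def witt_coeff_D)
qed

lemma d_map_pure_tensor:
  "d_map sc \<rho> (pure_tensor sc p y) =
    (\<Sum>i\<in>UNIV. pure_tensor sc (\<rho> (partial i) p) (wedge (*) (axis i 1) y))"
proof -
  have "(\<lambda>l. \<rho> (partial i) (pure_tensor sc p y l)) = pure_tensor sc (\<rho> (partial i) p) y" for i
    using rho_linear[OF weyl_algebra.partial] by (simp add: pure_tensor_def Vector_Spaces.linear_iff)
  then show ?thesis by (simp add: d_map_def wedge_pure_tensor[OF vector_space_axioms])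
qed

lemma F_mod_submodule:
  "submodule (fscale sc) witt_algebra (F_act sc \<rho>) (F_mod sc k) (F_mod sc k)"
proof -
  interpret V: vector_space "fscale sc :: complex \<Rightarrow> ('n list \<Rightarrow> 'p) \<Rightarrow> 'n list \<Rightarrow> 'p"
    by (intro vector_space_fscale vector_space_axioms)
  let ?G = "{pure_tensor sc p y | p y. p \<in> UNIV \<and> y \<in> exterior_power k} :: ('n list \<Rightarrow> 'p) set"
  have F: "F_mod sc k = V.span ?G" by (simp add: F_mod_def tensor_product_def)
  have D: "F_D sc \<rho> u r g \<in> V.span ?G" if "g \<in> V.span ?G" for u r g
    using that
  proof (induction rule: V.span_induct_alt)
    case base
    have "F_D sc \<rho> u r (0 :: 'n list \<Rightarrow> 'p) = 0"
      by (auto simp: F_D_def gl_act_def rho_zero D_in_weyl_algebra weyl_algebra.mult)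
    then show ?case by (simp only: V.span_zero)
  next
    case (step c x g)
    then obtain p y where x: "x = pure_tensor sc p y" "y \<in> exterior_power k" by auto
    have l: "Vector_Spaces.linear sc sc (\<rho> (D u r))"
      "Vector_Spaces.linear sc sc (\<rho> (\<lambda>f. monomial r * f))"
      by (intro rho_linear D_in_weyl_algebra weyl_algebra.mult)+
    have "gl_act sc (outer r u) (fscale sc c x + g) l =
        sc c (gl_act sc (outer r u) x l) + gl_act sc (outer r u) g l" for l
      by (simp add: gl_act_def fscale_def scale_right_distrib sum.distrib scale_sum_right
          mult.commute)
    then have "F_D sc \<rho> u r (fscale sc c x + g) =
        fscale sc c (F_D sc \<rho> u r x) + F_D sc \<rho> u r g"
      using l unfolding Vector_Spaces.linear_iff
      by (simp add: F_D_def fscale_def fun_eq_iff scale_right_distrib add_ac)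
    moreover have "F_D sc \<rho> u r x \<in> V.span ?G"
      unfolding x(1) F_D_pure_tensor using x(2) gl_act_in_exterior_power[OF x(2)]
      by (intro V.span_add V.span_base) blast+
    ultimately show ?case using step.IH by (simp only: V.span_add V.span_scale)
  qed
  then have "F_act sc \<rho> \<delta> g \<in> V.span ?G" if "g \<in> V.span ?G" for \<delta> g
    unfolding F_act_def using that by (intro V.span_sum D)
  then show ?thesis unfolding submodule_def F using V.subspace_span by blast
qed

end

end

theory Submission
  imports Defs
begin

text \<open>
  An element of \<open>F_mod sc k\<close> is a differential form of degree k on the torus with
  coefficients in P: an alternating function of k indices, where an index i stands for the
  one-form \<open>dx\<^sub>i / x\<^sub>i\<close>. The vector field \<open>D u r\<close> acts on forms as a Lie derivative, so
  Cartan's formula \<open>F_D u r g = d (x\<^sup>r \<iota>\<^sub>u g) + x\<^sup>r \<iota>\<^sub>u (d g)\<close> (\<open>F_D_cartan\<close>) holds.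
  Hence d commutes with the action, and \<open>D u r\<close> acts on a closed form y by
  \<open>y \<mapsto> d (x\<^sup>r \<iota>\<^sub>u y)\<close>. All five parts follow from two facts about a subspace N
  that is stable under all \<open>D u r\<close> with \<open>(u|r) = 0\<close>.

  Degree zero (\<open>div_zero_stable_contains_image\<close>). Let N be a subspace of P. If
  \<open>(u|t - s) = 0\<close> and \<open>(v|s) = 0\<close>, then \<open>D u (t - s) \<circ> D v s = \<partial>\<^sub>u x\<^sup>t \<partial>\<^sub>v\<close>, and enough triples
  (u, v, s) satisfy these constraints to give \<open>\<partial>\<^sub>i x\<^sup>t \<partial>\<^sub>j N \<subseteq> N\<close> for all i, j, t. Then
  \<open>{w. \<forall>i t. \<partial>\<^sub>i x\<^sup>t w \<in> N}\<close> is a submodule of P over the Weyl algebra. It contains \<open>\<hh>N\<close>, so it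
  is all of P as soon as \<open>\<hh>N \<noteq> 0\<close>, and therefore N contains \<open>\<hh>P\<close>. The vectors killed by all
  \<open>\<partial>\<^sub>i\<close> vanish unless P is isomorphic to the Laurent polynomials
  (\<open>isomorphic_to_A_iff_killed\<close>). Together these statements describe the submodules of the
  functions, and, through d, those of the exact forms of degree one. Forms of top degree n
  are functions again, because a field of divergence zero preserves the volume form.

  Degree k with \<open>2 \<le> k \<le> n - 1\<close> (\<open>exact_forms_in_stable_subspace\<close>). Let N be a nonzero stable
  space of exact k-forms. Composing \<open>y \<mapsto> d (x\<^sup>s \<iota>\<^sub>c y)\<close> with \<open>y \<mapsto> d (x\<^sup>t\<^sup>-\<^sup>s \<iota>\<^sub>b y)\<close> gives an
  expression that is affine in s, and its difference quotients show that
  \<open>d (x\<^sup>t \<iota>\<^sub>b (e\<^sub>a \<and> \<iota>\<^sub>c y)) \<in> N\<close> for distinct a, b, c. Composing two such operators and summing over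
  the free indices with Euler's formula \<open>\<Sum>\<^sub>i e\<^sub>i \<and> \<iota>\<^sub>i g = k g\<close> yields
  \<open>d (x\<^sup>t \<iota>\<^sub>b y) \<in> N\<close> without any constraint on b and t; the factors k - 1 and n - k that appear
  are nonzero exactly in this range of degrees. So
  \<open>G = {z. \<forall>t. d (x\<^sup>t z) \<in> N}\<close> contains nonzero (k-1)-forms, and it turns out to be stable under
  the Weyl algebra and under the matrix units \<open>e\<^sub>i \<and> \<iota>\<^sub>a\<close>. As P is simple, G contains all
  (k-1)-forms, and N contains all exact k-forms.

  Finally, \<open>L_tilde k\<close> is the space of closed k-forms (\<open>L_tilde_eq\<close>), and d identifies the
  quotient of all k-forms by it with the exact (k+1)-forms, which form a simple module.
\<close>

section \<open>Modules over the Weyl algebra\<close>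

context weyl_module
begin

text \<open>
  The actions of \<open>x\<^sup>r\<close> and \<open>\<partial>\<^sub>i\<close> on P. The whole Weyl algebra acts through them, so
  \<open>\<rho>\<close> itself rarely appears below.
\<close>

definition X :: "int ^ 'n \<Rightarrow> 'p \<Rightarrow> 'p"
  where "X r = \<rho> (\<lambda>f. monomial r * f)"

definition dd :: "'n \<Rightarrow> 'p \<Rightarrow> 'p"
  where "dd i = \<rho> (partial i)"

lemma rho_lin:
  assumes "a \<in> weyl_algebra"
  shows "\<rho> a (z + w) = \<rho> a z + \<rho> a w" "\<rho> a (sc c z) = sc c (\<rho> a z)"
  using rho_linear[OF assms] by (simp_all add: Vector_Spaces.linear_iff)

lemma X_add: "X r (z + w) = X r z + X r w"
  and X_scale: "X r (sc c z) = sc c (X r z)"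
  and X_zero [simp]: "X r 0 = 0"
  using rho_lin[OF weyl_algebra.mult] rho_zero[OF weyl_algebra.mult] by (simp_all add: X_def)

lemma dd_add: "dd i (z + w) = dd i z + dd i w"
  and dd_scale: "dd i (sc c z) = sc c (dd i z)"
  and dd_zero [simp]: "dd i 0 = 0"
  using rho_lin[OF weyl_algebra.partial] rho_zero[OF weyl_algebra.partial]
  by (simp_all add: dd_def)

lemma X_X: "X r (X s z) = X (r + s) z"
proof -
  have "X r (X s z) = \<rho> ((\<lambda>f. monomial r * f) \<circ> (\<lambda>f. monomial s * f)) z"
    by (simp add: X_def rho_comp weyl_algebra.mult)
  also have "(\<lambda>f. monomial r * f) \<circ> (\<lambda>f. monomial s * f) = (\<lambda>f. monomial (r + s) * f)"
    by (simp add: fun_eq_iff mult.assoc[symmetric]) (simp add: monomial_def mult_single)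
  finally show ?thesis by (simp add: X_def)
qed

lemma X_0 [simp]: "X 0 z = z"
proof -
  have "(\<lambda>f. monomial 0 * f) = (id :: 'n laurent \<Rightarrow> _)"
    by (simp add: fun_eq_iff monomial_def)
  then show ?thesis by (simp only: X_def rho_id)
qed

lemma dd_X: "dd i (X r z) = X r (dd i z) + sc (of_int (r $ i)) (X r z)"
proof -
  let ?m = "\<lambda>f. monomial r * f"
  have m: "?m \<in> weyl_algebra" "partial i \<in> weyl_algebra" "?m \<circ> partial i \<in> weyl_algebra"
    by (intro weyl_algebra.intros)+
  have "partial i \<circ> ?m = (\<lambda>f. (?m \<circ> partial i) f + lscale (of_int (r $ i)) (?m f))"
  proof
    fix f :: "'n laurent"
    have "partial i (monomial r) = lscale (of_int (r $ i)) (monomial r)"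
      by (intro poly_mapping_eqI) (simp add: monomial_def lookup_single when_def)
    then show "(partial i \<circ> ?m) f = (?m \<circ> partial i) f + lscale (of_int (r $ i)) (?m f)"
      by (simp add: partial_mult lscale_mult_left add.commute)
  qed
  then have "\<rho> (partial i \<circ> ?m) z = \<rho> (?m \<circ> partial i) z + sc (of_int (r $ i)) (\<rho> ?m z)"
    using rho_add[OF m(3) weyl_algebra_lscale[OF m(1)]] rho_scale[OF m(1)] by simp
  then show ?thesis using m by (simp add: rho_comp X_def dd_def)
qed

lemma dd_dd: "dd i (dd j z) = dd j (dd i z)"
proof -
  have "partial i \<circ> partial j = (partial j \<circ> partial i :: 'n laurent \<Rightarrow> _)"
    by (auto simp: fun_eq_iff intro!: poly_mapping_eqI)
  then show ?thesis
    unfolding dd_def by (metis rho_comp weyl_algebra.partial)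
qed

lemma rho_sum:
  fixes a :: "'i \<Rightarrow> 'n laurent \<Rightarrow> 'n laurent"
  shows "finite I \<Longrightarrow> (\<And>i. i \<in> I \<Longrightarrow> a i \<in> weyl_algebra) \<Longrightarrow>
    \<rho> (\<lambda>f. \<Sum>i\<in>I. a i f) z = (\<Sum>i\<in>I. \<rho> (a i) z)"
proof (induction I rule: finite_induct)
  case empty
  have "(\<lambda>f. \<Sum>i\<in>{}. a i f) = (\<lambda>f. lscale 0 (1 * f))"
    by (simp add: fun_eq_iff lscale_def)
  then show ?case
    using rho_scale[OF weyl_algebra.mult[of 1], where c = 0 and z = z]
    by (simp only: scale_zero_left sum.empty)
qed (simp add: rho_add weyl_algebra_sum)

lemma rho_D: "\<rho> (D u r) z = X r (\<Sum>i\<in>UNIV. sc (u $ i) (dd i z))"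
proof -
  let ?a = "\<lambda>i f. lscale (u $ i) (partial i f)"
  have a: "?a i \<in> weyl_algebra" for i
    by (intro weyl_algebra_lscale weyl_algebra.partial)
  have "D u r = (\<lambda>f. monomial r * f) \<circ> (\<lambda>f. \<Sum>i\<in>UNIV. ?a i f)"
    by (auto simp: D_def)
  then have "\<rho> (D u r) z = X r (\<rho> (\<lambda>f. \<Sum>i\<in>UNIV. ?a i f) z)"
    by (simp add: rho_comp weyl_algebra.mult weyl_algebra_sum a X_def)
  also have "\<rho> (\<lambda>f. \<Sum>i\<in>UNIV. ?a i f) z = (\<Sum>i\<in>UNIV. sc (u $ i) (dd i z))"
    by (simp add: rho_sum a rho_scale weyl_algebra.partial dd_def)
  finally show ?thesis .
qed

text \<open>
  The Weyl algebra is generated by the monomials and the \<open>\<partial>\<^sub>i\<close>, so these suffice to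
  recognise a submodule.
\<close>

lemma rho_in_subspace:
  assumes M: "subspace M" and X: "\<And>r z. z \<in> M \<Longrightarrow> X r z \<in> M"
    and dd: "\<And>i z. z \<in> M \<Longrightarrow> dd i z \<in> M"
    and "a \<in> weyl_algebra" "z \<in> M"
  shows "\<rho> a z \<in> M"
  using assms(4,5)
proof (induction a arbitrary: z rule: weyl_algebra.induct)
  case (mult g)
  show ?case
  proof (induction g rule: laurent_induct)
    case (single r c)
    have "(\<lambda>f. Poly_Mapping.single r c * f) = (\<lambda>f. lscale c (monomial r * f))"
      by (simp add: fun_eq_iff lscale_def mult.assoc[symmetric]) (simp add: monomial_def mult_single)
    then show ?case
      using X[OF mult] M by (simp add: rho_scale weyl_algebra.mult X_def subspace_scale)
  next
    case (add f g)
    have "\<rho> (\<lambda>h. (f + g) * h) z = \<rho> (\<lambda>h. f * h) z + \<rho> (\<lambda>h. g * h) z"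
      by (simp add: distrib_right rho_add weyl_algebra.mult)
    then show ?case using add M by (simp add: subspace_add)
  qed
qed (use dd M in \<open>simp_all add: dd_def rho_add rho_comp subspace_add\<close>)

lemma simple_subspace_UNIV:
  assumes simple: "simple_module sc weyl_algebra \<rho> UNIV"
    and M: "subspace M" and "\<And>r z. z \<in> M \<Longrightarrow> X r z \<in> M"
    and "\<And>i z. z \<in> M \<Longrightarrow> dd i z \<in> M"
    and "z \<in> M" "z \<noteq> 0"
  shows "w \<in> M"
proof -
  have "submodule sc weyl_algebra \<rho> M UNIV"
    using rho_in_subspace[OF assms(2-4)] M by (simp add: submodule_def)
  then have "M = {0} \<or> M = UNIV"
    using simple by (simp add: simple_module_def)
  then show ?thesis using assms(5,6) by auto
qed

end

section \<open>Alternating forms with coefficients in a vector space\<close>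

text \<open>
  Forms are manipulated as vectors with operators acting on them. The pointwise rules for
  functions are therefore used only on demand.
\<close>

lemmas fun_apply = plus_fun_apply zero_fun_apply minus_apply uminus_apply

declare fun_apply [simp del]

text \<open>
  Contraction with a basis vector fills the first slot of a form; \<open>iotas\<close> contracts
  repeatedly. With \<open>eps i\<close>, the exterior multiplication by \<open>e\<^sub>i\<close> introduced below, the
  contractions generate a Clifford algebra.
\<close>

definition iota :: "'n \<Rightarrow> ('n list \<Rightarrow> 'p) \<Rightarrow> 'n list \<Rightarrow> 'p"
  where "iota a g = (\<lambda>l. g (a # l))"

definition iotas :: "'n list \<Rightarrow> ('n list \<Rightarrow> 'p) \<Rightarrow> 'n list \<Rightarrow> 'p"
  where "iotas S g = (\<lambda>l. g (S @ l))"

definition forms :: "nat \<Rightarrow> ('n list \<Rightarrow> 'p::ab_group_add) set"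
  where "forms k = {g. (\<forall>l. length l \<noteq> k \<longrightarrow> g l = 0) \<and>
    (\<forall>xs a b ys. g (xs @ b # a # ys) = - g (xs @ a # b # ys))}"

lemma iotas_Nil [simp]: "iotas [] g = g"
  and iotas_Cons: "iotas (a # S) g = iotas S (iota a g)"
  by (simp_all add: iotas_def iota_def)

lemma iota_add: "iota a (f + g) = iota a f + iota a g"
  and iota_zero [simp]: "iota a 0 = 0"
  and iota_fscale: "iota a (fscale sc c g) = fscale sc c (iota a g)"
  by (simp_all add: iota_def fun_eq_iff fun_apply fscale_def)

lemma iotas_diff: "iotas S (f - g) = iotas S f - iotas S g"
  by (simp add: iotas_def fun_eq_iff fun_apply)

lemma forms_iff:
  "g \<in> forms k \<longleftrightarrow>
    (\<forall>l. length l \<noteq> k \<longrightarrow> g l = 0) \<and> (\<forall>xs a b ys. g (xs @ b # a # ys) + g (xs @ a # b # ys) = 0)"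
  by (auto simp: forms_def eq_neg_iff_add_eq_0)

lemma forms_alt: "g \<in> forms k \<Longrightarrow> g (xs @ b # a # ys) = - g (xs @ a # b # ys)"
  and forms_length: "g \<in> forms k \<Longrightarrow> length l \<noteq> k \<Longrightarrow> g l = 0"
  unfolding forms_def by blast+

lemma iota_anticommute:
  assumes "g \<in> forms k"
  shows "iota a (iota b g) = - iota b (iota a g)"
proof
  fix l
  show "iota a (iota b g) l = (- iota b (iota a g)) l"
    using forms_alt[OF assms, of "[]" b a l] by (simp add: iota_def fun_apply)
qed

lemma iota_forms: "g \<in> forms (Suc k) \<Longrightarrow> iota a g \<in> forms k"
  unfolding forms_iff iota_def
proof (elim conjE, intro conjI allI impI)
  fix l :: "'a list" and xs ys b c
  assume g: "\<forall>l. length l \<noteq> Suc k \<longrightarrow> g l = 0"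
    "\<forall>xs a b ys. g (xs @ b # a # ys) + g (xs @ a # b # ys) = 0"
  show "g (a # l) = 0" if "length l \<noteq> k" using g(1) that by simp
  show "g (a # xs @ b # c # ys) + g (a # xs @ c # b # ys) = 0"
    using g(2)[rule_format, of "a # xs" b c ys] by simp
qed

lemma iota_forms_0: "g \<in> forms 0 \<Longrightarrow> iota a g = 0"
  by (auto simp: iota_def fun_eq_iff fun_apply forms_length)

lemma iota_forms_pred: "g \<in> forms k \<Longrightarrow> iota a g \<in> forms (k - 1)"
  by (cases k) (simp_all add: iota_forms iota_forms_0, simp add: forms_iff fun_apply)

locale form_space = vector_space sc for sc :: "complex \<Rightarrow> 'p::ab_group_add \<Rightarrow> 'p"
begin

sublocale F: vector_space "fscale sc :: complex \<Rightarrow> ('n list \<Rightarrow> 'p) \<Rightarrow> 'n list \<Rightarrow> 'p"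
  by (intro vector_space_fscale vector_space_axioms)

abbreviation eps :: "'n::finite \<Rightarrow> ('n list \<Rightarrow> 'p) \<Rightarrow> 'n list \<Rightarrow> 'p"
  where "eps i \<equiv> wedge sc (axis i 1)"

lemma subspace_forms: "F.subspace (forms k)"
  unfolding F.subspace_def
proof (intro conjI ballI allI)
  fix f g :: "'a list \<Rightarrow> 'p"
  assume "f \<in> forms k" "g \<in> forms k"
  then show "f + g \<in> forms k"
    unfolding forms_iff by (simp add: fun_apply) (metis add.left_commute add.assoc add.right_neutral)
qed (simp_all add: forms_iff fun_apply fscale_def scale_right_distrib[symmetric])

lemma wedge_add: "wedge sc v (f + g) = wedge sc v f + wedge sc v g"
  by (simp add: wedge_def fun_eq_iff fun_apply scale_right_distrib sum.distrib)

lemma wedge_diff: "wedge sc v (f - g) = wedge sc v f - wedge sc v g"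
  by (simp add: wedge_def fun_eq_iff fun_apply scale_right_diff_distrib sum_subtractf)

lemma wedge_minus: "wedge sc v (- g) = - wedge sc v g"
  by (simp add: wedge_def fun_eq_iff fun_apply sum_negf)

lemma wedge_zero [simp]: "wedge sc v 0 = 0"
  by (simp add: wedge_def fun_eq_iff fun_apply)

lemma wedge_fscale: "wedge sc v (fscale sc c g) = fscale sc c (wedge sc v g)"
  by (simp add: wedge_def fscale_def fun_eq_iff fun_apply scale_sum_right mult_ac)

lemma wedge_sum: "wedge sc v (\<Sum>i\<in>I. f i) = (\<Sum>i\<in>I. wedge sc v (f i))"
  by (induction I rule: infinite_finite_induct) (simp_all add: wedge_add)

text \<open>
  Exterior multiplication commutes with every linear operator on the coefficients, in
  particular with \<open>x\<^sup>r\<close> and \<open>\<partial>\<^sub>i\<close>.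
\<close>

lemma wedge_map:
  assumes "\<And>z w. A (z + w) = A z + A w" "\<And>c z. A (sc c z) = sc c (A z)"
  shows "wedge sc v (\<lambda>l. A (g l)) = (\<lambda>l. A (wedge sc v g l))"
proof -
  have "A 0 = 0" using assms(2)[of 0 0] by simp
  then have "A (\<Sum>i\<in>I. f i) = (\<Sum>i\<in>I. A (f i))" for f :: "nat \<Rightarrow> 'p" and I
    by (induction I rule: infinite_finite_induct) (simp_all add: assms)
  note lin = this
  show ?thesis unfolding wedge_def lin assms ..
qed

lemma wedge_zero_vec [simp]: "wedge sc 0 g = 0"
  by (simp add: wedge_def fun_eq_iff fun_apply)

lemma wedge_expand: "wedge sc v g = (\<Sum>i\<in>UNIV. fscale sc (v $ i) (eps i g))"
proof
  fix l
  have "(\<Sum>i\<in>UNIV. sc ((- 1) ^ j * (v $ i * axis i 1 $ (l ! j))) z) = sc ((- 1) ^ j * v $ (l ! j)) z"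
    for j z
  proof -
    have "(\<Sum>i\<in>UNIV. sc ((- 1) ^ j * (v $ i * axis i 1 $ (l ! j))) z) =
        (\<Sum>i\<in>UNIV. if i = l ! j then sc ((- 1) ^ j * v $ (l ! j)) z else 0)"
      by (intro sum.cong) (auto simp: axis_def)
    then show ?thesis by simp
  qed
  then show "wedge sc v g l = (\<Sum>i\<in>UNIV. fscale sc (v $ i) (eps i g)) l"
    by (simp add: sum_fun_apply fun_apply fscale_def wedge_def scale_sum_right mult.left_commute
        sum.swap[of _ "{..<length l}" UNIV])
qed

lemma wedge_vec_add: "wedge sc (v + w) g = wedge sc v g + wedge sc w g"
  by (simp add: wedge_def fun_eq_iff fun_apply distrib_left scale_left_distrib sum.distrib)

lemma iota_wedge: "iota a (wedge sc v g) = fscale sc (v $ a) g - wedge sc v (iota a g)"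
  by (simp add: iota_def fun_eq_iff fun_apply fscale_def wedge_Cons[OF vector_space_axioms])

text \<open>
  The Clifford relation \<open>\<iota>\<^sub>a e\<^sub>b + e\<^sub>b \<iota>\<^sub>a = \<delta>\<^sub>a\<^sub>b\<close>. Most computations with forms below only use
  this relation and the anticommutation of contractions.
\<close>

lemma iota_eps: "iota a (eps b g) = (if a = b then g else 0) - eps b (iota a g)"
  by (simp add: iota_wedge axis_def fscale_def) (simp add: fun_eq_iff fun_apply)

lemma wedge_anticommute: "wedge sc v (wedge sc w g) = - wedge sc w (wedge sc v g)"
proof
  fix l
  show "wedge sc v (wedge sc w g) l = (- wedge sc w (wedge sc v g)) l"
  proof (induction l arbitrary: g)
    case (Cons a l)
    have "wedge sc v (wedge sc w g) (a # l) = iota a (wedge sc v (wedge sc w g)) l"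
      "wedge sc w (wedge sc v g) (a # l) = iota a (wedge sc w (wedge sc v g)) l"
      by (simp_all add: iota_def)
    then show ?case
      by (simp add: iota_wedge wedge_diff wedge_fscale fun_apply Cons)
  qed (simp add: fun_apply)
qed

lemma eps_eps [simp]: "eps i (eps i g) = 0"
proof -
  have "eps i (eps i g) + eps i (eps i g) = 0"
    using wedge_anticommute[of "axis i 1" "axis i 1" g] by (metis add.right_inverse)
  then have "fscale sc 2 (eps i (eps i g)) = 0"
    using F.scale_left_distrib[of 1 1 "eps i (eps i g)"] by simp
  then show ?thesis by (simp add: F.scale_eq_0_iff)
qed

text \<open>
  The operator \<open>\<Sum>\<^sub>i e\<^sub>i \<iota>\<^sub>i\<close> counts the degree. Contracting with a further index moves one
  unit of the count outside by the Clifford relation, which is the induction step.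
\<close>

lemma euler:
  assumes "g \<in> forms k"
  shows "(\<Sum>i\<in>UNIV. eps i (iota i g)) = fscale sc (of_nat k) g"
proof
  fix l
  show "(\<Sum>i\<in>UNIV. eps i (iota i g)) l = fscale sc (of_nat k) g l"
    using assms
  proof (induction l arbitrary: g k)
    case Nil
    then show ?case
      by (cases k) (simp_all add: sum_fun_apply fun_apply fscale_def forms_length)
  next
    case (Cons a l)
    show ?case
    proof (cases k)
      case 0
      then have "(\<Sum>i\<in>UNIV. eps i (iota i g)) = 0"
        using iota_forms_0[of g] Cons.prems by (simp only: wedge_zero sum.neutral_const)
      then show ?thesis using 0 by (simp add: fscale_def fun_apply)
    next
      case (Suc m)
      have ia: "iota a g \<in> forms m" using Cons.prems Suc by (simp add: iota_forms)
      have "(\<Sum>i\<in>UNIV. eps i (iota i g)) (a # l) = (\<Sum>i\<in>UNIV. iota a (eps i (iota i g)) l)"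
        by (simp add: sum_fun_apply fun_apply) (simp add: iota_def)
      also have "\<dots> = (\<Sum>i\<in>UNIV. (if a = i then iota i g l else 0) + eps i (iota i (iota a g)) l)"
      proof (intro sum.cong refl)
        fix i
        show "iota a (eps i (iota i g)) l =
            (if a = i then iota i g l else 0) + eps i (iota i (iota a g)) l"
          by (simp add: iota_eps iota_anticommute[OF Cons.prems, of a i] wedge_minus fun_apply)
      qed
      also have "\<dots> = iota a g l + (\<Sum>i\<in>UNIV. eps i (iota i (iota a g))) l"
        by (simp add: sum.distrib sum_fun_apply fun_apply)
      also have "\<dots> = fscale sc (of_nat k) g (a # l)"
        using Cons.IH[OF ia] by (simp add: fscale_def scale_left_distrib Suc) (simp add: iota_def)
      finally show ?thesis .
    qed
  qed
qed

lemma forms_eq_sum: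
  assumes "g \<in> forms (Suc k)"
  shows "g = fscale sc (1 / of_nat (Suc k)) (\<Sum>i\<in>UNIV. eps i (iota i g))"
  using euler[OF assms] by (simp del: of_nat_Suc)

lemma F_mod_subset_forms: "F_mod sc k \<subseteq> forms k"
proof -
  have "pure_tensor sc p y \<in> forms k" if "y \<in> exterior_power k" for p y
    using that by (simp add: pure_tensor_def forms_iff exterior_power_iff scale_left_distrib[symmetric])
  then show ?thesis
    unfolding F_mod_def tensor_product_def
    by (intro F.span_minimal subspace_forms) auto
qed

lemma wedge_F_mod:
  assumes "g \<in> F_mod sc k"
  shows "wedge sc v g \<in> F_mod sc (Suc k)"
  using assms unfolding F_mod_def tensor_product_def
proof (induction g rule: F.span_induct_alt)
  case base
  show ?case by (simp only: wedge_zero F.span_zero)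
next
  case (step c x y)
  then obtain p w where x: "x = pure_tensor sc p w" "w \<in> exterior_power k" by auto
  have "wedge sc v x \<in> {pure_tensor sc p y |p y. p \<in> UNIV \<and> y \<in> exterior_power (Suc k)}"
    using wedge_in_exterior_power[OF x(2)] x(1) wedge_pure_tensor[OF vector_space_axioms] by blast
  then show ?case
    using step by (simp only: wedge_add wedge_fscale F.span_add F.span_scale F.span_base)
qed

text \<open>
  An alternating function of positive degree is a sum of wedge products \<open>e\<^sub>i \<and> \<iota>\<^sub>i g\<close> by Euler's
  formula, so it is a sum of pure tensors by induction on the degree.
\<close>

lemma F_mod_eq_forms: "F_mod sc k = (forms k :: ('n::finite list \<Rightarrow> 'p) set)"
proof
  show "forms k \<subseteq> (F_mod sc k :: ('n list \<Rightarrow> 'p) set)"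
  proof
    fix g :: "'n list \<Rightarrow> 'p"
    assume "g \<in> forms k"
    then show "g \<in> F_mod sc k"
    proof (induction k arbitrary: g)
      case 0
      let ?y = "\<lambda>l. if l = [] then 1 else 0"
      have "g = pure_tensor sc (g []) ?y"
        using forms_length[OF 0] by (auto simp: pure_tensor_def)
      moreover have "?y \<in> exterior_power 0" by (auto simp: exterior_power_0)
      ultimately show ?case
        unfolding F_mod_def tensor_product_def by (intro F.span_base) blast
    next
      case (Suc k)
      have F: "F.subspace (F_mod sc (Suc k) :: ('n list \<Rightarrow> 'p) set)"
        by (simp add: F_mod_def tensor_product_def)
      have "eps i (iota i g) \<in> F_mod sc (Suc k)" for i
        by (intro wedge_F_mod Suc.IH iota_forms Suc.prems)
      then have "fscale sc (1 / of_nat (Suc k)) (\<Sum>i\<in>UNIV. eps i (iota i g)) \<in> F_mod sc (Suc k)"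
        by (intro F.subspace_scale F.subspace_sum F)
      then show ?case by (simp only: forms_eq_sum[OF Suc.prems, symmetric])
    qed
  qed
qed (rule F_mod_subset_forms)

lemma wedge_forms: "g \<in> forms k \<Longrightarrow> wedge sc v g \<in> forms (Suc k)"
  using wedge_F_mod by (simp add: F_mod_eq_forms)

text \<open>
  The form \<open>p \<otimes> e\<^sub>i\<^sub>1 \<and> \<dots> \<and> e\<^sub>i\<^sub>m\<close>. For the empty list this identifies P with the forms of
  degree zero.
\<close>

definition basis_form :: "'n::finite list \<Rightarrow> 'p \<Rightarrow> 'n list \<Rightarrow> 'p"
  where "basis_form T p = foldr eps T (\<lambda>l. if l = [] then p else 0)"

lemma basis_form_Nil: "basis_form [] p = (\<lambda>l. if l = [] then p else 0)"
  and basis_form_Cons: "basis_form (i # T) p = eps i (basis_form T p)"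
  by (simp_all add: basis_form_def)

lemma basis_form_forms: "basis_form T p \<in> forms (length T)"
proof (induction T)
  case Nil
  show ?case by (simp add: basis_form_def forms_iff)
qed (simp add: basis_form_Cons wedge_forms)

lemma forms_subset_subspace:
  fixes G :: "('n::finite list \<Rightarrow> 'p) set"
  assumes "F.subspace G" "\<And>T p. length T = k \<Longrightarrow> basis_form T p \<in> G"
  shows "forms k \<subseteq> G"
proof
  fix g :: "'n list \<Rightarrow> 'p"
  assume "g \<in> forms k"
  then show "g \<in> G" using assms
  proof (induction k arbitrary: g G)
    case 0
    have "g = basis_form [] (g [])"
      using forms_length[OF 0(1)] by (auto simp: basis_form_Nil)
    then show ?case using 0(3)[of "[]"] by (metis list.size(3))
  next
    case (Suc k)
    have "iota i g \<in> {h. eps i h \<in> G}" for i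
    proof (rule Suc.IH)
      show "iota i g \<in> forms k" by (rule iota_forms[OF Suc.prems(1)])
      show "F.subspace {h. eps i h \<in> G}"
        using Suc.prems(2) by (auto simp: F.subspace_def wedge_add wedge_fscale)
      show "basis_form T p \<in> {h. eps i h \<in> G}" if "length T = k" for T p
        using Suc.prems(3)[of "i # T" p] that by (simp add: basis_form_Cons)
    qed
    then have "fscale sc (1 / of_nat (Suc k)) (\<Sum>i\<in>UNIV. eps i (iota i g)) \<in> G"
      by (intro F.subspace_scale F.subspace_sum Suc.prems(2)) simp_all
    then show ?case by (simp only: forms_eq_sum[OF Suc.prems(1), symmetric])
  qed
qed

lemma foldr_eps_linear:
  "foldr eps T (f + g) = foldr eps T f + foldr eps T g"
  "foldr eps T (f - g) = foldr eps T f - foldr eps T g"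
  "foldr eps T (fscale sc c g) = fscale sc c (foldr eps T g)"
  by (induction T) (simp_all add: wedge_add wedge_diff wedge_fscale)

text \<open>
  Moving a creation operator to the left past the contractions \<open>iotas S\<close> costs a sign and terms
  with one contraction fewer. Modulo the latter, membership in a subspace does not change.
\<close>

lemma iotas_eps_mod:
  assumes G: "F.subspace G"
    and lower: "\<And>S'. Suc (length S') = length S \<Longrightarrow> foldr eps T (iotas S' w) \<in> G"
  shows "foldr eps T (iotas S (eps i w)) \<in> G \<longleftrightarrow> foldr eps T (eps i (iotas S w)) \<in> G"
  using lower
proof (induction S arbitrary: w)
  case (Cons s S)
  have 1: "foldr eps T (iotas S (if s = i then w else 0)) \<in> G"
  proof (cases "s = i")
    case False
    have "iotas S (0 :: 'a list \<Rightarrow> 'p) = 0" by (simp add: iotas_def fun_eq_iff fun_apply)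
    moreover have "foldr eps T 0 = 0" by (induction T) simp_all
    ultimately show ?thesis using False G by (simp add: F.subspace_0)
  qed (use Cons.prems[of S] in simp)
  have "foldr eps T (iotas (s # S) (eps i w)) =
      foldr eps T (iotas S (if s = i then w else 0)) - foldr eps T (iotas S (eps i (iota s w)))"
    by (simp add: iotas_Cons iota_eps iotas_diff foldr_eps_linear)
  then have "foldr eps T (iotas (s # S) (eps i w)) \<in> G \<longleftrightarrow>
      foldr eps T (iotas S (eps i (iota s w))) \<in> G"
    using F.subspace_diff[OF G 1, of "foldr eps T (iotas S (eps i (iota s w)))"]
      F.subspace_diff[OF G 1, of "foldr eps T (iotas (s # S) (eps i w))"] by auto
  also have "\<dots> \<longleftrightarrow> foldr eps T (eps i (iotas S (iota s w))) \<in> G"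
  proof (rule Cons.IH)
    show "foldr eps T (iotas S' (iota s w)) \<in> G" if "Suc (length S') = length S" for S'
      using Cons.prems[of "s # S'"] that by (simp add: iotas_Cons)
  qed
  finally show ?case by (simp add: iotas_Cons)
qed simp

text \<open>
  A subspace stable under the matrix units \<open>e\<^sub>i \<iota>\<^sub>a\<close> of \<open>gl\<^sub>n\<close> is stable under all products of m
  creation and m annihilation operators in normal order. A product of m + 1 pairs is obtained
  by applying m pairs to \<open>e\<^sub>i \<iota>\<^sub>a z\<close> and reordering; the lower terms have m pairs again. For m
  equal to the degree, these products are the matrix units of the exterior power.
\<close>

lemma normal_ordered_closed:
  assumes G: "F.subspace G"
    and move: "\<And>i a z. z \<in> G \<Longrightarrow> eps i (iota a z) \<in> G"
    and "z \<in> G" "length T = length S"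
  shows "foldr eps T (iotas S z) \<in> G"
  using assms(3,4)
proof (induction "length S" arbitrary: S T z)
  case 0
  then show ?case by simp
next
  case (Suc m)
  obtain a S' where S: "S = a # S'" "length S' = m" using Suc.hyps(2) by (cases S) auto
  obtain i T' where T: "T = T' @ [i]" "length T' = m"
    using Suc.hyps(2) Suc.prems(2) by (cases T rule: rev_cases) auto
  have "foldr eps T' (iotas S' (eps i (iota a z))) \<in> G"
    using Suc.hyps(1)[of S' "eps i (iota a z)" T'] S T Suc.prems move by simp
  moreover have "foldr eps T' (iotas S'' (iota a z)) \<in> G" if "Suc (length S'') = length S'" for S''
    using Suc.hyps(1)[of "a # S''" z T'] that S T Suc.prems by (simp add: iotas_Cons)
  ultimately have "foldr eps T' (eps i (iotas S' (iota a z))) \<in> G"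
    using iotas_eps_mod[OF G, of S' T'] by blast
  then show ?case by (simp add: S T iotas_Cons)
qed

lemma iotas_full:
  assumes "g \<in> forms k" "length S = k"
  shows "iotas S g = (\<lambda>l. if l = [] then g S else 0)"
  using forms_length[OF assms(1)] assms(2) by (auto simp: iotas_def fun_eq_iff fun_apply)

lemma iota_iota:
  assumes "g \<in> forms k"
  shows "iota b (iota b g) = (0 :: 'n::finite list \<Rightarrow> 'p)"
proof -
  have "iota b (iota b g) + iota b (iota b g) = 0"
    using iota_anticommute[OF assms, of b b] by (metis add.right_inverse)
  then have "fscale sc 2 (iota b (iota b g)) = 0"
    using F.scale_left_distrib[of 1 1 "iota b (iota b g)"] by simp
  then show ?thesis by (simp add: F.scale_eq_0_iff)
qed

lemma basis_form_add: "basis_form T (p + q) = basis_form T p + basis_form T q"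
  by (induction T) (simp_all add: basis_form_Cons wedge_add, auto simp: basis_form_Nil fun_apply)

lemma basis_form_scale: "basis_form T (sc c p) = fscale sc c (basis_form T p)"
  by (induction T) (simp_all add: basis_form_Cons wedge_fscale, auto simp: basis_form_Nil fscale_def)

lemma basis_form_zero [simp]: "basis_form T 0 = 0"
  using basis_form_scale[of T 0 0] by simp

lemma basis_form_sum: "basis_form T (\<Sum>i\<in>I. f i) = (\<Sum>i\<in>I. basis_form T (f i))"
  by (induction I rule: infinite_finite_induct) (simp_all add: basis_form_add)

end

section \<open>The differential and the Cartan formula\<close>

text \<open>
  The complex vector of an exponent. The differential of \<open>x\<^sup>r\<close> is \<open>x\<^sup>r\<close> times the constant form
  \<open>cvec r\<close>.
\<close>

definition cvec :: "int ^ 'n \<Rightarrow> complex ^ 'n"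
  where "cvec r = (\<chi> i. of_int (r $ i))"

lemma cvec_0 [simp]: "cvec 0 = 0"
  and cvec_axis [simp]: "cvec (axis i 1) = axis i 1"
  by (simp_all add: cvec_def vec_eq_iff axis_def)

lemma cvec_add: "cvec (r + s) = cvec r + cvec s"
  by (simp add: cvec_def vec_eq_iff)

text \<open>
  A divergence zero field is a combination of the \<open>D u r\<close> with \<open>(u|r) = 0\<close>, but the action is
  defined through the expansion by \<open>witt_coeff\<close>. This expansion only involves such fields, so
  that stability can be tested on them.
\<close>

lemma dual_pairing_witt_coeff:
  fixes \<delta> :: "'n::finite laurent \<Rightarrow> 'n laurent"
  assumes "\<delta> \<in> div_zero_algebra"
  shows "dual_pairing (witt_coeff \<delta> r) r = 0"
proof -
  interpret L: vector_space
    "fscale lscale :: complex \<Rightarrow> ('n laurent \<Rightarrow> 'n laurent) \<Rightarrow> 'n laurent \<Rightarrow> 'n laurent"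
    by (intro vector_space_fscale vector_space_lscale)
  have sub: "L.subspace {\<delta>. dual_pairing (witt_coeff \<delta> r) r = 0}"
    unfolding L.subspace_def
    by (simp add: dual_pairing_def witt_coeff_def fscale_def fun_apply lookup_add distrib_right
        sum.distrib mult.assoc sum_distrib_left[symmetric])
  have "div_zero_algebra \<subseteq> {\<delta> :: 'n laurent \<Rightarrow> _. dual_pairing (witt_coeff \<delta> r) r = 0}"
    unfolding div_zero_algebra_def
    by (intro L.span_minimal sub) (auto simp: witt_coeff_D dual_pairing_def)
  then show ?thesis using assms by auto
qed

lemma D_in_div_zero:
  fixes u :: "complex ^ 'n::finite"
  assumes "dual_pairing u r = 0"
  shows "D u r \<in> div_zero_algebra"
proof -
  interpret L: vector_space
    "fscale lscale :: complex \<Rightarrow> ('n laurent \<Rightarrow> 'n laurent) \<Rightarrow> 'n laurent \<Rightarrow> 'n laurent"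
    by (intro vector_space_fscale vector_space_lscale)
  show ?thesis
    unfolding div_zero_algebra_def using assms by (intro L.span_base) blast
qed

sublocale weyl_module \<subseteq> form_space sc ..

context weyl_module
begin

text \<open>
  The operators \<open>x\<^sup>r\<close> and \<open>\<partial>\<^sub>i\<close> acting on the coefficients of a form.
\<close>

definition xx :: "int ^ 'n \<Rightarrow> ('n list \<Rightarrow> 'p) \<Rightarrow> 'n list \<Rightarrow> 'p"
  where "xx r g = (\<lambda>l. X r (g l))"

definition pd :: "'n \<Rightarrow> ('n list \<Rightarrow> 'p) \<Rightarrow> 'n list \<Rightarrow> 'p"
  where "pd i g = (\<lambda>l. dd i (g l))"

definition iotav :: "complex ^ 'n \<Rightarrow> ('n list \<Rightarrow> 'p) \<Rightarrow> 'n list \<Rightarrow> 'p"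
  where "iotav u g = (\<Sum>b\<in>UNIV. fscale sc (u $ b) (iota b g))"

abbreviation d :: "('n list \<Rightarrow> 'p) \<Rightarrow> 'n list \<Rightarrow> 'p"
  where "d \<equiv> d_map sc \<rho>"

lemma d_def: "d g = (\<Sum>i\<in>UNIV. eps i (pd i g))"
  by (simp add: d_map_def pd_def dd_def)

lemma X_minus: "X r (- z) = - X r z"
  and X_diff: "X r (z - w) = X r z - X r w"
  using X_scale[of r "-1"] X_add[of r z "- w"] by simp_all

lemma xx_add: "xx r (f + g) = xx r f + xx r g"
  and xx_diff: "xx r (f - g) = xx r f - xx r g"
  and xx_fscale: "xx r (fscale sc c g) = fscale sc c (xx r g)"
  and xx_zero [simp]: "xx r 0 = 0"
  and xx_xx: "xx r (xx s g) = xx (r + s) g"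
  and xx_0 [simp]: "xx 0 g = g"
  by (simp_all add: xx_def fscale_def fun_eq_iff fun_apply X_add X_scale X_X X_minus X_diff)

lemma xx_sum: "xx r (\<Sum>i\<in>I. f i) = (\<Sum>i\<in>I. xx r (f i))"
  by (induction I rule: infinite_finite_induct) (simp_all add: xx_add)

lemma pd_add: "pd i (f + g) = pd i f + pd i g"
  and pd_fscale: "pd i (fscale sc c g) = fscale sc c (pd i g)"
  and pd_zero [simp]: "pd i 0 = 0"
  and pd_pd: "pd i (pd j g) = pd j (pd i g)"
  and pd_xx: "pd i (xx r g) = xx r (pd i g) + fscale sc (of_int (r $ i)) (xx r g)"
  by (simp_all add: pd_def xx_def fscale_def fun_eq_iff fun_apply dd_add dd_scale dd_X dd_dd)

lemma pd_sum: "pd i (\<Sum>j\<in>I. f j) = (\<Sum>j\<in>I. pd i (f j))"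
  by (induction I rule: infinite_finite_induct) (simp_all add: pd_add)

lemma wedge_xx: "wedge sc v (xx r g) = xx r (wedge sc v g)"
  unfolding xx_def by (rule wedge_map[OF X_add X_scale])

lemma wedge_pd: "wedge sc v (pd i g) = pd i (wedge sc v g)"
  unfolding pd_def by (rule wedge_map[OF dd_add dd_scale])

lemma iota_xx: "iota a (xx r g) = xx r (iota a g)"
  and iota_pd: "iota a (pd i g) = pd i (iota a g)"
  by (simp_all add: iota_def xx_def pd_def)

lemma iota_sum: "iota a (\<Sum>i\<in>I. f i) = (\<Sum>i\<in>I. iota a (f i :: 'n list \<Rightarrow> 'p))"
  by (induction I rule: infinite_finite_induct) (simp_all add: iota_add)

lemma d_add: "d (f + g) = d f + d g"
  by (simp add: d_def pd_add wedge_add sum.distrib)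

lemma d_fscale: "d (fscale sc c g) = fscale sc c (d g)"
  by (simp add: d_def pd_fscale wedge_fscale F.scale_sum_right)

lemma d_zero [simp]: "d 0 = 0"
  by (simp add: d_def)

lemma d_minus: "d (- g) = - d g"
  using d_fscale[of "-1" g] by simp

lemma d_diff: "d (f - g) = d f - d g"
  using d_add[of f "- g"] by (simp add: d_minus)

lemma d_sum: "d (\<Sum>i\<in>I. f i) = (\<Sum>i\<in>I. d (f i))"
  by (induction I rule: infinite_finite_induct) (simp_all add: d_add)

lemma d_xx: "d (xx r g) = xx r (d g + wedge sc (cvec r) g)"
  by (simp add: d_def pd_xx wedge_add wedge_fscale wedge_xx sum.distrib xx_add xx_sum
      wedge_expand[of "cvec r"] xx_fscale) (simp add: cvec_def)

lemma d_d [simp]: "d (d g) = 0"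
proof -
  have "d (d g) = (\<Sum>i\<in>UNIV. \<Sum>j\<in>UNIV. eps i (eps j (pd i (pd j g))))"
    by (simp add: d_def pd_sum wedge_sum wedge_pd)
  also have "\<dots> = (\<Sum>i\<in>UNIV. \<Sum>j\<in>UNIV. - eps i (eps j (pd i (pd j g))))"
    by (subst sum.swap, intro sum.cong refl, subst wedge_anticommute) (simp only: pd_pd)
  also have "\<dots> = - (\<Sum>i\<in>UNIV. \<Sum>j\<in>UNIV. eps i (eps j (pd i (pd j g))))"
    by (simp add: sum_negf)
  also have "\<dots> = - d (d g)"
    by (simp add: d_def pd_sum wedge_sum wedge_pd)
  finally have "d (d g) + d (d g) = 0" by (metis add.right_inverse)
  then have "fscale sc 2 (d (d g)) = 0"
    using F.scale_left_distrib[of 1 1 "d (d g)"] by simp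
  then show ?thesis by (simp add: F.scale_eq_0_iff)
qed

text \<open>
  The Lie derivative along a constant field \<open>\<partial>\<^sub>a\<close> is \<open>\<partial>\<^sub>a\<close> on coefficients.
\<close>

lemma iota_d: "iota a (d g) = pd a g - d (iota a g)"
proof -
  have "iota a (d g) = (\<Sum>i\<in>UNIV. (if a = i then pd i g else 0) - eps i (pd i (iota a g)))"
    by (simp add: d_def iota_sum iota_eps iota_pd)
  then show ?thesis by (simp add: sum_subtractf d_def)
qed

lemma xx_forms: "g \<in> forms k \<Longrightarrow> xx r g \<in> forms k"
  and pd_forms: "g \<in> forms k \<Longrightarrow> pd i g \<in> forms k"
  by (simp_all add: forms_iff xx_def pd_def X_add[symmetric] dd_add[symmetric])

lemma d_forms: "g \<in> forms k \<Longrightarrow> d g \<in> forms (Suc k)"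
  unfolding d_def by (intro F.subspace_sum subspace_forms wedge_forms pd_forms)

lemma iotav_axis: "iotav (axis a 1) g = iota a g"
proof -
  have "iotav (axis a 1) g = (\<Sum>b\<in>UNIV. if b = a then iota a g else 0)"
    unfolding iotav_def by (intro sum.cong) (auto simp: axis_def)
  then show ?thesis by simp
qed

lemma iotav_d: "iotav u (d g) = (\<Sum>b\<in>UNIV. fscale sc (u $ b) (pd b g)) - d (iotav u g)"
  by (simp add: iotav_def iota_d F.scale_right_diff_distrib sum_subtractf d_sum d_fscale)

text \<open>
  The matrix \<open>r u\<^sup>T\<close> has rank one. On alternating tensors, replacing one slot after the other
  is contracting with u and then wedging with r.
\<close>

lemma gl_act_outer:
  assumes "g \<in> forms k"
  shows "gl_act sc (outer r u) g = wedge sc (cvec r) (iotav u g)"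
proof
  fix l
  show "gl_act sc (outer r u) g l = wedge sc (cvec r) (iotav u g) l"
    using assms
  proof (induction l arbitrary: g k)
    case (Cons a l)
    have "iota a (iotav u g) = - iotav u (iota a g)"
      by (simp add: iotav_def iota_sum iota_fscale sum_negf
          iota_anticommute[OF Cons.prems, of a])
    moreover have "gl_act sc (outer r u) (iota a g) l = wedge sc (cvec r) (iotav u (iota a g)) l"
      by (rule Cons.IH[OF iota_forms_pred[OF Cons.prems]])
    moreover have "wedge sc (cvec r) (iotav u g) (a # l) = iota a (wedge sc (cvec r) (iotav u g)) l"
      by (simp add: iota_def)
    ultimately show ?case
      by (simp add: gl_act_Cons iota_wedge wedge_minus fun_apply)
         (simp add: iota_def iotav_def sum_fun_apply fscale_def outer_def cvec_def scale_sum_right)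
  qed simp
qed

text \<open>
  Both sides agree with \<open>x\<^sup>r (\<partial>\<^sub>u + r \<and> \<iota>\<^sub>u) g\<close>: the differential of \<open>x\<^sup>r\<close> produces the term with
  \<open>r\<close>, and the remaining terms add up to \<open>\<partial>\<^sub>u\<close>.
\<close>

lemma F_D_cartan:
  assumes "g \<in> forms k"
  shows "F_D sc \<rho> u r g = d (xx r (iotav u g)) + xx r (iotav u (d g))"
proof -
  have "F_D sc \<rho> u r g =
      xx r (\<Sum>b\<in>UNIV. fscale sc (u $ b) (pd b g)) + xx r (gl_act sc (outer r u) g)"
    by (simp add: F_D_def fun_eq_iff fun_apply xx_def rho_D sum_fun_apply fscale_def pd_def)
       (simp add: X_def)
  then show ?thesis
    by (simp add: gl_act_outer[OF assms] d_xx iotav_d xx_add xx_diff)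
qed

lemma F_D_closed:
  assumes "g \<in> forms k" "d g = 0"
  shows "F_D sc \<rho> u r g = d (xx r (iotav u g))"
  using F_D_cartan[OF assms(1)] assms(2) by (simp add: iotav_def)

lemma F_D_d:
  assumes "g \<in> forms k"
  shows "F_D sc \<rho> u r (d g) = d (F_D sc \<rho> u r g)"
  using F_D_cartan[OF assms] F_D_closed[OF d_forms[OF assms]] by (simp add: d_add)

lemma F_act_partial:
  assumes "g \<in> forms k"
  shows "F_act sc \<rho> (partial i) g = pd i g"
  by (simp add: D_axis[symmetric] F_act_D F_D_cartan[OF assms] iotav_axis iota_d)

lemma div_zero_submodule_iff:
  "submodule (fscale sc) div_zero_algebra (F_act sc \<rho>) N M \<longleftrightarrow>
    F.subspace N \<and> N \<subseteq> M \<and>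
    (\<forall>u r g. dual_pairing u r = 0 \<longrightarrow> g \<in> N \<longrightarrow> F_D sc \<rho> u r g \<in> N)"
proof
  assume "submodule (fscale sc) div_zero_algebra (F_act sc \<rho>) N M"
  then show "F.subspace N \<and> N \<subseteq> M \<and>
    (\<forall>u r g. dual_pairing u r = 0 \<longrightarrow> g \<in> N \<longrightarrow> F_D sc \<rho> u r g \<in> N)"
    by (simp add: submodule_def F_act_D[symmetric] D_in_div_zero)
next
  assume "F.subspace N \<and> N \<subseteq> M \<and>
    (\<forall>u r g. dual_pairing u r = 0 \<longrightarrow> g \<in> N \<longrightarrow> F_D sc \<rho> u r g \<in> N)"
  then show "submodule (fscale sc) div_zero_algebra (F_act sc \<rho>) N M"
    by (auto simp: submodule_def F_act_def dual_pairing_witt_coeff intro!: F.subspace_sum)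
qed

lemma cartan_image_F:
  assumes "M \<subseteq> forms k"
  shows "cartan_image (F_act sc \<rho>) M = {\<Sum>i\<in>UNIV. pd i (m i) | m. \<forall>i. m i \<in> M}"
proof -
  have "(\<Sum>i\<in>UNIV. F_act sc \<rho> (partial i) (m i)) = (\<Sum>i\<in>UNIV. pd i (m i))" if "\<forall>i. m i \<in> M" for m
  proof (intro sum.cong refl)
    fix i
    have "m i \<in> forms k" using that assms by auto
    then show "F_act sc \<rho> (partial i) (m i) = pd i (m i)" by (rule F_act_partial)
  qed
  then show ?thesis unfolding cartan_image_def by (intro Collect_cong) metis
qed

end

section \<open>Submodules of the functions\<close>

lemma dual_pairing_axis [simp]: "dual_pairing (axis a 1) r = of_int (r $ a)"
proof -
  have "dual_pairing (axis a 1) r = (\<Sum>b\<in>UNIV. if b = a then of_int (r $ a) else 0)"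
    unfolding dual_pairing_def by (intro sum.cong) (auto simp: axis_def)
  then show ?thesis by simp
qed

lemma dual_pairing_add: "dual_pairing (u + v) r = dual_pairing u r + dual_pairing v r"
  and dual_pairing_scale: "dual_pairing (c *s u) r = c * dual_pairing u r"
  by (simp_all add: dual_pairing_def sum.distrib distrib_right sum_distrib_left mult.assoc)

context weyl_module
begin

definition partial_along :: "complex ^ 'n \<Rightarrow> 'p \<Rightarrow> 'p"
  where "partial_along u z = (\<Sum>i\<in>UNIV. sc (u $ i) (dd i z))"

lemma dd_diff: "dd i (z - w) = dd i z - dd i w"
  using dd_add[of i z "- w"] dd_scale[of i "-1" w] by simp

lemma X_sum: "X r (\<Sum>i\<in>I. f i) = (\<Sum>i\<in>I. X r (f i))"
  by (induction I rule: infinite_finite_induct) (simp_all add: X_add)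

lemma partial_along_axis: "partial_along (axis a 1) z = dd a z"
proof -
  have "partial_along (axis a 1) z = (\<Sum>b\<in>UNIV. if b = a then dd a z else 0)"
    unfolding partial_along_def by (intro sum.cong) (auto simp: axis_def)
  then show ?thesis by simp
qed

lemma partial_along_add: "partial_along (u + v) z = partial_along u z + partial_along v z"
  and partial_along_scale: "partial_along (c *s u) z = sc c (partial_along u z)"
  by (simp_all add: partial_along_def scale_left_distrib sum.distrib scale_sum_right)

lemma partial_along_X: "partial_along u (X r z) = X r (partial_along u z) + sc (dual_pairing u r) (X r z)"
  by (simp add: partial_along_def dd_X scale_right_distrib sum.distrib X_sum X_scale dual_pairing_def
      scale_sum_left)

text \<open>
  The compositions \<open>D u (t - s) \<circ> D v s\<close> within N give \<open>\<partial>\<^sub>i x\<^sup>t \<partial>\<^sub>j N \<subseteq> N\<close>. From then on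
  only the Weyl algebra acts, and simplicity of P applies.
\<close>

lemma div_zero_stable_contains_image:
  assumes n: "CARD('n) \<ge> 2"
    and simple: "simple_module sc weyl_algebra \<rho> UNIV"
    and N: "subspace N"
    and stable: "\<And>u r z. dual_pairing u r = 0 \<Longrightarrow> z \<in> N \<Longrightarrow> X r (partial_along u z) \<in> N"
    and z0: "z0 \<in> N" "dd j0 z0 \<noteq> 0"
  shows "dd i w \<in> N"
proof -
  \<comment> \<open>As \<open>(u|t - s) = 0\<close>, the factor \<open>x\<^sup>t\<^sup>-\<^sup>s\<close> passes through \<open>\<partial>\<^sub>u\<close> and merges with \<open>x\<^sup>s\<close>.\<close>
  have prod: "partial_along u (X t (partial_along v z)) \<in> N"
    if "dual_pairing u (t - s) = 0" "dual_pairing v s = 0" "z \<in> N" for u v s t z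
  proof -
    have "X (t - s) (partial_along u (X s (partial_along v z))) \<in> N"
      by (intro stable that)
    also have "X (t - s) (partial_along u (X s (partial_along v z))) = partial_along u (X t (partial_along v z))"
      using partial_along_X[of u "t - s" "X s (partial_along v z)"] that(1) by (simp add: X_X)
    finally show ?thesis .
  qed
  have off: "dd i (X t (dd j z)) \<in> N" if "z \<in> N" "i \<noteq> j" for i j t z
    using prod[of "axis i 1" t "axis i (t $ i)" "axis j 1" z] that
    by (simp add: partial_along_axis) (simp add: axis_def)
  have all: "dd i (X t (dd j z)) \<in> N" if z: "z \<in> N" for i j t z
  proof (cases "i = j")
    case True
    obtain l where l: "l \<noteq> i"
      using n by (metis card_2_iff' card_le_Suc0_iff_eq finite le_antisym nat_le_linear not_less_eq_eq
          numeral_2_eq_2 UNIV_I)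
    \<comment> \<open>The exponent \<open>s = (t\<^sub>l + 1) e\<^sub>l\<close> is orthogonal to \<open>e\<^sub>i\<close>, and \<open>t - s\<close> is orthogonal to \<open>e\<^sub>i + t\<^sub>i e\<^sub>l\<close>.
      The mixed term with \<open>l \<noteq> i\<close> is already known to lie in N.\<close>
    let ?u = "axis i 1 + of_int (t $ i) *s axis l 1"
    have "partial_along ?u (X t (partial_along (axis i 1) z)) \<in> N"
      using l z by (intro prod[of _ _ "axis l (t $ l + 1)"])
        (simp_all add: dual_pairing_add dual_pairing_scale, simp_all add: axis_def)
    then have "dd i (X t (dd i z)) + sc (of_int (t $ i)) (dd l (X t (dd i z))) \<in> N"
      by (simp add: partial_along_add partial_along_scale partial_along_axis)
    moreover have "sc (of_int (t $ i)) (dd l (X t (dd i z))) \<in> N"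
      by (intro subspace_scale[OF N] off z l)
    ultimately show ?thesis
      using subspace_diff[OF N] True by fastforce
  qed (rule off[OF z])
  define M where "M = {w. \<forall>i t. dd i (X t w) \<in> N}"
  have M: "subspace M"
    using N by (auto simp: M_def subspace_def X_add X_scale dd_add dd_scale)
  have XM: "X r w \<in> M" if "w \<in> M" for r w
    using that by (simp add: M_def X_X)
  have ddM: "dd l w \<in> M" if w: "w \<in> M" for l w
  proof -
    have sq: "X (- b) (dd l (dd l (X b w))) \<in> M" for b
    proof (rule XM)
      have "dd l (X b w) \<in> N" using w by (simp add: M_def)
      then show "dd l (dd l (X b w)) \<in> M" using all by (simp add: M_def)
    qed
    \<comment> \<open>Conjugation by \<open>x\<^sub>l\<close> shifts \<open>\<partial>\<^sub>l\<close> by one, and \<open>(\<partial>\<^sub>l + 1)\<^sup>2 - (\<partial>\<^sub>l - 1)\<^sup>2 = 4 \<partial>\<^sub>l\<close>.\<close>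
    have "X (- axis l 1) (dd l (dd l (X (axis l 1) w)))
        - X (axis l 1) (dd l (dd l (X (- axis l 1) w))) = sc 4 (dd l w)"
    proof -
      have "sc 4 (dd l w) = sc 2 (dd l w) + sc 2 (dd l w)"
        by (simp add: scale_left_distrib[symmetric])
      moreover have "sc 2 (dd l w) = dd l w + dd l w"
        using scale_left_distrib[of 1 1] by simp
      ultimately show ?thesis
        by (simp add: dd_X dd_add dd_diff dd_scale X_add X_diff X_scale X_X axis_nth)
    qed
    then have "sc 4 (dd l w) \<in> M"
      using subspace_diff[OF M sq[of "axis l 1"] sq[of "- axis l 1"]] by simp
    from subspace_scale[OF M this, of "1/4"] show ?thesis by simp
  qed
  have "dd j0 z0 \<in> M" using all[OF z0(1)] by (simp add: M_def)
  then have "w \<in> M" using simple_subspace_UNIV[OF simple M XM ddM] z0(2) by blast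
  then have "dd i (X 0 w) \<in> N" unfolding M_def by blast
  then show ?thesis by simp
qed

section \<open>Exact forms of degree between two and n - 1\<close>

lemma basis_form_X: "basis_form T (X r p) = xx r (basis_form T p)"
  and basis_form_dd: "basis_form T (dd i p) = pd i (basis_form T p)"
proof -
  show "basis_form T (X r p) = xx r (basis_form T p)"
    by (induction T) (simp_all add: basis_form_Cons wedge_xx, auto simp: basis_form_Nil xx_def)
  show "basis_form T (dd i p) = pd i (basis_form T p)"
    by (induction T) (simp_all add: basis_form_Cons wedge_pd, auto simp: basis_form_Nil pd_def)
qed

text \<open>
  The forms in N have degree \<open>m + 1\<close>. The proof enlarges the supply of operators h, lowering the
  degree by one, for which \<open>d (x\<^sup>t (h y))\<close> lies in N for all t and all y in N, until h can be any
  contraction. Commuting contractions with d then makes G stable under the Weyl algebra and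
  under the matrix units, which leaves no room for a proper subspace.
\<close>

lemma exact_forms_in_stable_subspace:
  assumes simple: "simple_module sc weyl_algebra \<rho> UNIV"
    and m: "1 \<le> m" "Suc m < CARD('n)"
    and N: "F.subspace N" "N \<subseteq> d ` forms m"
    and stable: "\<And>u r g. dual_pairing u r = 0 \<Longrightarrow> g \<in> N \<Longrightarrow> F_D sc \<rho> u r g \<in> N"
    and y0: "y0 \<in> N" "y0 \<noteq> 0"
    and g: "g \<in> forms m"
  shows "d g \<in> N"
proof -
  have form: "y \<in> forms (Suc m)" and closed: "d y = 0" if "y \<in> N" for y
    using that N(2) d_forms by auto
  have contract: "d (xx r (iota a y)) \<in> N" if "y \<in> N" "r $ a = 0" for y r a
    using stable[of "axis a 1" r y] F_D_closed[OF form closed, of y "axis a 1" r] that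
    by (simp add: iotav_axis)
  define G where "G = {z. \<forall>t. d (xx t z) \<in> N}"
  have G: "F.subspace G"
    using N(1) by (auto simp: G_def F.subspace_def xx_add xx_fscale d_add d_fscale)
  have xxG: "xx r z \<in> G" if "z \<in> G" for r z
    using that by (simp add: G_def xx_xx)
  have xxG_iff: "xx r z \<in> G \<longleftrightarrow> z \<in> G" for r z
    using xxG[of z r] xxG[of "xx r z" "- r"] by (auto simp: xx_xx)
  have dG: "d (xx t z) \<in> N" if "z \<in> G" for t z
    using that by (simp add: G_def)
  \<comment> \<open>Contract with \<open>c\<close> and then with \<open>b\<close>. The total exponent t is fixed, while the first exponent
    s may vary in the coordinate a; the result depends on s only through \<open>s \<and> _\<close>.\<close>
  have base: "iota b (eps a (iota c y)) \<in> G" if y: "y \<in> N" and abc: "a \<noteq> b" "a \<noteq> c" "b \<noteq> c" for a b c y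
    unfolding G_def
  proof (intro CollectI allI)
    fix t :: "int ^ 'n"
    have step: "d (xx t (iota b (d (iota c y)) + iota b (wedge sc (cvec s) (iota c y)))) \<in> N"
      if "s $ c = 0" "s $ b = t $ b" for s
    proof -
      have "d (xx (t - s) (iota b (d (xx s (iota c y))))) \<in> N"
        using that by (intro contract y) simp_all
      then show ?thesis by (simp add: d_xx[of s] iota_xx iota_add xx_xx xx_add)
    qed
    let ?s = "axis b (t $ b)"
    have "d (xx t (iota b (wedge sc (cvec (axis a 1 + ?s)) (iota c y))))
        - d (xx t (iota b (wedge sc (cvec ?s) (iota c y)))) \<in> N"
      using F.subspace_diff[OF N(1) step[of "axis a 1 + ?s"] step[of ?s]] abc
      by (simp add: axis_def d_add xx_add)
    then show "d (xx t (iota b (eps a (iota c y)))) \<in> N"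
      by (simp add: cvec_add wedge_vec_add iota_add xx_add d_add)
  qed
  \<comment> \<open>If h maps N into G, apply it to \<open>d (x\<^sup>s z) = x\<^sup>s (d z + s \<and> z)\<close> and let s vary.\<close>
  have compose: "h (eps i z) \<in> G \<and> h (d z) \<in> G"
    if h: "\<And>y. y \<in> N \<Longrightarrow> h y \<in> G" "\<And>r g. h (xx r g) = xx r (h g)" "\<And>f g. h (f + g) = h f + h g"
      and z: "z \<in> G" for h i z
  proof -
    have *: "h (d z) + h (wedge sc (cvec s) z) \<in> G" for s
      using h(1)[OF dG[OF z, of s]] by (simp add: d_xx h(2,3) xxG_iff)
    have "h (d z) \<in> G"
      using h(1)[OF dG[OF z, of 0]] by simp
    then show ?thesis using F.subspace_diff[OF G *[of "axis i 1"]] by fastforce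
  qed
  \<comment> \<open>Compose two of the basic operators. The middle pair \<open>\<iota>\<^sub>b e\<^sub>b\<close> is the identity on a form that
    \<open>\<iota>\<^sub>b\<close> kills.\<close>
  have clifford: "iota c (eps a (iota a (eps c (iota b y)))) \<in> G"
    if y: "y \<in> N" and abc: "a \<noteq> b" "a \<noteq> c" "b \<noteq> c" for a b c y
  proof -
    let ?z = "iota a (eps c (iota b y))"
    have bb: "iota b (iota b y) = 0" by (rule iota_iota[OF form[OF y]])
    have "eps c (iota b y) \<in> forms (Suc m)"
      by (intro wedge_forms iota_forms form y)
    from iota_anticommute[OF this, of b a] have "iota b ?z = 0"
      using abc by (simp add: iota_eps bb)
    then have "iota b (eps b ?z) = ?z" by (simp add: iota_eps)
    moreover have "iota c (eps a (iota b (eps b ?z))) \<in> G"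
      by (rule compose[of "\<lambda>g. iota c (eps a (iota b g))", THEN conjunct1])
        (use abc in \<open>auto simp: iota_xx wedge_xx iota_add wedge_add intro!: base y\<close>)
    ultimately show ?thesis by simp
  qed
  \<comment> \<open>Sum over a with Euler's formula: the degree is \<open>m + 1\<close>, the index \<open>a = c\<close> contributes
    1, and \<open>a = b\<close> contributes 0, so the factor m remains.\<close>
  have number: "iota c (eps c (iota b y)) \<in> G" if y: "y \<in> N" and bc: "b \<noteq> c" for b c y
  proof -
    let ?v = "eps c (iota b y)"
    let ?f = "\<lambda>a. iota c (eps a (iota a ?v))"
    have v: "?v \<in> forms (Suc m)" by (intro wedge_forms iota_forms form y)
    have "(\<Sum>a\<in>UNIV - {b, c}. ?f a) \<in> G"
      using y bc by (intro F.subspace_sum G clifford) auto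
    moreover have "(\<Sum>a\<in>UNIV. ?f a) = ?f c + (?f b + (\<Sum>a\<in>UNIV - {b, c}. ?f a))"
      using bc by (simp add: sum.remove[of UNIV c] sum.remove[of "UNIV - {c}" b] insert_commute
          Diff_insert2[symmetric])
    moreover have "?f b = 0" using bc by (simp add: iota_eps iota_iota[OF form[OF y]])
    moreover have "?f c = iota c ?v" by (simp add: iota_eps wedge_diff)
    moreover have "(\<Sum>a\<in>UNIV. ?f a) = fscale sc (of_nat (Suc m)) (iota c ?v)"
      using euler[OF v] by (simp add: iota_sum[symmetric] iota_fscale del: of_nat_Suc)
    ultimately have "fscale sc (of_nat m) (iota c ?v) \<in> G"
      by (simp add: F.scale_left_distrib)
    from F.subspace_scale[OF G this, of "1 / of_nat m"] show ?thesis
      using m(1) by simp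
  qed
  \<comment> \<open>Sum over c: \<open>\<Sum>\<^sub>c \<iota>\<^sub>c e\<^sub>c\<close> is \<open>n - m\<close> on forms of degree m, and \<open>c = b\<close> contributes 1.\<close>
  have iotaG: "iota b y \<in> G" if y: "y \<in> N" for b y
  proof -
    let ?w = "iota b y"
    let ?f = "\<lambda>c. iota c (eps c ?w)"
    have "(\<Sum>c\<in>UNIV - {b}. ?f c) \<in> G"
      using y by (intro F.subspace_sum G number) auto
    moreover have "(\<Sum>c\<in>UNIV. ?f c) = ?f b + (\<Sum>c\<in>UNIV - {b}. ?f c)"
      by (simp add: sum.remove[of UNIV b])
    moreover have "?f b = ?w" by (simp add: iota_eps iota_iota[OF form[OF y]])
    moreover have "(\<Sum>c\<in>UNIV. ?f c) = fscale sc (of_nat CARD('n)) ?w - fscale sc (of_nat m) ?w"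
      using euler[OF iota_forms[OF form[OF y]], of b]
      by (simp add: iota_eps sum_subtractf F.sum_constant_scale)
    ultimately have "fscale sc (of_nat CARD('n) - of_nat m - 1) ?w \<in> G"
      by (simp add: F.scale_left_diff_distrib)
    moreover have "of_nat CARD('n) - of_nat m - (1 :: complex) \<noteq> 0"
    proof -
      have "CARD('n) \<noteq> Suc m" using m(2) by simp
      then have "(of_nat CARD('n) :: complex) \<noteq> of_nat (Suc m)" by (simp only: of_nat_eq_iff not_False_eq_True)
      then show ?thesis by (auto simp: diff_eq_eq)
    qed
    ultimately show ?thesis
      using F.subspace_scale[OF G, of _ "1 / (of_nat CARD('n) - of_nat m - 1)"] by fastforce
  qed
  have iota_dG: "iota a (d z) \<in> G" and iota_epsG: "iota a (eps i z) \<in> G" if "z \<in> G" for a i z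
    using compose[of "iota a" z i] that by (simp_all add: iotaG iota_xx iota_add)
  have eps_iotaG: "eps i (iota a z) \<in> G" if "z \<in> G" for a i z
  proof -
    have "(if a = i then z else 0) - iota a (eps i z) \<in> G"
      using that iota_epsG[OF that] by (intro F.subspace_diff G) (simp_all add: F.subspace_0[OF G])
    then show ?thesis by (simp add: iota_eps)
  qed
  \<comment> \<open>Since d squares to zero, d may be moved onto the factor \<open>x\<^sup>t\<close>, where it becomes \<open>t \<and> _\<close>.\<close>
  have d_iotaG: "d (iota a z) \<in> G" if z: "z \<in> G" for a z
    unfolding G_def
  proof (intro CollectI allI)
    fix t
    have "wedge sc (cvec t) (iota a z) \<in> G"
      unfolding wedge_expand[of "cvec t"] by (intro F.subspace_sum F.subspace_scale G eps_iotaG z)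
    then have "- d (xx t (wedge sc (cvec t) (iota a z))) \<in> N"
      by (intro F.subspace_neg N(1) dG)
    moreover have "d (d (xx t (iota a z))) = 0" by (rule d_d)
    then have "d (xx t (d (iota a z))) + d (xx t (wedge sc (cvec t) (iota a z))) = 0"
      by (simp add: d_xx[of t "iota a z"] xx_add d_add)
    then have "d (xx t (d (iota a z))) = - d (xx t (wedge sc (cvec t) (iota a z)))"
      by (rule eq_neg_iff_add_eq_0[THEN iffD2])
    ultimately show "d (xx t (d (iota a z))) \<in> N" by simp
  qed
  have pdG: "pd a z \<in> G" if z: "z \<in> G" for a z
  proof -
    have "iota a (d z) + d (iota a z) \<in> G"
      by (intro F.subspace_add G iota_dG d_iotaG z)
    then show ?thesis by (simp add: iota_d)
  qed
  \<comment> \<open>The coefficients that G admits in every basis direction form a submodule of P. The normal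
    ordered products put the coefficient of \<open>y0\<close> at any list into it.\<close>
  define Q where "Q = {p. \<forall>T. length T = m \<longrightarrow> basis_form T p \<in> G}"
  have Q: "subspace Q"
  proof -
    have "basis_form T 0 = 0" for T :: "'n list"
      using basis_form_scale[of T 0 0] by simp
    then show ?thesis
      using G by (simp add: Q_def subspace_def F.subspace_def basis_form_add basis_form_scale)
  qed
  obtain l where l: "y0 l \<noteq> 0" using y0(2) by (auto simp: fun_eq_iff fun_apply)
  then have "length l = Suc m" using forms_length[OF form[OF y0(1)]] by blast
  then obtain b S where bS: "l = b # S" "length S = m" by (cases l) auto
  have "y0 l \<in> Q"
    unfolding Q_def
  proof (intro CollectI allI impI)
    fix T :: "'n list" assume "length T = m"
    then have "foldr eps T (iotas S (iota b y0)) \<in> G"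
      using bS by (intro normal_ordered_closed G eps_iotaG iotaG y0) simp_all
    moreover have "iotas S (iota b y0) = (\<lambda>k. if k = [] then y0 l else 0)"
      unfolding iotas_full[OF iota_forms[OF form[OF y0(1)]] bS(2), of b] unfolding iota_def bS(1) ..
    ultimately show "basis_form T (y0 l) \<in> G" by (simp add: basis_form_def)
  qed
  have "p \<in> Q" for p
  proof (rule simple_subspace_UNIV[OF simple Q _ _ \<open>y0 l \<in> Q\<close> l])
    show "X r q \<in> Q" if "q \<in> Q" for r q
      using that by (simp add: Q_def basis_form_X xxG)
    show "dd i q \<in> Q" if "q \<in> Q" for i q
      using that by (simp add: Q_def basis_form_dd pdG)
  qed
  then have "forms m \<subseteq> G"
    by (intro forms_subset_subspace G) (auto simp: Q_def)
  then have "d (xx 0 g) \<in> N" using g dG by blast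
  then show ?thesis by simp
qed

end

section \<open>The module of Laurent polynomials\<close>

lemma isomorphic_modules_sym:
  assumes iso: "isomorphic_modules L sc2 act2 M2 sc1 act1 M1"
    and closed: "\<And>x y. x \<in> M2 \<Longrightarrow> y \<in> M2 \<Longrightarrow> x + y \<in> M2" "\<And>c x. x \<in> M2 \<Longrightarrow> sc2 c x \<in> M2"
      "\<And>a x. a \<in> L \<Longrightarrow> x \<in> M2 \<Longrightarrow> act2 a x \<in> M2"
  shows "isomorphic_modules L sc1 act1 M1 sc2 act2 M2"
proof -
  obtain \<phi> where \<phi>: "bij_betw \<phi> M2 M1" "\<forall>x\<in>M2. \<forall>y\<in>M2. \<phi> (x + y) = \<phi> x + \<phi> y"
    "\<forall>c. \<forall>x\<in>M2. \<phi> (sc2 c x) = sc1 c (\<phi> x)" "\<forall>a\<in>L. \<forall>x\<in>M2. \<phi> (act2 a x) = act1 a (\<phi> x)"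
    using iso unfolding isomorphic_modules_def by blast
  let ?\<psi> = "inv_into M2 \<phi>"
  have \<psi>: "?\<psi> x \<in> M2" "\<phi> (?\<psi> x) = x" if "x \<in> M1" for x
    using \<phi>(1) that by (auto simp: bij_betw_def inv_into_into f_inv_into_f)
  have eq: "?\<psi> x = y" if "y \<in> M2" "\<phi> y = x" for x y
    using \<phi>(1) that by (auto simp: bij_betw_def)
  have "?\<psi> (x + y) = ?\<psi> x + ?\<psi> y" if "x \<in> M1" "y \<in> M1" for x y
    using that \<phi> \<psi> closed by (intro eq) simp_all
  moreover have "?\<psi> (sc1 c x) = sc2 c (?\<psi> x)" if "x \<in> M1" for c x
    using that \<phi> \<psi> closed by (intro eq) simp_all
  moreover have "?\<psi> (act1 a x) = act2 a (?\<psi> x)" if "a \<in> L" "x \<in> M1" for a x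
    using that \<phi> \<psi> closed by (intro eq) simp_all
  ultimately show ?thesis
    unfolding isomorphic_modules_def using bij_betw_inv_into[OF \<phi>(1)] by blast
qed

lemma lookup_D:
  "Poly_Mapping.lookup (D u r f) (r + s) = dual_pairing u s * Poly_Mapping.lookup f s"
  by (simp add: D_def lookup_sum dual_pairing_def sum_distrib_right mult.assoc)

text \<open>
  The constant coefficient of \<open>D u r f\<close> comes from the exponent \<open>- r\<close> of f, with factor
  \<open>- (u|r) = 0\<close>.
\<close>

lemma div_zero_lookup_0:
  assumes "\<delta> \<in> div_zero_algebra"
  shows "Poly_Mapping.lookup (\<delta> f) 0 = 0"
proof -
  have "Poly_Mapping.lookup (D (witt_coeff \<delta> r) r f) 0 = 0" for r
  proof -
    have "dual_pairing (witt_coeff \<delta> r) (- r) = - dual_pairing (witt_coeff \<delta> r) r"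
      by (simp add: dual_pairing_def sum_negf)
    then show ?thesis
      using lookup_D[of "witt_coeff \<delta> r" r f "- r"] dual_pairing_witt_coeff[OF assms] by simp
  qed
  moreover have "\<delta> \<in> witt_algebra" using assms div_zero_subset_witt by blast
  ultimately show ?thesis
    by (subst witt_expansion) (simp_all add: lookup_sum)
qed

lemma A_prime_iff: "f \<in> A_prime \<longleftrightarrow> Poly_Mapping.lookup f 0 = 0"
proof
  interpret L: vector_space "lscale :: complex \<Rightarrow> 'a laurent \<Rightarrow> 'a laurent"
    by (rule vector_space_lscale)
  have "L.subspace {f. Poly_Mapping.lookup f 0 = 0}"
    by (simp add: L.subspace_def lookup_add)
  then have "A_prime \<subseteq> {f :: 'a laurent. Poly_Mapping.lookup f 0 = 0}"
    unfolding A_prime_def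
    by (intro L.span_minimal) (auto simp: monomial_def lookup_single)
  then show "f \<in> A_prime \<Longrightarrow> Poly_Mapping.lookup f 0 = 0" by auto
  assume f: "Poly_Mapping.lookup f 0 = 0"
  have "f - Poly_Mapping.single 0 (Poly_Mapping.lookup f 0) \<in> A_prime"
  proof (induction f rule: laurent_induct)
    case (single r c)
    show ?case
    proof (cases "r = 0")
      case True
      then show ?thesis by (simp add: A_prime_def L.span_zero lookup_single)
    next
      case False
      have "Poly_Mapping.single r c = lscale c (monomial r)"
        by (intro poly_mapping_eqI) (simp add: monomial_def lookup_single when_def)
      moreover have "lscale c (monomial r) \<in> A_prime"
        unfolding A_prime_def using False by (intro L.span_scale L.span_base) blast
      moreover have "Poly_Mapping.lookup (Poly_Mapping.single r c) 0 = 0"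
        using False by (simp add: lookup_single)
      ultimately show ?thesis by (metis single_zero diff_zero)
    qed
  next
    case (add f g)
    have "f + g - Poly_Mapping.single 0 (Poly_Mapping.lookup (f + g) 0) =
        (f - Poly_Mapping.single 0 (Poly_Mapping.lookup f 0)) +
        (g - Poly_Mapping.single 0 (Poly_Mapping.lookup g 0))"
      by (simp add: lookup_add single_add algebra_simps)
    also have "\<dots> \<in> A_prime"
      using add unfolding A_prime_def by (rule L.span_add)
    finally show ?case .
  qed
  then show "f \<in> A_prime" using f by simp
qed

lemma partial_eq_0_iff:
  "(\<forall>i. partial i f = 0) \<longleftrightarrow> f = Poly_Mapping.single 0 (Poly_Mapping.lookup f 0)"
proof
  assume 0: "\<forall>i. partial i f = 0"
  show "f = Poly_Mapping.single 0 (Poly_Mapping.lookup f 0)"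
  proof (intro poly_mapping_eqI)
    fix r
    show "Poly_Mapping.lookup f r = Poly_Mapping.lookup (Poly_Mapping.single 0 (Poly_Mapping.lookup f 0)) r"
    proof (cases "r = 0")
      case False
      then obtain i where "r $ i \<noteq> 0" by (auto simp: vec_eq_iff)
      moreover have "of_int (r $ i) * Poly_Mapping.lookup f r = 0"
        using 0 by (metis lookup_partial lookup_zero)
      ultimately show ?thesis using False by (simp add: lookup_single)
    qed simp
  qed
next
  assume f: "f = Poly_Mapping.single 0 (Poly_Mapping.lookup f 0)"
  have "partial i (Poly_Mapping.single 0 c) = 0" for i c
    by (simp add: partial_single)
  then show "\<forall>i. partial i f = 0" using f by metis
qed

context weyl_module
begin

lemma isomorphic_to_A_obtain:
  assumes "isomorphic_to_A sc \<rho>"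
  obtains \<psi> where "bij \<psi>" "\<And>z w. \<psi> (z + w) = \<psi> z + \<psi> w" "\<And>c z. \<psi> (sc c z) = lscale c (\<psi> z)"
    "\<And>a z. a \<in> weyl_algebra \<Longrightarrow> \<psi> (\<rho> a z) = a (\<psi> z)"
  using assms unfolding isomorphic_to_A_def isomorphic_modules_def by auto

text \<open>
  The constants of the Laurent polynomials are killed by all \<open>\<partial>\<^sub>i\<close>. Conversely, if z is killed,
  then \<open>f \<mapsto> f z\<close> is a homomorphism from the Laurent polynomials; it is onto because P is
  simple.
\<close>

lemma isomorphic_to_A_iff_killed:
  assumes simple: "simple_module sc weyl_algebra \<rho> UNIV"
  shows "isomorphic_to_A sc \<rho> \<longleftrightarrow> (\<exists>z. z \<noteq> 0 \<and> (\<forall>i. dd i z = 0))"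
proof
  assume "isomorphic_to_A sc \<rho>"
  then obtain \<psi> where \<psi>: "bij \<psi>" "\<And>z w. \<psi> (z + w) = \<psi> z + \<psi> w"
    "\<And>a z. a \<in> weyl_algebra \<Longrightarrow> \<psi> (\<rho> a z) = a (\<psi> z)"
    by (rule isomorphic_to_A_obtain) blast
  have 0: "\<psi> 0 = 0" using \<psi>(2)[of 0 0] by simp
  have inj: "z = 0" if "\<psi> z = 0" for z
    using that 0 bij_is_inj[OF \<psi>(1)] by (metis injD)
  obtain z where z: "\<psi> z = 1" using bij_is_surj[OF \<psi>(1)] by (metis surjD)
  have "\<psi> (dd i z) = 0" for i
    by (simp add: dd_def \<psi>(3) weyl_algebra.partial z partial_single[of i 0 1, simplified])
  moreover have "z \<noteq> 0" using z 0 by auto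
  ultimately show "\<exists>z. z \<noteq> 0 \<and> (\<forall>i. dd i z = 0)" using inj by blast
next
  assume "\<exists>z. z \<noteq> 0 \<and> (\<forall>i. dd i z = 0)"
  then obtain z where z: "z \<noteq> 0" "\<And>i. dd i z = 0" by blast
  define \<theta> where "\<theta> f = \<rho> (\<lambda>g. f * g) z" for f
  have add: "\<theta> (f + g) = \<theta> f + \<theta> g" for f g
    by (simp add: \<theta>_def distrib_right rho_add weyl_algebra.mult)
  have scale: "\<theta> (lscale c f) = sc c (\<theta> f)" for c f
    by (simp add: \<theta>_def lscale_mult_left rho_scale weyl_algebra.mult)
  have act: "\<theta> (a f) = \<rho> a (\<theta> f)" if "a \<in> weyl_algebra" for a f
    using that
  proof (induction a arbitrary: f rule: weyl_algebra.induct)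
    case (mult g)
    show ?case
      using rho_comp[OF weyl_algebra.mult weyl_algebra.mult, of g f z]
      by (simp add: \<theta>_def comp_def mult.assoc)
  next
    case (partial i)
    have w: "partial i \<circ> (\<lambda>h. f * h) \<in> weyl_algebra" "(\<lambda>h. f * h) \<circ> partial i \<in> weyl_algebra"
      "(\<lambda>h. partial i f * h) \<in> weyl_algebra"
      by (intro weyl_algebra.intros)+
    have "partial i \<circ> (\<lambda>h. f * h) = (\<lambda>h. (\<lambda>h. partial i f * h) h + ((\<lambda>h. f * h) \<circ> partial i) h)"
      by (simp add: fun_eq_iff partial_mult)
    then have "\<rho> (partial i \<circ> (\<lambda>h. f * h)) z = \<theta> (partial i f) + \<rho> ((\<lambda>h. f * h) \<circ> partial i) z"
      using rho_add[OF w(3,2)] by (simp only: \<theta>_def)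
    then show ?case
      using z(2)[of i]
      by (simp add: \<theta>_def rho_comp weyl_algebra.intros dd_def rho_zero)
  qed (simp_all add: add rho_add rho_comp)
  have zero: "\<theta> 0 = 0" using add[of 0 0] by simp
  have single: "\<theta> (Poly_Mapping.single r c) = sc c (X r z)" for r c
  proof -
    have "Poly_Mapping.single r c = lscale c (monomial r)"
      by (intro poly_mapping_eqI) (simp add: monomial_def lookup_single when_def)
    then show ?thesis using scale[of c "monomial r"] by (simp add: \<theta>_def X_def)
  qed
  \<comment> \<open>The kernel is stable under \<open>\<partial>\<^sub>i - r\<^sub>i\<close>, which removes the monomial \<open>x\<^sup>r\<close>. A nonzero element with
    the fewest monomials would be a multiple of one monomial, which is invertible.\<close>
  have inj: "f = 0" if "\<theta> f = 0" for f
    using that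
  proof (induction "card (Poly_Mapping.keys f)" arbitrary: f rule: less_induct)
    case less
    show ?case
    proof (rule ccontr)
      assume "f \<noteq> 0"
      then obtain s where s: "s \<in> Poly_Mapping.keys f" by (metis keys_eq_empty equals0I)
      show False
      proof (cases "Poly_Mapping.keys f = {s}")
        case True
        then have f: "f = Poly_Mapping.single s (Poly_Mapping.lookup f s)"
          by (intro poly_mapping_eqI) (auto simp: lookup_single when_def in_keys_iff)
        have "sc (Poly_Mapping.lookup f s) (X s z) = 0"
          using less.prems single[of s "Poly_Mapping.lookup f s"] f by simp
        moreover have "Poly_Mapping.lookup f s \<noteq> 0" using s by (simp add: in_keys_iff)
        ultimately have "X s z = 0" by simp
        then have "X (- s) (X s z) = 0" by simp
        then show False using z(1) by (simp add: X_X)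
      next
        case False
        then obtain r where r: "r \<in> Poly_Mapping.keys f" "r \<noteq> s" using s by auto
        then obtain i where i: "r $ i \<noteq> s $ i" by (auto simp: vec_eq_iff)
        let ?g = "partial i f + lscale (- of_int (r $ i)) f"
        have g: "Poly_Mapping.lookup ?g t = of_int (t $ i - r $ i) * Poly_Mapping.lookup f t" for t
          by (simp add: lookup_add algebra_simps)
        have "Poly_Mapping.keys ?g \<subseteq> Poly_Mapping.keys f - {r}"
          using g by (auto simp: in_keys_iff)
        then have "card (Poly_Mapping.keys ?g) \<le> card (Poly_Mapping.keys f - {r})"
          by (intro card_mono) simp_all
        also have "\<dots> < card (Poly_Mapping.keys f)"
          using r(1) by (intro card_Diff1_less) simp_all
        finally have "card (Poly_Mapping.keys ?g) < card (Poly_Mapping.keys f)" .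
        moreover have "\<theta> ?g = 0"
          using less.prems act[OF weyl_algebra.partial, of i f]
          by (simp add: add scale rho_zero weyl_algebra.partial)
        ultimately have "?g = 0" by (rule less.hyps)
        then have "of_int (s $ i - r $ i) * Poly_Mapping.lookup f s = 0"
          using g[of s] by simp
        then show False using s i by (simp add: in_keys_iff)
      qed
    qed
  qed
  have "inj \<theta>"
  proof (rule injI)
    fix f g assume eq: "\<theta> f = \<theta> g"
    have "\<theta> (f + lscale (-1) g) = 0" using eq by (simp add: add scale)
    then have "f + lscale (-1) g = 0" by (rule inj)
    moreover have "lscale (-1) g = - g" by (intro poly_mapping_eqI) simp
    ultimately show "f = g" by simp
  qed
  moreover have "w \<in> range \<theta>" for w
  proof (rule simple_subspace_UNIV[OF simple])
    have "\<exists>h. \<theta> f + \<theta> g = \<theta> h" "\<exists>h. sc c (\<theta> f) = \<theta> h" for c f g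
      by (metis add) (metis scale)
    then show "subspace (range \<theta>)"
      unfolding subspace_def using zero by (auto simp: image_iff)
    show "X r w \<in> range \<theta>" if "w \<in> range \<theta>" for r w
      using that act[OF weyl_algebra.mult[of "monomial r"]] by (auto simp: X_def) (metis rangeI)
    show "dd i w \<in> range \<theta>" if "w \<in> range \<theta>" for i w
      using that act[OF weyl_algebra.partial[of i]] by (auto simp: dd_def) (metis rangeI)
    show "z \<in> range \<theta>"
      using single[of 0 1] by (metis X_0 rangeI scale_one)
  qed (rule z(1))
  ultimately have "bij \<theta>" by (auto intro: bijI)
  then have "isomorphic_modules weyl_algebra lscale (\<lambda>a f. a f) UNIV sc \<rho> UNIV"
    unfolding isomorphic_modules_def using add scale act by blast
  then show "isomorphic_to_A sc \<rho>"
    unfolding isomorphic_to_A_def by (rule isomorphic_modules_sym) simp_all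
qed

subsection \<open>The image of the Cartan subalgebra\<close>

lemma cartan_image_P: "w \<in> cartan_image \<rho> UNIV \<longleftrightarrow> (\<exists>m. w = (\<Sum>i\<in>UNIV. dd i (m i)))"
  by (simp add: cartan_image_def dd_def)

lemma subspace_cartan_image: "subspace (cartan_image \<rho> UNIV)"
  unfolding subspace_def
proof (intro conjI ballI allI)
  show "0 \<in> cartan_image \<rho> UNIV"
    unfolding cartan_image_P by (rule exI[of _ "\<lambda>_. 0"]) simp
next
  fix x y assume "x \<in> cartan_image \<rho> UNIV" "y \<in> cartan_image \<rho> UNIV"
  then obtain m m' where "x = (\<Sum>i\<in>UNIV. dd i (m i))" "y = (\<Sum>i\<in>UNIV. dd i (m' i))"
    unfolding cartan_image_P by blast
  then show "x + y \<in> cartan_image \<rho> UNIV"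
    unfolding cartan_image_P
    by (intro exI[of _ "\<lambda>i. m i + m' i"]) (simp add: dd_add sum.distrib)
next
  fix c x assume "x \<in> cartan_image \<rho> UNIV"
  then obtain m where "x = (\<Sum>i\<in>UNIV. dd i (m i))"
    unfolding cartan_image_P by blast
  then show "sc c x \<in> cartan_image \<rho> UNIV"
    unfolding cartan_image_P
    by (intro exI[of _ "\<lambda>i. sc c (m i)"]) (simp add: dd_scale scale_sum_right)
qed

lemma dd_in_cartan_image: "dd i w \<in> cartan_image \<rho> UNIV"
proof -
  have "dd i w = (\<Sum>j\<in>UNIV. dd j (if j = i then w else 0))"
    by (subst sum.cong[OF refl, of _ _ "\<lambda>j. if j = i then dd i w else 0"]) auto
  then show ?thesis unfolding cartan_image_P by (rule exI[of _ "\<lambda>j. if j = i then w else 0"])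
qed

lemma cartan_image_least:
  assumes "subspace N" "\<And>i w. dd i w \<in> N"
  shows "cartan_image \<rho> UNIV \<subseteq> N"
  using assms by (auto simp: cartan_image_P intro!: subspace_sum)

text \<open>
  A nonzero killed vector forces P to be the Laurent polynomials, where the killed vectors are
  the constants and no \<open>\<partial>\<^sub>i f\<close> has a constant term.
\<close>

lemma cartan_image_inter_killed:
  assumes simple: "simple_module sc weyl_algebra \<rho> UNIV"
    and z: "z \<in> cartan_image \<rho> UNIV" "\<And>i. dd i z = 0"
  shows "z = 0"
proof (rule ccontr)
  assume "z \<noteq> 0"
  then have "isomorphic_to_A sc \<rho>" using isomorphic_to_A_iff_killed[OF simple] z(2) by blast
  then obtain \<psi> where \<psi>: "bij \<psi>" "\<And>z w. \<psi> (z + w) = \<psi> z + \<psi> w"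
    "\<And>a z. a \<in> weyl_algebra \<Longrightarrow> \<psi> (\<rho> a z) = a (\<psi> z)"
    by (rule isomorphic_to_A_obtain) blast
  have 0: "\<psi> 0 = 0" using \<psi>(2)[of 0 0] by simp
  have sum: "\<psi> (\<Sum>i\<in>I. f i) = (\<Sum>i\<in>I. \<psi> (f i))" for f and I :: "'n set"
    by (induction I rule: infinite_finite_induct) (simp_all add: 0 \<psi>(2))
  have dd: "\<psi> (dd i w) = partial i (\<psi> w)" for i w
    by (simp add: dd_def \<psi>(3) weyl_algebra.partial)
  obtain m where "z = (\<Sum>i\<in>UNIV. dd i (m i))" using z(1) by (auto simp: cartan_image_P)
  then have "Poly_Mapping.lookup (\<psi> z) 0 = 0" by (simp add: sum dd lookup_sum)
  moreover have "partial i (\<psi> z) = 0" for i using dd[of i z] z(2) 0 by simp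
  then have "\<psi> z = Poly_Mapping.single 0 (Poly_Mapping.lookup (\<psi> z) 0)"
    using partial_eq_0_iff by blast
  ultimately have "\<psi> z = \<psi> 0" using 0 by simp
  then show False using \<open>z \<noteq> 0\<close> bij_is_inj[OF \<psi>(1)] by (auto dest: injD)
qed

text \<open>
  If \<open>\<partial>\<^sub>i\<^sup>2\<close> were zero, then so would be \<open>(\<partial>\<^sub>i + 1)\<^sup>2 + (\<partial>\<^sub>i - 1)\<^sup>2 = 2 \<partial>\<^sub>i\<^sup>2 + 2\<close>.
\<close>

lemma dd_dd_nonzero:
  assumes "(z :: 'p) \<noteq> 0"
  obtains w where "dd i (dd i w) \<noteq> 0"
proof (rule ccontr)
  assume "\<not> thesis"
  then have 0: "dd i (dd i w) = 0" for w using that by blast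
  let ?e = "axis i 1"
  have "X (- ?e) (dd i (dd i (X ?e z))) + X ?e (dd i (dd i (X (- ?e) z))) = sc 2 z"
    using scale_left_distrib[of 1 1 z] 0[of z]
    by (simp add: dd_X dd_add dd_diff dd_scale X_add X_diff X_minus X_scale X_X axis_nth)
  then show False using assms 0 by simp
qed

text \<open>
  For the Laurent polynomials, \<open>\<hh>P\<close> and the killed vectors span P. The vectors w all of whose
  multiples \<open>x\<^sup>r w\<close> lie in the sum S of these two spaces form a submodule, as
  \<open>x\<^sup>r \<partial>\<^sub>i w = \<partial>\<^sub>i (x\<^sup>r w) - r\<^sub>i x\<^sup>r w\<close>. It contains every killed vector z, as \<open>r\<^sub>i x\<^sup>r z = \<partial>\<^sub>i (x\<^sup>r z)\<close>.
\<close>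

lemma cartan_image_plus_killed:
  assumes simple: "simple_module sc weyl_algebra \<rho> UNIV" and "isomorphic_to_A sc \<rho>"
  obtains q where "q \<in> cartan_image \<rho> UNIV" "\<And>i. dd i (p - q) = 0"
proof -
  obtain z where z: "z \<noteq> 0" "\<And>i. dd i z = 0"
    using assms isomorphic_to_A_iff_killed by blast
  let ?K = "{z. \<forall>i. dd i z = 0}"
  let ?S = "{q + k | q k. q \<in> cartan_image \<rho> UNIV \<and> k \<in> ?K}"
  have K: "subspace ?K" by (simp add: subspace_def dd_add dd_scale)
  have S: "subspace ?S" by (rule subspace_sums[OF subspace_cartan_image K])
  let ?M = "{w. \<forall>r. X r w \<in> ?S}"
  have hS: "w \<in> ?S" if "w \<in> cartan_image \<rho> UNIV" for w
  proof -
    have "w + 0 \<in> ?S" using that subspace_0[OF K] by blast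
    then show ?thesis by simp
  qed
  have "p \<in> ?M"
  proof (rule simple_subspace_UNIV[OF simple])
    show "subspace ?M"
      using S by (auto simp: subspace_def X_add X_scale)
    show "X r w \<in> ?M" if "w \<in> ?M" for r w
      using that by (simp add: X_X)
    show "dd i w \<in> ?M" if w: "w \<in> ?M" for i w
    proof (rule CollectI, rule allI)
      fix r
      have "dd i (X r w) - sc (of_int (r $ i)) (X r w) \<in> ?S"
        using w
        by (intro subspace_diff[OF S hS[OF dd_in_cartan_image] subspace_scale[OF S]]) blast
      then show "X r (dd i w) \<in> ?S" by (simp only: dd_X add_diff_cancel_right')
    qed
    show "z \<in> ?M"
    proof (rule CollectI, rule allI)
      fix r
      show "X r z \<in> ?S"
      proof (cases "r = 0")
        case True
        have "0 + z \<in> ?S" using z(2) subspace_0[OF subspace_cartan_image] by blast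
        then show ?thesis using True by simp
      next
        case False
        then obtain i where i: "r $ i \<noteq> 0" by (auto simp: vec_eq_iff)
        have "sc (1 / of_int (r $ i)) (dd i (X r z)) \<in> ?S"
          by (intro subspace_scale[OF S] hS dd_in_cartan_image)
        then show ?thesis using i by (simp add: dd_X z(2))
      qed
    qed
  qed (rule z(1))
  then have "X 0 p \<in> ?S" by blast
  then obtain q k where "p = q + k" "q \<in> cartan_image \<rho> UNIV" "k \<in> ?K" by auto
  then show ?thesis using that[of q] by simp
qed

end

section \<open>Least nonzero submodules\<close>

lemma unique_simple_submoduleI:
  assumes S: "submodule sc L act S M" "S \<noteq> {0}"
    and least: "\<And>N. submodule sc L act N M \<Longrightarrow> N \<noteq> {0} \<Longrightarrow> S \<subseteq> N"
  shows "unique_simple_submodule sc L act S M"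
  unfolding unique_simple_submodule_def
proof (intro allI iffI)
  fix N
  assume N: "submodule sc L act N M \<and> simple_module sc L act N"
  then have "S \<subseteq> N" using least by (auto simp: simple_module_def)
  then have "submodule sc L act S N" using S by (simp add: submodule_def)
  then show "N = S" using N S(2) by (auto simp: simple_module_def)
next
  fix N assume N: "N = S"
  have "simple_module sc L act S"
    unfolding simple_module_def
  proof (intro conjI allI impI)
    show "submodule sc L act S S" using S(1) by (simp add: submodule_def)
    fix N assume N: "submodule sc L act N S"
    then have "submodule sc L act N M" using S(1) by (auto simp: submodule_def)
    then show "N = {0} \<or> N = S" using least[of N] N by (auto simp: submodule_def)
  qed (rule S(2))
  then show "submodule sc L act N M \<and> simple_module sc L act N" using N S(1) by simp
qed

text \<open>
  Once a least nonzero submodule is known, simplicity of the module is an equality of sets.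
\<close>

lemma simple_module_iff_least:
  assumes S: "submodule sc L act S M" "S \<noteq> {0}" and M: "submodule sc L act M M"
    and least: "\<And>N. submodule sc L act N M \<Longrightarrow> N \<noteq> {0} \<Longrightarrow> S \<subseteq> N"
  shows "simple_module sc L act M \<longleftrightarrow> S = M"
proof
  show "simple_module sc L act M \<Longrightarrow> S = M" using S by (auto simp: simple_module_def)
  assume "S = M"
  then show "simple_module sc L act M"
    unfolding simple_module_def using S(2) M least by (auto simp: submodule_def)
qed

section \<open>Degrees of nonzero forms\<close>

context form_space
begin

lemma eps_iota_zero:
  assumes "g \<in> forms (Suc k)" "\<And>i. eps i (iota i g) = 0"
  shows "g = 0"
proof -
  have "fscale sc (of_nat (Suc k)) g = 0" using euler[OF assms(1)] assms(2) by simp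
  then show ?thesis by (simp add: F.scale_eq_0_iff del: of_nat_Suc)
qed

text \<open>
  A form whose contractions vanish outside a set A of fewer elements than its degree is
  zero: contracting with one element of A lowers the degree and removes the element from A.
\<close>

lemma forms_above:
  fixes g :: "'n::finite list \<Rightarrow> 'p"
  assumes "g \<in> forms k" "k > CARD('n)"
  shows "g = 0"
proof -
  have "g = 0" if "finite A" "g \<in> forms k" "k > card A" "\<And>a. a \<notin> A \<Longrightarrow> iota a g = 0"
    for A :: "'n set" and g :: "'n list \<Rightarrow> 'p" and k
    using that
  proof (induction A arbitrary: g k rule: finite_induct)
    case empty
    then obtain m where "k = Suc m" by (cases k) auto
    then show ?case using empty eps_iota_zero[of g m] by simp
  next
    case (insert b A)
    obtain m where k: "k = Suc m" using insert.prems(2) by (cases k) auto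
    have "iota b g = 0"
    proof (rule insert.IH)
      show "iota b g \<in> forms m" using insert.prems(1) k by (simp add: iota_forms)
      show "card A < m" using insert.prems(2) insert.hyps k by simp
      show "iota a (iota b g) = 0" if "a \<notin> A" for a
      proof (cases "a = b")
        case False
        then have "iota b (iota a g) = 0" using insert.prems(3)[of a] that by simp
        then show ?thesis using iota_anticommute[OF insert.prems(1), of a b] by simp
      qed (simp add: iota_iota[OF insert.prems(1)])
    qed
    then have zero: "iota a g = 0" if "a \<notin> A" for a
      using insert.prems(3)[of a] that by (cases "a = b") auto
    have "card A < k" using insert.prems(2) insert.hyps by simp
    then show ?case by (rule insert.IH[OF insert.prems(1) _ zero])
  qed
  from this[of UNIV g k] assms show ?thesis by simp
qed

text \<open>
  If all \<open>e\<^sub>i \<and> g\<close> vanish, then \<open>e\<^sub>i \<iota>\<^sub>i g = g\<close> for all i, and Euler's formula gives \<open>n g = m g\<close>.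
\<close>

lemma eps_zero:
  fixes g :: "'n::finite list \<Rightarrow> 'p"
  assumes g: "g \<in> forms m" and m: "m < CARD('n)" and zero: "\<And>i. eps i g = 0"
  shows "g = 0"
proof -
  have "eps i (iota i g) = g" for i
    using iota_eps[of i i g] zero by simp
  then have "fscale sc (of_nat CARD('n)) g = fscale sc (of_nat m) g"
    using euler[OF g] by (simp add: F.sum_constant_scale)
  then show ?thesis using m by (simp add: F.scale_cancel_right)
qed

lemma forms_nontrivial:
  assumes "(p :: 'p) \<noteq> 0" "m \<le> CARD('n::finite)"
  shows "\<exists>g \<in> forms m. (g :: 'n list \<Rightarrow> 'p) \<noteq> 0"
  using assms(2)
proof (induction m)
  case 0
  have "basis_form [] p \<noteq> (0 :: 'n list \<Rightarrow> 'p)"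
  proof
    assume "basis_form [] p = (0 :: 'n list \<Rightarrow> 'p)"
    from fun_cong[OF this, of "[]"] show False
      using assms(1) by (simp add: basis_form_Nil fun_apply)
  qed
  moreover have "basis_form [] p \<in> (forms 0 :: ('n list \<Rightarrow> 'p) set)"
    using basis_form_forms[of "[]" p] by simp
  ultimately show ?case by blast
next
  case (Suc m)
  then obtain g :: "'n list \<Rightarrow> 'p" where "g \<in> forms m" "g \<noteq> 0" by auto
  then obtain i where "eps i g \<noteq> 0" using eps_zero[of g m] Suc.prems by auto
  then show ?case using wedge_forms[OF \<open>g \<in> forms m\<close>] by blast
qed

lemma foldr_eps_iotas:
  assumes "g \<in> forms k" "distinct T" "\<And>t. t \<in> set T \<Longrightarrow> eps t (iota t g) = g"
  shows "foldr eps T (iotas T g) = g"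
  using assms
proof (induction T arbitrary: g k)
  case (Cons t T)
  have "eps s (iota s (iota t g)) = iota t g" if s: "s \<in> set T" for s
  proof -
    have "eps s (iota s (iota t g)) = - eps s (iota t (iota s g))"
      by (simp add: iota_anticommute[OF Cons.prems(1), of s t] wedge_minus)
    also have "\<dots> = iota t (eps s (iota s g))"
      using s Cons.prems(2) by (auto simp: iota_eps)
    also have "\<dots> = iota t g" using Cons.prems(3)[of s] s by simp
    finally show ?thesis .
  qed
  then have "foldr eps T (iotas T (iota t g)) = iota t g"
    using Cons.prems(2) by (intro Cons.IH[OF iota_forms_pred[OF Cons.prems(1)]]) auto
  then show ?case using Cons.prems(3)[of t] by (simp add: iotas_Cons)
qed simp

text \<open>
  A top form is killed by every \<open>e\<^sub>t\<close>, so that \<open>e\<^sub>t \<iota>\<^sub>t\<close> is the identity on it; successively, the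
  form is contracted completely and rebuilt.
\<close>

lemma top_form_eq:
  fixes y :: "'n::finite list \<Rightarrow> 'p"
  assumes y: "y \<in> forms CARD('n)" and T: "distinct T" "set T = UNIV"
  shows "y = basis_form T (y T)"
proof -
  have "eps t (iota t y) = y" for t
  proof -
    have "eps t y = 0" by (rule forms_above[OF wedge_forms[OF y]]) simp
    then show ?thesis using iota_eps[of t t y] by simp
  qed
  then have "foldr eps T (iotas T y) = y" by (intro foldr_eps_iotas[OF y T(1)])
  moreover have "length T = CARD('n)" using T distinct_card by metis
  ultimately show ?thesis using iotas_full[OF y, of T] by (simp add: basis_form_def)
qed

end

section \<open>Functions, exact one-forms and top forms\<close>

lemma witt_in_weyl:
  assumes "\<delta> \<in> witt_algebra"
  shows "\<delta> \<in> weyl_algebra"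
proof -
  have "\<delta> = (\<lambda>f. \<Sum>r\<in>witt_support \<delta>. D (witt_coeff \<delta> r) r f)"
    using witt_expansion[OF assms] by blast
  also have "\<dots> \<in> weyl_algebra"
    by (intro weyl_algebra_sum finite_witt_support D_in_weyl_algebra)
  finally show ?thesis .
qed

context weyl_module
begin

lemma forms_0: "forms 0 = (range (basis_form []) :: ('n list \<Rightarrow> 'p) set)"
proof
  show "forms 0 \<subseteq> (range (basis_form []) :: ('n list \<Rightarrow> 'p) set)"
  proof
    fix g :: "'n list \<Rightarrow> 'p"
    assume "g \<in> forms 0"
    then have "g = basis_form [] (g [])"
      unfolding basis_form_Nil by (intro ext) (simp add: forms_length)
    then show "g \<in> range (basis_form [])" by (rule range_eqI)
  qed
  show "range (basis_form []) \<subseteq> (forms 0 :: ('n list \<Rightarrow> 'p) set)"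
    using basis_form_forms[of "[]"] by auto
qed

lemma vac_forms: "basis_form [] p \<in> forms 0"
  using basis_form_forms[of "[]"] by simp

lemma vac_eq_iff: "basis_form [] p = (basis_form [] q :: 'n list \<Rightarrow> 'p) \<longleftrightarrow> p = q"
  by (auto simp: basis_form_Nil fun_eq_iff)

lemma basis_form_partial_along:
  "basis_form T (partial_along u p) = (\<Sum>b\<in>UNIV. fscale sc (u $ b) (pd b (basis_form T p)))"
  by (simp add: partial_along_def basis_form_sum basis_form_scale basis_form_dd)

lemma F_D_vac: "F_D sc \<rho> u r (basis_form [] p) = basis_form [] (X r (partial_along u p))"
proof -
  have z: "iotav u (basis_form [] p) = 0"
    by (simp add: iotav_def iota_forms_0[OF vac_forms])
  then show ?thesis
    by (simp add: F_D_cartan[OF vac_forms] iotav_d basis_form_X basis_form_partial_along)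
qed

lemma F_act_vac:
  assumes "\<delta> \<in> witt_algebra"
  shows "F_act sc \<rho> \<delta> (basis_form [] p) = basis_form [] (\<rho> \<delta> p)"
proof -
  let ?s = "\<lambda>f. \<Sum>r\<in>witt_support \<delta>. D (witt_coeff \<delta> r) r f"
  have eq: "?s = \<delta>" using witt_expansion[OF assms] by (intro ext) simp
  have "\<rho> ?s p = (\<Sum>r\<in>witt_support \<delta>. \<rho> (D (witt_coeff \<delta> r) r) p)"
    by (intro rho_sum finite_witt_support D_in_weyl_algebra)
  then have "\<rho> \<delta> p = (\<Sum>r\<in>witt_support \<delta>. \<rho> (D (witt_coeff \<delta> r) r) p)"
    unfolding eq .
  then show ?thesis
    by (simp add: F_act_def F_D_vac basis_form_sum rho_D partial_along_def)
qed

lemma F_D_forms: "g \<in> forms k \<Longrightarrow> F_D sc \<rho> u r g \<in> forms k"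
  using F_mod_submodule[of k] D_in_witt_algebra[of u r]
  by (metis F_act_D F_mod_eq_forms submodule_def)

lemma F_act_d: "g \<in> forms k \<Longrightarrow> F_act sc \<rho> \<delta> (d g) = d (F_act sc \<rho> \<delta> g)"
  by (simp add: F_act_def d_sum F_D_d)

lemma d_vac_zero_iff: "d (basis_form [] p) = 0 \<longleftrightarrow> (\<forall>i. dd i p = 0)"
proof
  assume 0: "d (basis_form [] p) = 0"
  have "basis_form [] (dd i p) = (0 :: 'n list \<Rightarrow> 'p)" for i
    using iota_d[of i "basis_form [] p"] 0
    by (simp add: basis_form_dd iota_forms_0[OF vac_forms])
  then show "\<forall>i. dd i p = 0"
    by (metis (mono_tags, lifting) basis_form_Nil zero_fun_apply)
next
  assume "\<forall>i. dd i p = 0"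
  then show "d (basis_form [] p) = 0"
    by (simp add: d_def basis_form_dd[symmetric])
qed

lemma functions_contain_cartan_image:
  assumes n: "CARD('n) \<ge> 2" and simple: "simple_module sc weyl_algebra \<rho> UNIV"
    and N: "submodule (fscale sc) div_zero_algebra (F_act sc \<rho>) N M"
    and p: "basis_form [] p \<in> N" "dd j p \<noteq> 0"
  shows "basis_form [] ` cartan_image \<rho> UNIV \<subseteq> N"
proof -
  have N': "F.subspace N" "\<And>u r g. dual_pairing u r = 0 \<Longrightarrow> g \<in> N \<Longrightarrow> F_D sc \<rho> u r g \<in> N"
    using N by (auto simp: div_zero_submodule_iff)
  let ?N = "{q. basis_form [] q \<in> N}"
  have sub: "subspace ?N"
    using N'(1)
    by (simp add: subspace_def F.subspace_def basis_form_add basis_form_scale)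
  have "dd i w \<in> ?N" for i w
    using p N'(2) by (intro div_zero_stable_contains_image[OF n simple sub, of p])
      (auto simp: F_D_vac[symmetric])
  then have "cartan_image \<rho> UNIV \<subseteq> ?N" by (intro cartan_image_least sub)
  then show ?thesis by auto
qed

text \<open>
  Pull the submodule back along d. The kernel of d consists of the killed vectors, so a nonzero
  submodule contains some \<open>d p\<close> with p not killed.
\<close>

lemma exact_1_forms_contain_cartan_image:
  assumes n: "CARD('n) \<ge> 2" and simple: "simple_module sc weyl_algebra \<rho> UNIV"
    and N: "submodule (fscale sc) div_zero_algebra (F_act sc \<rho>) N (d ` forms 0)" "N \<noteq> {0}"
  shows "d ` basis_form [] ` cartan_image \<rho> UNIV \<subseteq> N"
proof -
  have N': "F.subspace N" "N \<subseteq> d ` forms 0"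
    "\<And>u r g. dual_pairing u r = 0 \<Longrightarrow> g \<in> N \<Longrightarrow> F_D sc \<rho> u r g \<in> N"
    using N by (auto simp: div_zero_submodule_iff)
  let ?N = "{g \<in> forms 0. d g \<in> N}"
  have "submodule (fscale sc) div_zero_algebra (F_act sc \<rho>) ?N (forms 0)"
    unfolding div_zero_submodule_iff
    using N'(1,3) subspace_forms[of 0]
    by (auto simp: F.subspace_def d_add d_fscale F_D_d[symmetric] F_D_forms)
  moreover obtain p where p: "d (basis_form [] p) \<in> N" "d (basis_form [] p) \<noteq> 0"
    using N(2) N'(2) F.subspace_0[OF N'(1)] by (fastforce simp: forms_0)
  moreover obtain j where "dd j p \<noteq> 0" using p(2) d_vac_zero_iff by blast
  ultimately have "basis_form [] ` cartan_image \<rho> UNIV \<subseteq> ?N"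
    using vac_forms by (intro functions_contain_cartan_image[OF n simple, of _ "forms 0" p j]) simp_all
  then show ?thesis by auto
qed

text \<open>
  For \<open>(u|r) = 0\<close> the operators \<open>x\<^sup>r\<close> and \<open>\<partial>\<^sub>u\<close> commute. Hence every subspace between \<open>\<hh>P\<close> and P is
  a submodule.
\<close>

lemma cartan_image_stable:
  assumes "dual_pairing u r = 0"
  shows "X r (partial_along u p) \<in> cartan_image \<rho> UNIV"
proof -
  have "partial_along u (X r p) \<in> cartan_image \<rho> UNIV"
    unfolding partial_along_def
    by (intro subspace_sum subspace_scale subspace_cartan_image dd_in_cartan_image)
  then show ?thesis by (simp add: partial_along_X assms)
qed

lemma subspace_vac: "subspace S \<Longrightarrow> F.subspace (basis_form [] ` S :: ('n list \<Rightarrow> 'p) set)"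
  by (auto simp: subspace_def F.subspace_def basis_form_add[symmetric] basis_form_scale[symmetric])
    (metis basis_form_zero imageI)

lemma vac_submodule:
  assumes "subspace S" "cartan_image \<rho> UNIV \<subseteq> S"
  shows "submodule (fscale sc) div_zero_algebra (F_act sc \<rho>) (basis_form [] ` S) (forms 0)"
  unfolding div_zero_submodule_iff
  by (auto simp: F_D_vac vac_forms subspace_vac[OF assms(1)]
      intro!: imageI subsetD[OF assms(2)] cartan_image_stable)

lemma subspace_d: "F.subspace N \<Longrightarrow> F.subspace (d ` N)"
proof -
  assume N: "F.subspace N"
  show ?thesis
    unfolding F.subspace_def
  proof (intro conjI ballI allI)
    show "0 \<in> d ` N" using F.subspace_0[OF N] by (metis d_zero imageI)
    show "x + y \<in> d ` N" if "x \<in> d ` N" "y \<in> d ` N" for x y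
      using that F.subspace_add[OF N] by (auto simp: d_add[symmetric])
    show "fscale sc c x \<in> d ` N" if "x \<in> d ` N" for c x
      using that F.subspace_scale[OF N] by (auto simp: d_fscale[symmetric])
  qed
qed

lemma d_submodule:
  assumes "submodule (fscale sc) div_zero_algebra (F_act sc \<rho>) N M" "M \<subseteq> forms m"
  shows "submodule (fscale sc) div_zero_algebra (F_act sc \<rho>) (d ` N) (d ` M)"
  using assms subspace_d unfolding div_zero_submodule_iff
  by (auto simp: F_D_d subset_iff)

lemma forms_submodule: "submodule (fscale sc) div_zero_algebra (F_act sc \<rho>) (forms m) (forms m)"
  unfolding div_zero_submodule_iff by (simp add: subspace_forms F_D_forms)

lemma exact_submodule:
  "submodule (fscale sc) div_zero_algebra (F_act sc \<rho>) (d ` forms m) (forms (Suc m))"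
  using d_submodule[OF forms_submodule order_refl, of m] d_forms
  unfolding div_zero_submodule_iff by auto

lemma cartan_image_F_0: "cartan_image (F_act sc \<rho>) (forms 0) = basis_form [] ` cartan_image \<rho> UNIV"
proof -
  have "(\<exists>m. y = (\<Sum>i\<in>UNIV. pd i (m i)) \<and> (\<forall>i. m i \<in> forms 0)) \<longleftrightarrow>
      (\<exists>m. y = basis_form [] (\<Sum>i\<in>UNIV. dd i (m i)))" for y
  proof
    assume "\<exists>m. y = (\<Sum>i\<in>UNIV. pd i (m i)) \<and> (\<forall>i. m i \<in> forms 0)"
    then obtain m where m: "y = (\<Sum>i\<in>UNIV. pd i (m i))" "\<forall>i. m i \<in> range (basis_form [])"
      unfolding forms_0 by blast
    have "\<forall>i. \<exists>q. m i = basis_form [] q" using m(2) by (simp add: image_iff)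
    from choice[OF this] obtain q where "\<forall>i. m i = basis_form [] (q i)" by blast
    then show "\<exists>m. y = basis_form [] (\<Sum>i\<in>UNIV. dd i (m i))"
      using m(1) by (intro exI[of _ q]) (simp add: basis_form_sum basis_form_dd)
  next
    assume "\<exists>m. y = basis_form [] (\<Sum>i\<in>UNIV. dd i (m i))"
    then obtain m where "y = basis_form [] (\<Sum>i\<in>UNIV. dd i (m i))" by blast
    then show "\<exists>m. y = (\<Sum>i\<in>UNIV. pd i (m i)) \<and> (\<forall>i. m i \<in> forms 0)"
      by (intro exI[of _ "\<lambda>i. basis_form [] (m i)"])
        (simp add: basis_form_sum basis_form_dd vac_forms)
  qed
  moreover have "y \<in> basis_form [] ` cartan_image \<rho> UNIV \<longleftrightarrow>
      (\<exists>m. y = basis_form [] (\<Sum>i\<in>UNIV. dd i (m i)))" for y :: "'n list \<Rightarrow> 'p"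
    by (simp only: image_iff Bex_def cartan_image_P) blast
  ultimately show ?thesis
    unfolding cartan_image_F[OF order_refl] set_eq_iff by simp
qed

lemma pd_d: "pd i (d g) = d (pd i g)"
  by (simp add: d_def pd_sum wedge_pd pd_pd[of i])

lemma cartan_image_d:
  assumes "M \<subseteq> forms m"
  shows "cartan_image (F_act sc \<rho>) (d ` M) = d ` cartan_image (F_act sc \<rho>) M"
proof -
  have dM: "d ` M \<subseteq> forms (Suc m)" using assms d_forms by auto
  have "(\<exists>m. y = (\<Sum>i\<in>UNIV. pd i (m i)) \<and> (\<forall>i. m i \<in> d ` M)) \<longleftrightarrow>
      (\<exists>m. y = d (\<Sum>i\<in>UNIV. pd i (m i)) \<and> (\<forall>i. m i \<in> M))" for y
  proof
    assume "\<exists>m. y = (\<Sum>i\<in>UNIV. pd i (m i)) \<and> (\<forall>i. m i \<in> d ` M)"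
    then obtain m where m: "y = (\<Sum>i\<in>UNIV. pd i (m i))" "\<forall>i. \<exists>q. m i = d q \<and> q \<in> M"
      by blast
    then obtain q where "\<And>i. m i = d (q i) \<and> q i \<in> M" by metis
    then show "\<exists>m. y = d (\<Sum>i\<in>UNIV. pd i (m i)) \<and> (\<forall>i. m i \<in> M)"
      using m(1) by (intro exI[of _ q]) (simp add: d_sum pd_d)
  next
    assume "\<exists>m. y = d (\<Sum>i\<in>UNIV. pd i (m i)) \<and> (\<forall>i. m i \<in> M)"
    then obtain m where "y = d (\<Sum>i\<in>UNIV. pd i (m i))" "\<forall>i. m i \<in> M" by blast
    then show "\<exists>m. y = (\<Sum>i\<in>UNIV. pd i (m i)) \<and> (\<forall>i. m i \<in> d ` M)"
      by (intro exI[of _ "\<lambda>i. d (m i)"]) (simp add: d_sum pd_d)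
  qed
  then show ?thesis
    unfolding cartan_image_F[OF dM] cartan_image_F[OF assms] by (auto simp: image_iff)
qed

text \<open>
  If d vanished on m-forms, then so would \<open>x\<^sup>-\<^sup>r d x\<^sup>r - d = r \<and> _\<close> for every r.
\<close>

lemma d_nontrivial:
  assumes "(p :: 'p) \<noteq> 0" "m < CARD('n)"
  shows "\<exists>g\<in>forms m. d g \<noteq> 0"
proof (rule ccontr)
  assume "\<not> ?thesis"
  then have 0: "d g = 0" if "g \<in> forms m" for g using that by blast
  obtain g :: "'n list \<Rightarrow> 'p" where g: "g \<in> forms m" "g \<noteq> 0"
    using forms_nontrivial[where 'n = 'n, OF assms(1), of m] assms(2) by auto
  have "eps i g = 0" for i
  proof -
    have "xx (axis i 1) (eps i g) = 0"
      using 0[OF xx_forms[OF g(1), of "axis i 1"]] 0[OF g(1)] by (simp add: d_xx)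
    then have "xx (- axis i 1) (xx (axis i 1) (eps i g)) = 0" by simp
    then show ?thesis by (simp only: xx_xx) simp
  qed
  then show False using eps_zero[OF g(1) assms(2)] g(2) by blast
qed

lemma iotav_forms: "g \<in> forms (Suc k) \<Longrightarrow> iotav u g \<in> forms k"
  unfolding iotav_def by (intro F.subspace_sum F.subspace_scale subspace_forms iota_forms)

text \<open>
  Closed forms are mapped to exact ones by Cartan's formula. Conversely, if every field maps y
  to an exact form, then every field kills \<open>w = d y\<close>, so \<open>d (x\<^sup>r \<iota>\<^sub>a w) = 0\<close> for all r and a.
  Comparing \<open>r = 0\<close> with \<open>r = e\<^sub>a\<close> gives \<open>e\<^sub>a \<iota>\<^sub>a w = 0\<close>, and Euler's formula gives \<open>w = 0\<close>.
\<close>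

lemma L_tilde_eq: "L_tilde sc \<rho> (Suc m) = {y \<in> forms (Suc m). d y = 0}"
proof (intro set_eqI iffI)
  fix y
  assume "y \<in> L_tilde sc \<rho> (Suc m)"
  then have y: "y \<in> forms (Suc m)"
    and L: "\<And>\<delta>. \<delta> \<in> witt_algebra \<Longrightarrow> F_act sc \<rho> \<delta> y \<in> d ` forms m"
    by (auto simp: L_tilde_def L_mod_def F_mod_eq_forms)
  let ?w = "d y"
  have w: "?w \<in> forms (Suc (Suc m))" by (rule d_forms[OF y])
  have 0: "d (xx r (iota a ?w)) = 0" for a r
  proof -
    have "d (F_D sc \<rho> (axis a 1) r y) = 0"
      using L[OF D_in_witt_algebra[of "axis a 1" r]] by (auto simp: F_act_D)
    then show ?thesis
      using F_D_closed[OF w d_d, of "axis a 1" r] by (simp add: F_D_d[OF y] iotav_axis)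
  qed
  have "eps a (iota a ?w) = 0" for a
  proof -
    have "xx (axis a 1) (eps a (iota a ?w)) = 0"
      using 0[of "axis a 1" a] 0[of 0 a] by (simp add: d_xx)
    then have "xx (- axis a 1) (xx (axis a 1) (eps a (iota a ?w))) = 0" by simp
    then show ?thesis by (simp only: xx_xx) simp
  qed
  then have "?w = 0" by (rule eps_iota_zero[OF w])
  then show "y \<in> {y \<in> forms (Suc m). d y = 0}" using y by simp
next
  fix y
  assume "y \<in> {y \<in> forms (Suc m). d y = 0}"
  then have y: "y \<in> forms (Suc m)" "d y = 0" by simp_all
  have "F_act sc \<rho> \<delta> y \<in> d ` forms m" for \<delta>
    unfolding F_act_def F_D_closed[OF y]
    by (intro F.subspace_sum subspace_d subspace_forms imageI xx_forms iotav_forms y)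
  then show "y \<in> L_tilde sc \<rho> (Suc m)"
    using y by (simp add: L_tilde_def L_mod_def F_mod_eq_forms)
qed

text \<open>
  The coefficient of a top form identifies top forms with P and, since the matrix \<open>r u\<^sup>T\<close> has trace
  \<open>(u|r)\<close>, also identifies the actions of \<open>D u r\<close> for \<open>(u|r) = 0\<close>. Exact top forms have
  coefficients in \<open>\<hh>P\<close>, which contains no nonzero killed vector, and so the result in degree zero
  applies.
\<close>

lemma exact_top_forms_in_stable_subspace:
  assumes n: "CARD('n) \<ge> 2" and simple: "simple_module sc weyl_algebra \<rho> UNIV"
    and m: "Suc m = CARD('n)"
    and N: "F.subspace N" "N \<subseteq> d ` forms m"
    and stable: "\<And>u r g. dual_pairing u r = 0 \<Longrightarrow> g \<in> N \<Longrightarrow> F_D sc \<rho> u r g \<in> N"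
    and y0: "y0 \<in> N" "y0 \<noteq> 0"
    and g: "g \<in> forms m"
  shows "d g \<in> N"
proof -
  obtain T :: "'n list" where T: "set T = UNIV" "distinct T"
    using finite_distinct_list[of "UNIV :: 'n set"] by auto
  have len: "length T = Suc m" using T distinct_card m by metis
  have top: "y = basis_form T (y T)" if "y \<in> forms (Suc m)" for y
    using that top_form_eq T m by metis
  have exact: "d h T \<in> cartan_image \<rho> UNIV" for h
    unfolding cartan_image_P
    by (rule exI[of _ "\<lambda>i. eps i h T"]) (simp add: d_def wedge_pd sum_fun_apply, simp add: pd_def)
  let ?N = "{p. basis_form T p \<in> N}"
  have sub: "subspace ?N"
    using N(1)
    by (simp add: subspace_def F.subspace_def basis_form_add basis_form_scale)
  have FD: "F_D sc \<rho> u r (basis_form T p) = basis_form T (X r (partial_along u p))"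
    if "dual_pairing u r = 0" for u r p
  proof -
    let ?y = "basis_form T p"
    have y: "?y \<in> forms (Suc m)" using basis_form_forms[of T p] len by simp
    have zero: "h = 0" if "h \<in> forms (Suc (Suc m))" for h :: "'n list \<Rightarrow> 'p"
      using forms_above[OF that] m by simp
    have dy: "d ?y = 0" by (rule zero[OF d_forms[OF y]])
    have "wedge sc (cvec r) (iotav u ?y) = fscale sc (dual_pairing u r) ?y - iotav u (wedge sc (cvec r) ?y)"
      by (simp add: iotav_def iota_wedge F.scale_right_diff_distrib sum_subtractf wedge_sum
          wedge_fscale dual_pairing_def F.scale_sum_left cvec_def)
    also have "\<dots> = 0"
      using that zero[OF wedge_forms[OF y]] by (simp add: iotav_def)
    finally have "F_D sc \<rho> u r ?y = xx r (d (iotav u ?y))"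
      by (simp add: F_D_closed[OF y dy] d_xx)
    also have "d (iotav u ?y) = basis_form T (partial_along u p)"
      using iotav_d[of u ?y] dy by (simp add: basis_form_partial_along) (simp add: iotav_def)
    finally show ?thesis by (simp add: basis_form_X)
  qed
  have y0f: "y0 \<in> forms (Suc m)" using N(2) y0(1) d_forms by auto
  have "y0 T \<noteq> 0"
    using top[OF y0f] y0(2) by auto
  moreover have "y0 T \<in> cartan_image \<rho> UNIV" using N(2) y0(1) exact by auto
  ultimately obtain j where "dd j (y0 T) \<noteq> 0"
    using cartan_image_inter_killed[OF simple] by blast
  moreover have "y0 T \<in> ?N" using top[OF y0f] y0(1) by simp
  ultimately have "dd i w \<in> ?N" for i w
    using stable by (intro div_zero_stable_contains_image[OF n simple sub, of "y0 T" j])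
      (auto simp: FD[symmetric])
  then have "cartan_image \<rho> UNIV \<subseteq> ?N" by (intro cartan_image_least sub)
  then have "basis_form T (d g T) \<in> N" using exact by blast
  then show ?thesis using top[OF d_forms[OF g]] by simp
qed

end

section \<open>The structure theorem\<close>

context weyl_module
begin

lemma cartan_images_nonzero:
  assumes "simple_module sc weyl_algebra \<rho> UNIV"
  shows "basis_form [] ` cartan_image \<rho> UNIV \<noteq> ({0} :: ('n list \<Rightarrow> 'p) set)"
    "d ` basis_form [] ` cartan_image \<rho> UNIV \<noteq> {0}"
proof -
  obtain z :: 'p where "z \<noteq> 0" using assms by (auto simp: simple_module_def)
  define i :: 'n where "i = undefined"
  obtain w where w: "dd i (dd i w) \<noteq> 0" using dd_dd_nonzero[OF \<open>z \<noteq> 0\<close>, of i] by blast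
  show 2: "d ` basis_form [] ` cartan_image \<rho> UNIV \<noteq> {0}"
    using w d_vac_zero_iff dd_in_cartan_image by (metis image_eqI singletonD)
  show "basis_form [] ` cartan_image \<rho> UNIV \<noteq> ({0} :: ('n list \<Rightarrow> 'p) set)"
  proof
    assume "basis_form [] ` cartan_image \<rho> UNIV = ({0} :: ('n list \<Rightarrow> 'p) set)"
    then have "d ` basis_form [] ` cartan_image \<rho> UNIV = d ` {0}" by (rule arg_cong)
    then show False using 2 by simp
  qed
qed

lemma functions_least_submodule:
  assumes n: "CARD('n) \<ge> 2" and simple: "simple_module sc weyl_algebra \<rho> UNIV"
    and A: "\<not> isomorphic_to_A sc \<rho>"
    and N: "submodule (fscale sc) div_zero_algebra (F_act sc \<rho>) N (forms 0)" "N \<noteq> {0}"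
  shows "basis_form [] ` cartan_image \<rho> UNIV \<subseteq> N"
proof -
  have "0 \<in> N" "N \<subseteq> forms 0" using N(1) by (auto simp: div_zero_submodule_iff F.subspace_def)
  then obtain p where "basis_form [] p \<in> N" "basis_form [] p \<noteq> (0 :: 'n list \<Rightarrow> 'p)"
    using N(2) by (fastforce simp: forms_0)
  moreover then have "p \<noteq> 0" by auto
  then obtain j where "dd j p \<noteq> 0"
    using A isomorphic_to_A_iff_killed[OF simple] by blast
  ultimately show ?thesis by (intro functions_contain_cartan_image[OF n simple N(1)])
qed

lemma tensor_product_exterior_power_0:
  assumes "subspace S"
  shows "tensor_product sc S (exterior_power 0) = (basis_form [] ` S :: ('n list \<Rightarrow> 'p) set)"
proof -
  have pure: "pure_tensor sc p (\<lambda>l. if l = [] then c else 0) = (basis_form [] (sc c p) :: 'n list \<Rightarrow> 'p)"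
    for p c
    by (auto simp: pure_tensor_def basis_form_Nil fun_eq_iff)
  have "{pure_tensor sc p y | p y. p \<in> S \<and> y \<in> exterior_power 0} = (basis_form [] ` S :: ('n list \<Rightarrow> 'p) set)"
  proof (intro equalityI subsetI)
    fix g :: "'n list \<Rightarrow> 'p"
    assume "g \<in> {pure_tensor sc p y | p y. p \<in> S \<and> y \<in> exterior_power 0}"
    then show "g \<in> basis_form [] ` S"
      using subspace_scale[OF assms] by (auto simp: exterior_power_0 pure)
  next
    fix g :: "'n list \<Rightarrow> 'p"
    assume "g \<in> basis_form [] ` S"
    then obtain p where p: "p \<in> S" "g = basis_form [] p" by auto
    then have "g = pure_tensor sc p (\<lambda>l. if l = [] then 1 else 0)" by (simp add: pure)
    then show "g \<in> {pure_tensor sc p y | p y. p \<in> S \<and> y \<in> exterior_power 0}"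
      using p(1) by (auto simp: exterior_power_0)
  qed
  then show ?thesis
    unfolding tensor_product_def using F.span_eq_iff subspace_vac[OF assms] by simp
qed

text \<open>
  A Laurent polynomial is split into its constant term and the rest. Divergence zero fields
  kill constants and never produce a constant term, so the splitting is one of modules.
\<close>

lemma functions_isomorphic:
  assumes "isomorphic_to_A sc \<rho>"
  shows "isomorphic_modules div_zero_algebra (fscale sc) (F_act sc \<rho>) (forms 0)
    A_C_scale A_C_act (A_prime \<times> UNIV)"
proof -
  obtain \<psi> where \<psi>: "bij \<psi>" "\<And>z w. \<psi> (z + w) = \<psi> z + \<psi> w" "\<And>c z. \<psi> (sc c z) = lscale c (\<psi> z)"
    "\<And>a z. a \<in> weyl_algebra \<Longrightarrow> \<psi> (\<rho> a z) = a (\<psi> z)"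
    using isomorphic_to_A_obtain[OF assms] by blast
  define c :: "'n laurent \<Rightarrow> 'n laurent"
    where "c f = Poly_Mapping.single 0 (Poly_Mapping.lookup f 0)" for f
  define \<theta> :: "('n list \<Rightarrow> 'p) \<Rightarrow> 'n laurent \<times> complex"
    where "\<theta> g = (\<psi> (g []) - c (\<psi> (g [])), Poly_Mapping.lookup (\<psi> (g [])) 0)" for g
  have vac: "\<exists>p. g = basis_form [] p" if "g \<in> forms 0" for g :: "'n list \<Rightarrow> 'p"
    using that by (auto simp: forms_0)
  have c: "c (f + g) = c f + c g" "c (lscale a f) = lscale a (c f)" for f g a
    by (auto intro!: poly_mapping_eqI simp: c_def lookup_add lookup_single when_def)
  have "inj_on \<theta> (forms 0)"
  proof (rule inj_onI)
    fix g h assume gh: "g \<in> forms 0" "h \<in> forms 0" "\<theta> g = \<theta> h"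
    then have "\<psi> (g []) = \<psi> (h [])" by (auto simp: \<theta>_def c_def)
    then have "g [] = h []" using bij_is_inj[OF \<psi>(1)] by (auto dest: injD)
    then show "g = h" using vac[OF gh(1)] vac[OF gh(2)] by (auto simp: basis_form_Nil)
  qed
  moreover have "\<theta> ` forms 0 = A_prime \<times> UNIV"
  proof (intro equalityI subsetI)
    fix x assume "x \<in> \<theta> ` forms 0"
    then show "x \<in> A_prime \<times> UNIV"
      by (auto simp: \<theta>_def A_prime_iff c_def lookup_minus)
  next
    fix x :: "'n laurent \<times> complex" assume "x \<in> A_prime \<times> UNIV"
    then obtain f a where x: "x = (f, a)" "Poly_Mapping.lookup f 0 = 0" by (auto simp: A_prime_iff)
    obtain p where p: "\<psi> p = f + Poly_Mapping.single 0 a"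
      using bij_is_surj[OF \<psi>(1)] by (metis surjD)
    have "\<theta> (basis_form [] p) = x"
      by (simp add: \<theta>_def basis_form_Nil p c_def x lookup_add)
    then show "x \<in> \<theta> ` forms 0" using vac_forms by blast
  qed
  ultimately have "bij_betw \<theta> (forms 0) (A_prime \<times> UNIV)" by (simp add: bij_betw_def)
  moreover have "\<theta> (g + h) = \<theta> g + \<theta> h" for g h
    by (simp add: \<theta>_def fun_apply \<psi>(2) c lookup_add)
  moreover have "\<theta> (fscale sc a g) = A_C_scale a (\<theta> g)" for a g
  proof -
    have "lscale a f - lscale a h = lscale a (f - h)" for f h :: "'n laurent"
      by (intro poly_mapping_eqI) (simp add: lookup_minus right_diff_distrib)
    then show ?thesis by (simp add: \<theta>_def fscale_def \<psi>(3) c A_C_scale_def)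
  qed
  moreover have "\<theta> (F_act sc \<rho> \<delta> g) = A_C_act \<delta> (\<theta> g)" if \<delta>: "\<delta> \<in> div_zero_algebra" and g: "g \<in> forms 0" for \<delta> g
  proof -
    have w: "\<delta> \<in> witt_algebra" using \<delta> div_zero_subset_witt by blast
    obtain p where p: "g = basis_form [] p" using vac[OF g] by blast
    have "F_act sc \<rho> \<delta> g [] = \<rho> \<delta> p"
      by (simp add: p F_act_vac[OF w]) (simp add: basis_form_Nil)
    moreover have "\<delta> (f - c f) = \<delta> f" for f
    proof -
      have eq: "D u r (f - c f) = D u r f" for u r
      proof (rule poly_mapping_eqI)
        fix t
        have "Poly_Mapping.lookup (D u r (f - c f)) (r + (t - r)) =
            Poly_Mapping.lookup (D u r f) (r + (t - r))"
          unfolding lookup_D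
          by (auto simp: c_def lookup_minus lookup_single when_def dual_pairing_def)
        then show "Poly_Mapping.lookup (D u r (f - c f)) t = Poly_Mapping.lookup (D u r f) t" by simp
      qed
      show ?thesis by (simp add: witt_expansion[OF w] eq)
    qed
    moreover have "g [] = p" by (simp add: p basis_form_Nil)
    ultimately show ?thesis
      using div_zero_lookup_0[OF \<delta>]
      by (simp add: \<theta>_def A_C_act_def \<psi>(4) witt_in_weyl[OF w] c_def)
  qed
  ultimately show ?thesis unfolding isomorphic_modules_def by blast
qed

lemma exact_1_forms_eq_cartan_image:
  assumes simple: "simple_module sc weyl_algebra \<rho> UNIV" and A: "isomorphic_to_A sc \<rho>"
  shows "d ` basis_form [] ` cartan_image \<rho> UNIV = d ` forms 0"
proof
  show "d ` forms 0 \<subseteq> d ` basis_form [] ` cartan_image \<rho> UNIV"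
  proof
    fix y assume "y \<in> d ` forms 0"
    then obtain p where p: "y = d (basis_form [] p)" by (auto simp: forms_0)
    obtain q where q: "q \<in> cartan_image \<rho> UNIV" "\<And>i. dd i (p - q) = 0"
      using cartan_image_plus_killed[OF assms] by blast
    have "d (basis_form [] (p - q)) = 0" using q(2) d_vac_zero_iff by blast
    then have "d (basis_form [] (p - q)) + d (basis_form [] q) = d (basis_form [] q)" by simp
    then have "y = d (basis_form [] q)"
      by (simp add: d_add[symmetric] basis_form_add[symmetric] p)
    then show "y \<in> d ` basis_form [] ` cartan_image \<rho> UNIV" using q(1) by blast
  qed
qed (use vac_forms in blast)

text \<open>
  The kernel of d on Laurent polynomials consists of the constants, so d is injective on
  \<open>A_prime\<close> and has the same image there.
\<close>

lemma exact_1_forms_isomorphic: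
  assumes "isomorphic_to_A sc \<rho>"
  shows "isomorphic_modules div_zero_algebra (fscale sc) (F_act sc \<rho>) (d ` forms 0)
    lscale (\<lambda>\<delta> f. \<delta> f) A_prime"
proof (rule isomorphic_modules_sym)
  obtain \<psi> where \<psi>: "bij \<psi>" "\<And>z w. \<psi> (z + w) = \<psi> z + \<psi> w" "\<And>c z. \<psi> (sc c z) = lscale c (\<psi> z)"
    "\<And>a z. a \<in> weyl_algebra \<Longrightarrow> \<psi> (\<rho> a z) = a (\<psi> z)"
    using isomorphic_to_A_obtain[OF assms] by blast
  define \<eta> where "\<eta> = inv \<psi>"
  have \<psi>\<eta>: "\<psi> (\<eta> f) = f" and \<eta>\<psi>: "\<eta> (\<psi> z) = z" for f z
    using \<psi>(1) by (simp_all add: \<eta>_def bij_is_surj surj_f_inv_f bij_is_inj inv_f_f)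
  have \<eta>: "\<eta> (f + g) = \<eta> f + \<eta> g" "\<eta> (lscale c f) = sc c (\<eta> f)" for f g c
    using \<eta>\<psi>[of "\<eta> f + \<eta> g"] \<eta>\<psi>[of "sc c (\<eta> f)"] by (simp_all add: \<psi>(2,3) \<psi>\<eta>)
  have \<eta>_act: "\<eta> (a f) = \<rho> a (\<eta> f)" if "a \<in> weyl_algebra" for a f
    using \<eta>\<psi>[of "\<rho> a (\<eta> f)"] by (simp add: \<psi>(4)[OF that] \<psi>\<eta>)
  have \<eta>0: "\<eta> 0 = 0" using \<eta>(1)[of 0 0] by simp
  have \<eta>0_iff: "\<eta> f = 0 \<longleftrightarrow> f = 0" for f using \<eta>0 \<psi>\<eta> by metis
  define \<theta> where "\<theta> f = d (basis_form [] (\<eta> f))" for f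
  have \<theta>_0: "\<theta> f = 0 \<longleftrightarrow> f = Poly_Mapping.single 0 (Poly_Mapping.lookup f 0)" for f
  proof -
    have "\<theta> f = 0 \<longleftrightarrow> (\<forall>i. \<eta> (partial i f) = 0)"
      by (simp add: \<theta>_def d_vac_zero_iff dd_def \<eta>_act weyl_algebra.partial)
    also have "\<dots> \<longleftrightarrow> (\<forall>i. partial i f = 0)" by (simp add: \<eta>0_iff)
    finally show ?thesis by (simp only: partial_eq_0_iff)
  qed
  have \<theta>: "\<theta> (f + g) = \<theta> f + \<theta> g" "\<theta> (lscale c f) = fscale sc c (\<theta> f)" for f g c
    by (simp_all add: \<theta>_def \<eta> basis_form_add basis_form_scale d_add d_fscale)
  have "\<theta> (\<delta> f) = F_act sc \<rho> \<delta> (\<theta> f)" if "\<delta> \<in> div_zero_algebra" for \<delta> f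
  proof -
    have "\<delta> \<in> witt_algebra" using that div_zero_subset_witt by blast
    then show ?thesis
      by (simp add: \<theta>_def F_act_d[OF vac_forms] F_act_vac \<eta>_act witt_in_weyl)
  qed
  moreover have "bij_betw \<theta> A_prime (d ` forms 0)"
    unfolding bij_betw_def
  proof
    show "inj_on \<theta> A_prime"
    proof (rule inj_onI)
      fix f g assume fg: "f \<in> A_prime" "g \<in> A_prime" "\<theta> f = \<theta> g"
      have "lscale (-1) g = - g" by (intro poly_mapping_eqI) simp
      then have "\<theta> (f - g) = 0" using \<theta>(1)[of f "- g"] \<theta>(2)[of "-1" g] fg(3) by simp
      then have "f - g = Poly_Mapping.single 0 (Poly_Mapping.lookup (f - g) 0)"
        using \<theta>_0 by blast
      moreover have "Poly_Mapping.lookup (f - g) 0 = 0"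
        using fg by (simp add: A_prime_iff lookup_minus)
      ultimately show "f = g" by simp
    qed
    show "\<theta> ` A_prime = d ` forms 0"
    proof (intro equalityI subsetI)
      fix y assume "y \<in> \<theta> ` A_prime"
      then show "y \<in> d ` forms 0" using vac_forms by (auto simp: \<theta>_def)
    next
      fix y assume "y \<in> d ` forms 0"
      then obtain p where "y = d (basis_form [] p)" by (auto simp: forms_0)
      then have y: "y = \<theta> (\<psi> p)" by (simp add: \<theta>_def \<eta>\<psi>)
      let ?c = "Poly_Mapping.single 0 (Poly_Mapping.lookup (\<psi> p) 0)"
      have "\<theta> ?c = 0" unfolding \<theta>_0 by simp
      then have "y = \<theta> (\<psi> p - ?c)"
        using \<theta>(1)[of "\<psi> p - ?c" ?c] y by simp
      moreover have "\<psi> p - ?c \<in> A_prime" by (simp add: A_prime_iff lookup_minus)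
      ultimately show "y \<in> \<theta> ` A_prime" by blast
    qed
  qed
  ultimately show "isomorphic_modules div_zero_algebra lscale (\<lambda>\<delta> f. \<delta> f) A_prime
      (fscale sc) (F_act sc \<rho>) (d ` forms 0)"
    unfolding isomorphic_modules_def using \<theta> by blast
next
  show "f + g \<in> A_prime" if "f \<in> A_prime" "g \<in> A_prime" for f g :: "'n laurent"
    using that by (simp add: A_prime_iff lookup_add)
  show "lscale c f \<in> A_prime" if "f \<in> A_prime" for c and f :: "'n laurent"
    using that by (simp add: A_prime_iff)
  show "\<delta> f \<in> A_prime" if "\<delta> \<in> div_zero_algebra" for \<delta> and f :: "'n laurent"
    using div_zero_lookup_0[OF that] by (simp add: A_prime_iff)
qed

lemma exact_forms_no_proper_submodule:
  assumes n: "CARD('n) \<ge> 2" and simple: "simple_module sc weyl_algebra \<rho> UNIV"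
    and m: "1 \<le> m" "m < CARD('n)"
    and N: "submodule (fscale sc) div_zero_algebra (F_act sc \<rho>) N (d ` forms m)" "N \<noteq> {0}"
  shows "N = d ` forms m"
proof -
  have N': "F.subspace N" "N \<subseteq> d ` forms m"
    "\<And>u r g. dual_pairing u r = 0 \<Longrightarrow> g \<in> N \<Longrightarrow> F_D sc \<rho> u r g \<in> N"
    using N by (auto simp: div_zero_submodule_iff)
  obtain y0 where y0: "y0 \<in> N" "y0 \<noteq> 0" using N(2) F.subspace_0[OF N'(1)] by auto
  have "d g \<in> N" if "g \<in> forms m" for g
  proof (cases "Suc m = CARD('n)")
    case True
    show ?thesis
      using exact_top_forms_in_stable_subspace[OF n simple True N'(1,2) N'(3) y0 that] .
  next
    case False
    then have "Suc m < CARD('n)" using m(2) by simp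
    from exact_forms_in_stable_subspace[OF simple m(1) this N'(1,2) N'(3) y0 that] show ?thesis .
  qed
  then show ?thesis using N'(2) by auto
qed

text \<open>
  Modulo closed forms, the m-forms are the exact (m+1)-forms, which form a simple module: for
  \<open>m + 1 < n\<close> by the result on middle degrees, for \<open>m + 1 = n\<close> by the one on top forms.
\<close>

lemma closed_forms_maximal:
  assumes n: "CARD('n) \<ge> 2" and simple: "simple_module sc weyl_algebra \<rho> UNIV"
    and m: "1 \<le> m" "m < CARD('n)"
  shows "maximal_submodule (fscale sc) div_zero_algebra (F_act sc \<rho>)
    {y \<in> forms m. d y = 0} (forms m)"
proof -
  let ?K = "{y \<in> forms m. d y = 0}"
  obtain z :: 'p where "z \<noteq> 0" using simple by (auto simp: simple_module_def)
  then have ne: "?K \<noteq> forms m" using d_nontrivial[of z m] m(2) by blast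
  have F0: "F_D sc \<rho> u r 0 = 0" for u r
    using F_D_cartan[OF F.subspace_0[OF subspace_forms], of u r] by (simp add: iotav_def)
  have K: "submodule (fscale sc) div_zero_algebra (F_act sc \<rho>) ?K (forms m)"
    unfolding div_zero_submodule_iff
    using subspace_forms[of m]
    by (auto simp: F.subspace_def d_add d_fscale F_D_forms F_D_d[symmetric] F0)
  have "N = ?K \<or> N = forms m"
    if N: "submodule (fscale sc) div_zero_algebra (F_act sc \<rho>) N (forms m)" "?K \<subseteq> N" for N
  proof (cases "d ` N = {0}")
    case True
    then show ?thesis using N by (auto simp: div_zero_submodule_iff)
  next
    case False
    have dN: "d ` N = d ` forms m"
      by (rule exact_forms_no_proper_submodule[OF n simple m d_submodule[OF N(1) order_refl] False])
    have sub: "F.subspace N" "N \<subseteq> forms m" using N(1) by (auto simp: div_zero_submodule_iff)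
    have "g \<in> N" if g: "g \<in> forms m" for g
    proof -
      obtain h where h: "h \<in> N" "d g = d h" using dN g by blast
      have "g - h \<in> ?K"
        using g h sub(2) F.subspace_diff[OF subspace_forms, of g m h] by (auto simp: d_diff)
      then have "(g - h) + h \<in> N" using h(1) N(2) by (intro F.subspace_add[OF sub(1)]) auto
      then show ?thesis by simp
    qed
    then show ?thesis using sub(2) by auto
  qed
  then show ?thesis unfolding maximal_submodule_def using K ne by blast
qed

end

theorem theorem4p16:
  fixes sc :: "complex \<Rightarrow> 'p::ab_group_add \<Rightarrow> 'p"
    and \<rho> :: "('n::finite laurent \<Rightarrow> 'n laurent) \<Rightarrow> 'p \<Rightarrow> 'p"
  assumes n_ge_2: "CARD('n) \<ge> 2"
    and P_module: "weyl_module sc \<rho>"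
    and P_simple: "simple_module sc weyl_algebra \<rho> UNIV"
  shows
    "(simple_module (fscale sc) div_zero_algebra (F_act sc \<rho>) (F_mod sc 0)
        \<longleftrightarrow> cartan_image \<rho> UNIV = UNIV)
     \<and>
     (\<forall>k. 1 \<le> k \<and> k \<le> CARD('n) - 1 \<longrightarrow>
        \<not> simple_module (fscale sc) div_zero_algebra (F_act sc \<rho>) (F_mod sc k))
     \<and>
     ((\<not> isomorphic_to_A sc \<rho> \<longrightarrow>
         unique_simple_submodule (fscale sc) div_zero_algebra (F_act sc \<rho>)
           (cartan_image (F_act sc \<rho>) (F_mod sc 0)) (F_mod sc 0) \<and>
         (\<forall>N. submodule (fscale sc) div_zero_algebra (F_act sc \<rho>) N (F_mod sc 0) \<and> N \<noteq> {0}
           \<longrightarrow> (\<exists>P'. module.subspace sc P' \<and> cartan_image \<rho> UNIV \<subseteq> P' \<and>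
                  N = tensor_product sc P' (exterior_power 0)))) \<and>
      (isomorphic_to_A sc \<rho> \<longrightarrow>
         isomorphic_modules div_zero_algebra
           (fscale sc) (F_act sc \<rho>) (F_mod sc 0)
           A_C_scale A_C_act (A_prime \<times> UNIV)))
     \<and>
     ((\<not> isomorphic_to_A sc \<rho> \<longrightarrow>
         unique_simple_submodule (fscale sc) div_zero_algebra (F_act sc \<rho>)
           (cartan_image (F_act sc \<rho>) (L_mod sc \<rho> 1)) (L_mod sc \<rho> 1)) \<and>
      (isomorphic_to_A sc \<rho> \<longrightarrow>
         L_mod sc \<rho> 1 = cartan_image (F_act sc \<rho>) (L_mod sc \<rho> 1) \<and>
         isomorphic_modules div_zero_algebra
           (fscale sc) (F_act sc \<rho>) (cartan_image (F_act sc \<rho>) (L_mod sc \<rho> 1))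
           lscale (\<lambda>\<delta> f. \<delta> f) A_prime) \<and>
      (simple_module (fscale sc) div_zero_algebra (F_act sc \<rho>) (L_mod sc \<rho> 1)
         \<longleftrightarrow> cartan_image \<rho> UNIV = UNIV \<or> isomorphic_to_A sc \<rho>))
     \<and>
     (CARD('n) \<ge> 3 \<longrightarrow> (\<forall>k. 2 \<le> k \<and> k \<le> CARD('n) - 1 \<longrightarrow>
        simple_module (fscale sc) div_zero_algebra (F_act sc \<rho>) (L_mod sc \<rho> k) \<and>
        maximal_submodule (fscale sc) div_zero_algebra (F_act sc \<rho>)
          (L_tilde sc \<rho> k) (F_mod sc k)))"
proof -
  interpret weyl_module sc \<rho> by (rule P_module)
  note n = n_ge_2 and simple = P_simple
  let ?S = "div_zero_algebra :: ('n laurent \<Rightarrow> 'n laurent) set"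
  let ?H = "basis_form [] ` cartan_image \<rho> UNIV :: ('n list \<Rightarrow> 'p) set"
  obtain z :: 'p where z: "z \<noteq> 0" using simple by (auto simp: simple_module_def)
  have F: "F_mod sc k = (forms k :: ('n list \<Rightarrow> 'p) set)" for k by (rule F_mod_eq_forms)
  have L: "L_mod sc \<rho> (Suc m) = d ` forms m" for m by (simp add: L_mod_def F)
  have L1: "L_mod sc \<rho> 1 = d ` forms 0" using L[of 0] by simp
  have hF: "cartan_image (F_act sc \<rho>) (forms 0) = ?H" by (rule cartan_image_F_0)
  have hL: "cartan_image (F_act sc \<rho>) (d ` forms 0) = d ` ?H"
    by (simp add: cartan_image_d[OF order_refl] hF)
  have H: "submodule (fscale sc) ?S (F_act sc \<rho>) ?H (forms 0)"
    by (rule vac_submodule[OF subspace_cartan_image order_refl])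
  have dH: "submodule (fscale sc) ?S (F_act sc \<rho>) (d ` ?H) (d ` forms 0)"
    by (rule d_submodule[OF H order_refl])
  note nonzero = cartan_images_nonzero[OF simple]
  have exact: "submodule (fscale sc) ?S (F_act sc \<rho>) (d ` forms m) (d ` forms m)" for m
    using exact_submodule[of m] by (simp add: submodule_def)
  have H_eq: "?H = forms 0 \<longleftrightarrow> cartan_image \<rho> UNIV = UNIV"
  proof -
    have "inj (basis_form [] :: 'p \<Rightarrow> 'n list \<Rightarrow> 'p)" by (auto intro: injI simp: vac_eq_iff)
    from inj_image_eq_iff[OF this] show ?thesis unfolding forms_0 .
  qed
  have not_A: "\<not> isomorphic_to_A sc \<rho>" if "cartan_image \<rho> UNIV = UNIV"
    using isomorphic_to_A_iff_killed[OF simple] cartan_image_inter_killed[OF simple] that by blast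
  have a: "simple_module (fscale sc) ?S (F_act sc \<rho>) (forms 0) \<longleftrightarrow> cartan_image \<rho> UNIV = UNIV"
  proof
    assume "simple_module (fscale sc) ?S (F_act sc \<rho>) (forms 0)"
    then have "?H = forms 0" using H nonzero(1) by (auto simp: simple_module_def)
    then show "cartan_image \<rho> UNIV = UNIV" by (simp add: H_eq)
  next
    assume "cartan_image \<rho> UNIV = UNIV"
    then show "simple_module (fscale sc) ?S (F_act sc \<rho>) (forms 0)"
      using simple_module_iff_least[OF H nonzero(1) forms_submodule
          functions_least_submodule[OF n simple not_A]] H_eq by simp
  qed
  have b: "\<not> simple_module (fscale sc) ?S (F_act sc \<rho>) (forms k)" if k: "1 \<le> k" "k \<le> CARD('n) - 1" for k
  proof
    assume s: "simple_module (fscale sc) ?S (F_act sc \<rho>) (forms k)"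
    obtain m where m: "k = Suc m" using k(1) by (cases k) auto
    have "d ` forms m = {0} \<or> d ` forms m = forms k"
      using s exact_submodule[of m] by (simp add: simple_module_def m)
    moreover have "d ` forms m \<noteq> {0}"
    proof -
      have "m < CARD('n)" using k m by linarith
      then show ?thesis using d_nontrivial[OF z, of m] by blast
    qed
    moreover have "d ` forms m \<noteq> forms k"
      using d_nontrivial[OF z, of k] k n by (metis d_d imageE le_imp_less_Suc Suc_diff_1
          order_less_le_trans zero_less_numeral)
    ultimately show False by blast
  qed
  have c1: "unique_simple_submodule (fscale sc) ?S (F_act sc \<rho>) ?H (forms 0)"
    if "\<not> isomorphic_to_A sc \<rho>"
    by (rule unique_simple_submoduleI[OF H nonzero(1) functions_least_submodule[OF n simple that]])
  have c2: "\<exists>P'. subspace P' \<and> cartan_image \<rho> UNIV \<subseteq> P' \<and> N = tensor_product sc P' (exterior_power 0)"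
    if A: "\<not> isomorphic_to_A sc \<rho>"
      and N: "submodule (fscale sc) ?S (F_act sc \<rho>) N (forms 0)" "N \<noteq> {0}" for N
  proof -
    let ?P = "{p. basis_form [] p \<in> N}"
    have N': "F.subspace N" "N \<subseteq> forms 0" using N(1) by (auto simp: div_zero_submodule_iff)
    have P: "subspace ?P"
      using N'(1) by (simp add: subspace_def F.subspace_def basis_form_add basis_form_scale)
    have "N = basis_form [] ` ?P" using N'(2) by (auto simp: forms_0)
    moreover have "cartan_image \<rho> UNIV \<subseteq> ?P" using functions_least_submodule[OF n simple A N] by auto
    ultimately show ?thesis
      using P tensor_product_exterior_power_0[OF P] by (intro exI[of _ ?P]) simp
  qed
  have least1: "d ` ?H \<subseteq> N"
    if "submodule (fscale sc) ?S (F_act sc \<rho>) N (d ` forms 0)" "N \<noteq> {0}" for N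
    by (rule exact_1_forms_contain_cartan_image[OF n simple that])
  have d1: "unique_simple_submodule (fscale sc) ?S (F_act sc \<rho>) (d ` ?H) (d ` forms 0)"
    by (rule unique_simple_submoduleI[OF dH nonzero(2) least1])
  have d2: "d ` ?H = d ` forms 0" if "isomorphic_to_A sc \<rho>"
    by (rule exact_1_forms_eq_cartan_image[OF simple that])
  have d3: "simple_module (fscale sc) ?S (F_act sc \<rho>) (d ` forms 0) \<longleftrightarrow> d ` ?H = d ` forms 0"
    by (rule simple_module_iff_least[OF dH nonzero(2) exact least1])
  \<comment> \<open>Unless P is the module of Laurent polynomials, d is injective on functions.\<close>
  have d4: "d ` ?H = d ` forms 0 \<longleftrightarrow> cartan_image \<rho> UNIV = UNIV \<or> isomorphic_to_A sc \<rho>"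
  proof
    assume eq: "d ` ?H = d ` forms 0"
    show "cartan_image \<rho> UNIV = UNIV \<or> isomorphic_to_A sc \<rho>"
    proof (rule disjCI)
      assume A: "\<not> isomorphic_to_A sc \<rho>"
      have "p \<in> cartan_image \<rho> UNIV" for p
      proof -
        have "d (basis_form [] p) \<in> d ` ?H" unfolding eq using vac_forms by blast
        then obtain q where q: "q \<in> cartan_image \<rho> UNIV" "d (basis_form [] p) = d (basis_form [] q)"
          by auto
        have "d (basis_form [] (p - q)) + d (basis_form [] q) = d (basis_form [] p)"
          by (simp add: d_add[symmetric] basis_form_add[symmetric])
        then have "d (basis_form [] (p - q)) = 0" using q(2) by simp
        then have "p - q = 0"
          using A isomorphic_to_A_iff_killed[OF simple] d_vac_zero_iff by blast
        then show ?thesis using q(1) by simp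
      qed
      then show "cartan_image \<rho> UNIV = UNIV" by blast
    qed
  next
    assume "cartan_image \<rho> UNIV = UNIV \<or> isomorphic_to_A sc \<rho>"
    then show "d ` ?H = d ` forms 0" using d2 H_eq by auto
  qed
  have e: "simple_module (fscale sc) ?S (F_act sc \<rho>) (L_mod sc \<rho> k) \<and>
      maximal_submodule (fscale sc) ?S (F_act sc \<rho>) (L_tilde sc \<rho> k) (forms k)"
    if k: "2 \<le> k" "k \<le> CARD('n) - 1" for k
  proof -
    obtain m where m: "k = Suc m" "1 \<le> m" using k(1) by (cases k) auto
    have m_less: "m < CARD('n)" using k m by linarith
    then have "d ` forms m \<noteq> {0}" using d_nontrivial[OF z, of m] by blast
    then have "simple_module (fscale sc) ?S (F_act sc \<rho>) (d ` forms m)"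
      unfolding simple_module_def
      using exact exact_forms_no_proper_submodule[OF n simple m(2) m_less] by blast
    moreover have "maximal_submodule (fscale sc) ?S (F_act sc \<rho>) {y \<in> forms k. d y = 0} (forms k)"
      using k by (intro closed_forms_maximal[OF n simple]) auto
    ultimately show ?thesis by (simp add: m(1) L L_tilde_eq)
  qed
  show ?thesis
    unfolding F L1 hF hL
    using a b c1 c2 functions_isomorphic d1 d2 exact_1_forms_isomorphic d3 d4 e by auto
qed

end
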